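(* Let $V$ and $V'$ be left vector spaces of finite dimensions $n$ and $n'$ over division rings $R$ and $R'$, respectively, let $k\in\{2,\dots,n-2\}$, $k'\in\{2,\dots,n'-2\}$, and let $f$ be an isometric embedding of $\Gamma_{k}(V)$ in $\Gamma_{k'}(V')$. If $k\le n-k$ then one of the following holds: (A) there exist $S\in\mathcal G_{k'-k}(V')$ and a semilinear $(2k)$-embedding $l:V\to V'/S$ such that $f(X)=\pi(\langle l(X)\rangle)$ for every $X\in\mathcal G_k(V)$, where $\pi$ sends each subspace of $V'/S$ to its preimage in $V'$ under the quotient map $V'\to V'/S$; (B) there exist $U\in\mathcal G_{k'+k}(V')$ and a semilinear $(2k)$-embedding $v:V\to U^{*}$ such that for every $X\in\mathcal G_k(V)$, $f(X)$ is the annihilator of $\langle v(X)\rangle$ in $U$, i.e. $f(X)=\{u\in U:\varphi(u)=0 \text{ for all }\varphi\in\langle v(X)\rangle\}$. Moreover, in the case $n=2k$, there exist $S\in\mathcal G_{k'-k}(V')$ and $U\in\mathcal G_{k'+k}(V')$ with $S\subset U$ such that either there is a semilinear embedding $l:V\to U/S$ with $f(X)=\pi(\langle l(X)\rangle)$ for all $X\in\mathcal G_k(V)$, or there is a semilinear embedding $w:V\to (U/S)^{*}$ such that for all $X\in\mathcal G_k(V)$, $f(X)=\pi(Y_X)$ where $Y_X$ is the annihilator of $\langle w(X)\rangle$ in $U/S$ (here $\pi$ sends each subspace of $U/S\subset V'/S$ to its preimage in $V'$).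
   Context: For a vector space $W$ of dimension $m$ and $1\le p\le m-1$, $\mathcal G_p(W)$ is the set of $p$-dimensional subspaces of $W$, and the Grassmann graph $\Gamma_p(W)$ has vertex set $\mathcal G_p(W)$, two vertices adjacent iff their intersection is $(p-1)$-dimensional. An embedding of a graph $\Gamma$ in a graph $\Gamma'$ is an injective map on vertices such that two vertices are adjacent iff their images are adjacent; it is isometric if it preserves graph distance. For a left vector space $W$ over a division ring, $W^*$ denotes its dual space (a vector space over the opposite division ring). A map $l:V\to W$ between vector spaces over division rings $R$, $R''$ is semilinear if it is additive and there is a ring homomorphism $\sigma:R\to R''$ with $l(ax)=\sigma(a)l(x)$ for all $a\in R$, $x\in V$. A semilinear $m$-embedding is a semilinear injection such that the image of every linearly independent $m$-element subset is linearly independent; a semilinear embedding is a semilinear injection mapping every linearly independent subset to a linearly independent subset (equivalently, when $\dim V\le\dim W$, a semilinear $(\dim V)$-embedding). For a subset $A$, $\langle A\rangle$ denotes its linear span. *)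

theory Defs
  imports "Graph_Theory.Graph_Theory" "HOL-Algebra.Module" "HOL-Algebra.AbelCoset"
begin

section \<open>Left vector spaces over division rings\<close>

text \<open>
  The library's locale \<open>module\<close> (and the type-class \<open>vector_space\<close>) only allow commutative
  scalars, so the axioms of \<open>module\<close> are restated over a possibly non-commutative division ring.
  The fields \<open>mult\<close> and \<open>one\<close> of a module record carry no meaning.
\<close>

locale skew_field = ring +
  assumes one_not_zero: "\<one> \<noteq> \<zero>"
    and skew_field_Units: "Units R = carrier R - {\<zero>}"

locale left_vector_space = R?: skew_field R + M?: abelian_group M
  for R :: "('a, 'r) ring_scheme" (structure) and M :: "('a, 'v, 'm) module_scheme" (structure) +
  assumes smult_closed:
      "\<lbrakk>a \<in> carrier R; x \<in> carrier M\<rbrakk> \<Longrightarrow> a \<odot>\<^bsub>M\<^esub> x \<in> carrier M"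
    and smult_l_distr:
      "\<lbrakk>a \<in> carrier R; b \<in> carrier R; x \<in> carrier M\<rbrakk> \<Longrightarrow>
       (a \<oplus> b) \<odot>\<^bsub>M\<^esub> x = a \<odot>\<^bsub>M\<^esub> x \<oplus>\<^bsub>M\<^esub> b \<odot>\<^bsub>M\<^esub> x"
    and smult_r_distr:
      "\<lbrakk>a \<in> carrier R; x \<in> carrier M; y \<in> carrier M\<rbrakk> \<Longrightarrow>
       a \<odot>\<^bsub>M\<^esub> (x \<oplus>\<^bsub>M\<^esub> y) = a \<odot>\<^bsub>M\<^esub> x \<oplus>\<^bsub>M\<^esub> a \<odot>\<^bsub>M\<^esub> y"
    and smult_assoc:
      "\<lbrakk>a \<in> carrier R; b \<in> carrier R; x \<in> carrier M\<rbrakk> \<Longrightarrow>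
       (a \<otimes> b) \<odot>\<^bsub>M\<^esub> x = a \<odot>\<^bsub>M\<^esub> (b \<odot>\<^bsub>M\<^esub> x)"
    and smult_one:
      "x \<in> carrier M \<Longrightarrow> \<one> \<odot>\<^bsub>M\<^esub> x = x"

definition lin_span :: "('a, 'r) ring_scheme \<Rightarrow> ('a, 'v, 'm) module_scheme \<Rightarrow> 'v set \<Rightarrow> 'v set" where
  "lin_span R V A =
     {finsum V (\<lambda>v. c v \<odot>\<^bsub>V\<^esub> v) F | F c. finite F \<and> F \<subseteq> A \<and> c \<in> F \<rightarrow> carrier R}"

definition lin_indep :: "('a, 'r) ring_scheme \<Rightarrow> ('a, 'v, 'm) module_scheme \<Rightarrow> 'v set \<Rightarrow> bool" where
  "lin_indep R V A \<longleftrightarrow> A \<subseteq> carrier V \<and>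
     (\<forall>F c. finite F \<longrightarrow> F \<subseteq> A \<longrightarrow> c \<in> F \<rightarrow> carrier R \<longrightarrow>
        finsum V (\<lambda>v. c v \<odot>\<^bsub>V\<^esub> v) F = \<zero>\<^bsub>V\<^esub> \<longrightarrow> (\<forall>v\<in>F. c v = \<zero>\<^bsub>R\<^esub>))"

definition has_dim :: "('a, 'r) ring_scheme \<Rightarrow> ('a, 'v, 'm) module_scheme \<Rightarrow> nat \<Rightarrow> bool" where
  "has_dim R V n \<longleftrightarrow>
     (\<exists>B. lin_indep R V B \<and> lin_span R V B = carrier V \<and> finite B \<and> card B = n)"

text \<open>
  A subspace is a \<open>submodule\<close>; as a vector space in its own right it is \<open>V\<lparr>carrier := X\<rparr>\<close>.
\<close>

definition grassmannian ::
    "('a, 'r) ring_scheme \<Rightarrow> ('a, 'v, 'm) module_scheme \<Rightarrow> nat \<Rightarrow> 'v set set" where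
  "grassmannian R V p = {X. submodule X R V \<and> has_dim R (V\<lparr>carrier := X\<rparr>) p}"


section \<open>Quotient spaces, opposite ring and dual spaces\<close>

text \<open>
  Vectors of the quotient by \<open>S\<close> are the cosets of \<open>S\<close>. For \<open>S \<subseteq> U\<close> the space
  \<open>quot_space (V\<lparr>carrier := U\<rparr>) S\<close> is literally a subspace of \<open>quot_space V S\<close>.
\<close>

definition quot_space :: "('a, 'v, 'm) module_scheme \<Rightarrow> 'v set \<Rightarrow> ('a, 'v set) module" where
  "quot_space V S =
     \<lparr>carrier = a_rcosets\<^bsub>V\<^esub> S, mult = undefined, one = undefined, zero = S, add = set_add V,
      smult = (\<lambda>a X. \<Union>x\<in>X. S +>\<^bsub>V\<^esub> (a \<odot>\<^bsub>V\<^esub> x))\<rparr>"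

definition quot_preimage :: "('a, 'v, 'm) module_scheme \<Rightarrow> 'v set \<Rightarrow> 'v set set \<Rightarrow> 'v set" where
  "quot_preimage V S Y = {x \<in> carrier V. S +>\<^bsub>V\<^esub> x \<in> Y}"

definition opposite_ring :: "('a, 'r) ring_scheme \<Rightarrow> ('a, 'r) ring_scheme" where
  "opposite_ring R = R\<lparr>mult := (\<lambda>a b. b \<otimes>\<^bsub>R\<^esub> a)\<rparr>"

text \<open>
  The linear functionals on a left vector space form a right vector space over \<open>R\<close>, that is, a left
  vector space over \<open>opposite_ring R\<close>. Functionals are taken to be \<open>undefined\<close> outside the
  carrier, so that equality of functionals is equality on the carrier.
\<close>

definition dual_space ::
    "('a, 'r) ring_scheme \<Rightarrow> ('a, 'v, 'm) module_scheme \<Rightarrow> ('a, 'v \<Rightarrow> 'a) module" where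
  "dual_space R V =
     \<lparr>carrier = {\<phi> \<in> carrier V \<rightarrow>\<^sub>E carrier R.
        (\<forall>x\<in>carrier V. \<forall>y\<in>carrier V. \<phi> (x \<oplus>\<^bsub>V\<^esub> y) = \<phi> x \<oplus>\<^bsub>R\<^esub> \<phi> y) \<and>
        (\<forall>a\<in>carrier R. \<forall>x\<in>carrier V. \<phi> (a \<odot>\<^bsub>V\<^esub> x) = a \<otimes>\<^bsub>R\<^esub> \<phi> x)},
      mult = undefined, one = undefined,
      zero = (\<lambda>x\<in>carrier V. \<zero>\<^bsub>R\<^esub>),
      add = (\<lambda>\<phi> \<psi>. \<lambda>x\<in>carrier V. \<phi> x \<oplus>\<^bsub>R\<^esub> \<psi> x),
      smult = (\<lambda>a \<phi>. \<lambda>x\<in>carrier V. \<phi> x \<otimes>\<^bsub>R\<^esub> a)\<rparr>"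

definition annihilator ::
    "('a, 'r) ring_scheme \<Rightarrow> ('a, 'v, 'm) module_scheme \<Rightarrow> ('v \<Rightarrow> 'a) set \<Rightarrow> 'v set" where
  "annihilator R V \<Phi> = {x \<in> carrier V. \<forall>\<phi>\<in>\<Phi>. \<phi> x = \<zero>\<^bsub>R\<^esub>}"


section \<open>Semilinear embeddings\<close>

definition semilinear ::
    "('a, 'r) ring_scheme \<Rightarrow> ('a, 'v, 'm) module_scheme \<Rightarrow>
     ('b, 's) ring_scheme \<Rightarrow> ('b, 'w, 'n) module_scheme \<Rightarrow> ('v \<Rightarrow> 'w) \<Rightarrow> bool" where
  "semilinear R V R' W l \<longleftrightarrow> l \<in> carrier V \<rightarrow> carrier W \<and>
     (\<forall>x\<in>carrier V. \<forall>y\<in>carrier V. l (x \<oplus>\<^bsub>V\<^esub> y) = l x \<oplus>\<^bsub>W\<^esub> l y) \<and>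
     (\<exists>\<sigma>\<in>ring_hom R R'. \<forall>a\<in>carrier R. \<forall>x\<in>carrier V. l (a \<odot>\<^bsub>V\<^esub> x) = \<sigma> a \<odot>\<^bsub>W\<^esub> l x)"

definition semilinear_m_embedding ::
    "nat \<Rightarrow> ('a, 'r) ring_scheme \<Rightarrow> ('a, 'v, 'm) module_scheme \<Rightarrow>
     ('b, 's) ring_scheme \<Rightarrow> ('b, 'w, 'n) module_scheme \<Rightarrow> ('v \<Rightarrow> 'w) \<Rightarrow> bool" where
  "semilinear_m_embedding m R V R' W l \<longleftrightarrow> semilinear R V R' W l \<and> inj_on l (carrier V) \<and>
     (\<forall>A. lin_indep R V A \<and> finite A \<and> card A = m \<longrightarrow> lin_indep R' W (l ` A))"

definition semilinear_embedding ::
    "('a, 'r) ring_scheme \<Rightarrow> ('a, 'v, 'm) module_scheme \<Rightarrow>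
     ('b, 's) ring_scheme \<Rightarrow> ('b, 'w, 'n) module_scheme \<Rightarrow> ('v \<Rightarrow> 'w) \<Rightarrow> bool" where
  "semilinear_embedding R V R' W l \<longleftrightarrow> semilinear R V R' W l \<and> inj_on l (carrier V) \<and>
     (\<forall>A. lin_indep R V A \<longrightarrow> lin_indep R' W (l ` A))"


section \<open>Grassmann graphs and isometric embeddings\<close>

text \<open>
  An undirected graph is represented by the digraph with both orientations of every edge. Only
  \<open>p \<ge> 1\<close> is meaningful, because of the truncated subtraction \<open>p - 1\<close>.
\<close>

definition grassmann_graph ::
    "('a, 'r) ring_scheme \<Rightarrow> ('a, 'v, 'm) module_scheme \<Rightarrow> nat \<Rightarrow> 'v set pair_pre_digraph" where
  "grassmann_graph R V p =
     \<lparr>pverts = grassmannian R V p,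
      parcs = {(X, Y). X \<in> grassmannian R V p \<and> Y \<in> grassmannian R V p \<and>
                       X \<inter> Y \<in> grassmannian R V (p - 1)}\<rparr>"

lemma grassmann_graph_sym: "pair_sym_digraph (grassmann_graph R V p)"
  by unfold_locales
     (auto simp: grassmann_graph_def symmetric_def sym_def arcs_ends_def arc_to_ends_def
        with_proj_def Int_commute)

text \<open>
  The library's \<open>\<mu>\<close> is the infimum of the walk costs; with all arcs of cost \<open>1\<close> it is the number
  of edges of a shortest walk, and infinite if there is none.
\<close>

definition graph_dist :: "'v pair_pre_digraph \<Rightarrow> 'v \<Rightarrow> 'v \<Rightarrow> ereal" where
  "graph_dist G = wf_digraph.\<mu> (with_proj G) (\<lambda>_. 1)"

definition graph_embedding ::
    "'v pair_pre_digraph \<Rightarrow> 'w pair_pre_digraph \<Rightarrow> ('v \<Rightarrow> 'w) \<Rightarrow> bool" where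
  "graph_embedding G H f \<longleftrightarrow> f \<in> pverts G \<rightarrow> pverts H \<and> inj_on f (pverts G) \<and>
     (\<forall>x\<in>pverts G. \<forall>y\<in>pverts G. (x, y) \<in> parcs G \<longleftrightarrow> (f x, f y) \<in> parcs H)"

definition isometric_embedding ::
    "'v pair_pre_digraph \<Rightarrow> 'w pair_pre_digraph \<Rightarrow> ('v \<Rightarrow> 'w) \<Rightarrow> bool" where
  "isometric_embedding G H f \<longleftrightarrow> graph_embedding G H f \<and>
     (\<forall>x\<in>pverts G. \<forall>y\<in>pverts G. graph_dist H (f x) (f y) = graph_dist G x y)"

end

theory Submission
  imports Defs
begin

text \<open>
  Distances in Grassmann graphs are given by \<open>k - dim (X \<inter> Y)\<close>, so an isometric embedding satisfies
  \<open>dim (f X \<inter> f Y) = k' - k + dim (X \<inter> Y)\<close> and \<open>dim (f X + f Y) = k' + k - dim (X \<inter> Y)\<close>. These two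
  equations are exchanged by reversing the order of the subspaces of \<open>V'\<close>, and so are the cases (A)
  and (B).

  Either all stars are mapped into stars or all stars are mapped into tops; up to reversing the order,
  assume the former. By downward induction on the dimension of \<open>A = X \<inter> Y\<close>, the intersection
  \<open>f X \<inter> f Y\<close> depends only on \<open>A\<close>. This extends \<open>f\<close> to all subspaces of dimension at most \<open>k\<close>, raising
  every dimension by \<open>k' - k\<close>. The value at \<open>0\<close> is \<open>S\<close>, points of \<open>V\<close> go to points of \<open>V'/S\<close>, and
  lines and the independence of up to three points are preserved, so the fundamental theorem of
  projective geometry gives \<open>l\<close>. Opposite vertices have images whose sum has dimension \<open>k' + k\<close>, hence
  \<open>l\<close> preserves the independence of \<open>2k\<close> vectors.

  If \<open>n = 2k\<close>, then the image under \<open>l\<close> of a basis of \<open>V\<close> spans a subspace \<open>U\<close> that contains all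
  \<open>f X\<close>, and the construction can be repeated with \<open>U/S\<close> in place of \<open>V'/S\<close>.
\<close>

section \<open>Linear algebra over division rings\<close>

text \<open>An isometric embedding is used only through the ranks of the elements
  \<open>f X \<inter>\<^sub>L f Y\<close>, and the argument takes place in a modular lattice. Ranks
  are integers so that reversing the order, with the rank negated, is again an instance. The
  obstacle is mixed behaviour of stars. Adjacency by itself only says that three pairwise adjacent
  images share their meet or share their join, and it does not relate the alternatives taken by
  different triples. Distance two does: a vertex \<open>Z\<close> that contains X \<inter> Y but is
  not inside X + Y, and a vertex \<open>W\<close> inside X + Y that does not contain X \<inter> Y,
  are at distance two. Their images can therefore neither both lie above the meet of the images of
  \<open>X\<close> and \<open>Y\<close> nor both below the join, so the behaviour of one determines
  that of the other. The hypothesis k \<le> n - k makes room: two subspaces of dimension at most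
  \<open>k\<close> extend to vertices with the same intersection. This gives every small subspace a
  representation by vertices and bounds the intersections of extended images.\<close>

context left_vector_space
begin

section \<open>Subspaces and scalar multiples\<close>

text \<open>Closure under negation, which \<open>submodule\<close> demands through
  \<open>subgroup\<close>, follows from multiplication by \<ominus>1; hence four familiar closure
  conditions suffice.\<close>

lemma subspaceI:
  assumes "X \<subseteq> carrier M" "\<zero>\<^bsub>M\<^esub> \<in> X"
    and "\<And>x y. x \<in> X \<Longrightarrow> y \<in> X \<Longrightarrow> x \<oplus>\<^bsub>M\<^esub> y \<in> X"
    and "\<And>a x. a \<in> carrier R \<Longrightarrow> x \<in> X \<Longrightarrow> a \<odot>\<^bsub>M\<^esub> x \<in> X"
  shows "submodule X R M"
proof -
  have "\<ominus>\<^bsub>M\<^esub> x \<in> X" if x: "x \<in> X" for x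
  proof -
    have xM: "x \<in> carrier M" using x assms(1) by auto
    have "\<zero> \<odot>\<^bsub>M\<^esub> x \<oplus>\<^bsub>M\<^esub> \<zero> \<odot>\<^bsub>M\<^esub> x = \<zero> \<odot>\<^bsub>M\<^esub> x"
      using smult_l_distr[of \<zero> \<zero> x] xM by simp
    then have z: "\<zero> \<odot>\<^bsub>M\<^esub> x = \<zero>\<^bsub>M\<^esub>"
      using xM by (simp add: smult_closed M.add.r_cancel_one')
    have "(\<ominus> \<one>) \<odot>\<^bsub>M\<^esub> x \<oplus>\<^bsub>M\<^esub> x = \<zero>\<^bsub>M\<^esub>"
      using smult_l_distr[of "\<ominus> \<one>" \<one> x] xM z by (simp add: R.l_neg smult_one)
    then have "\<ominus>\<^bsub>M\<^esub> x = (\<ominus> \<one>) \<odot>\<^bsub>M\<^esub> x"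
      using xM by (simp add: M.minus_equality smult_closed)
    then show ?thesis using assms(4) x by simp
  qed
  then show ?thesis
    using assms unfolding submodule_def submodule_axioms_def
    by (auto intro!: subgroup.intro simp: a_inv_def)
qed

lemma subspace_subset: "submodule X R M \<Longrightarrow> X \<subseteq> carrier M"
  using subgroup.subset[of X "add_monoid M"] by (auto simp: submodule_def)

lemma subspace_memD: "submodule X R M \<Longrightarrow> x \<in> X \<Longrightarrow> x \<in> carrier M"
  using subspace_subset by blast

lemma subspace_zero: "submodule X R M \<Longrightarrow> \<zero>\<^bsub>M\<^esub> \<in> X"
  using subgroup.one_closed[of X "add_monoid M"] by (auto simp: submodule_def)

lemma subspace_add: "submodule X R M \<Longrightarrow> x \<in> X \<Longrightarrow> y \<in> X \<Longrightarrow> x \<oplus>\<^bsub>M\<^esub> y \<in> X"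
  using subgroup.m_closed[of X "add_monoid M"] by (auto simp: submodule_def)

lemma subspace_neg: "submodule X R M \<Longrightarrow> x \<in> X \<Longrightarrow> \<ominus>\<^bsub>M\<^esub> x \<in> X"
  using subgroup.m_inv_closed[of X "add_monoid M"] by (auto simp: submodule_def a_inv_def)

lemma subspace_smult: "submodule X R M \<Longrightarrow> a \<in> carrier R \<Longrightarrow> x \<in> X \<Longrightarrow> a \<odot>\<^bsub>M\<^esub> x \<in> X"
  by (auto simp: submodule_def submodule_axioms_def)

lemma subspace_carrier: "submodule (carrier M) R M"
  by (rule subspaceI) (auto intro: smult_closed)

lemma subspace_Int: "submodule X R M \<Longrightarrow> submodule Y R M \<Longrightarrow> submodule (X \<inter> Y) R M"
  by (rule subspaceI)
    (auto dest: subspace_memD intro: subspace_zero subspace_add subspace_smult)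

lemma smult_l_null: "x \<in> carrier M \<Longrightarrow> \<zero> \<odot>\<^bsub>M\<^esub> x = \<zero>\<^bsub>M\<^esub>"
  using smult_l_distr[of \<zero> \<zero> x] by (simp add: smult_closed M.add.r_cancel_one')

lemma smult_r_null: "a \<in> carrier R \<Longrightarrow> a \<odot>\<^bsub>M\<^esub> \<zero>\<^bsub>M\<^esub> = \<zero>\<^bsub>M\<^esub>"
  using smult_r_distr[of a "\<zero>\<^bsub>M\<^esub>" "\<zero>\<^bsub>M\<^esub>"] by (simp add: smult_closed M.add.r_cancel_one')

lemma smult_l_minus:
  assumes "a \<in> carrier R" "x \<in> carrier M"
  shows "(\<ominus> a) \<odot>\<^bsub>M\<^esub> x = \<ominus>\<^bsub>M\<^esub> (a \<odot>\<^bsub>M\<^esub> x)"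
proof -
  have "(\<ominus> a) \<odot>\<^bsub>M\<^esub> x \<oplus>\<^bsub>M\<^esub> a \<odot>\<^bsub>M\<^esub> x = \<zero>\<^bsub>M\<^esub>"
    using smult_l_distr[of "\<ominus> a" a x] assms by (simp add: R.l_neg smult_l_null)
  then show ?thesis using assms by (simp add: M.minus_equality smult_closed)
qed

lemma smult_r_minus:
  assumes "a \<in> carrier R" "x \<in> carrier M"
  shows "a \<odot>\<^bsub>M\<^esub> (\<ominus>\<^bsub>M\<^esub> x) = \<ominus>\<^bsub>M\<^esub> (a \<odot>\<^bsub>M\<^esub> x)"
proof -
  have "a \<odot>\<^bsub>M\<^esub> (\<ominus>\<^bsub>M\<^esub> x) \<oplus>\<^bsub>M\<^esub> a \<odot>\<^bsub>M\<^esub> x = \<zero>\<^bsub>M\<^esub>"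
    using smult_r_distr[of a "\<ominus>\<^bsub>M\<^esub> x" x] assms by (simp add: M.l_neg smult_r_null)
  then show ?thesis using assms by (simp add: M.minus_equality smult_closed)
qed

lemma inv_nonzero:
  assumes "a \<in> carrier R" "a \<noteq> \<zero>"
  shows "inv a \<in> carrier R" "inv a \<otimes> a = \<one>" "a \<otimes> inv a = \<one>" "inv a \<noteq> \<zero>"
proof -
  have u: "a \<in> Units R" using assms skew_field_Units by auto
  then show "inv a \<in> carrier R" "inv a \<otimes> a = \<one>" "a \<otimes> inv a = \<one>" by auto
  then show "inv a \<noteq> \<zero>" using assms one_not_zero by auto
qed

lemma smult_inv_cancel:
  assumes "a \<in> carrier R" "a \<noteq> \<zero>" "x \<in> carrier M"
  shows "inv a \<odot>\<^bsub>M\<^esub> (a \<odot>\<^bsub>M\<^esub> x) = x" "a \<odot>\<^bsub>M\<^esub> (inv a \<odot>\<^bsub>M\<^esub> x) = x"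
  using assms inv_nonzero[OF assms(1,2)] by (simp_all add: smult_assoc[symmetric] smult_one)

lemma smult_eq_zeroD:
  assumes "a \<in> carrier R" "x \<in> carrier M" "a \<odot>\<^bsub>M\<^esub> x = \<zero>\<^bsub>M\<^esub>"
  shows "a = \<zero> \<or> x = \<zero>\<^bsub>M\<^esub>"
  using smult_inv_cancel(1)[of a x] assms inv_nonzero[of a] smult_r_null by metis

lemma subspace_smult_cancel:
  assumes "submodule X R M" "a \<in> carrier R" "a \<noteq> \<zero>" "x \<in> carrier M" "a \<odot>\<^bsub>M\<^esub> x \<in> X"
  shows "x \<in> X"
  using subspace_smult[OF assms(1) inv_nonzero(1)[OF assms(2,3)] assms(5)]
    smult_inv_cancel(1)[OF assms(2-4)] by simp

lemma subspace_add_cancel_left: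
  assumes "submodule X R M" "x \<in> X" "y \<in> carrier M" "x \<oplus>\<^bsub>M\<^esub> y \<in> X"
  shows "y \<in> X"
proof -
  have "\<ominus>\<^bsub>M\<^esub> x \<oplus>\<^bsub>M\<^esub> (x \<oplus>\<^bsub>M\<^esub> y) \<in> X"
    by (rule subspace_add[OF assms(1) subspace_neg[OF assms(1,2)] assms(4)])
  then show ?thesis using assms subspace_memD[OF assms(1,2)] M.r_neg1 M.r_neg2 by metis
qed

lemma subspace_add_cancel_right:
  assumes "submodule X R M" "y \<in> X" "x \<in> carrier M" "x \<oplus>\<^bsub>M\<^esub> y \<in> X"
  shows "x \<in> X"
  using subspace_add_cancel_left[of X y x] assms subspace_memD[OF assms(1,2)] M.a_comm by auto

lemma subspace_finsum:
  assumes "submodule X R M" "finite F" "F \<subseteq> X" "c \<in> F \<rightarrow> carrier R"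
  shows "finsum M (\<lambda>v. c v \<odot>\<^bsub>M\<^esub> v) F \<in> X"
  using assms(2,3,4)
proof (induction F rule: finite_induct)
  case empty
  then show ?case using subspace_zero[OF assms(1)] by simp
next
  case (insert x F)
  have "finsum M (\<lambda>v. c v \<odot>\<^bsub>M\<^esub> v) (insert x F) =
      c x \<odot>\<^bsub>M\<^esub> x \<oplus>\<^bsub>M\<^esub> finsum M (\<lambda>v. c v \<odot>\<^bsub>M\<^esub> v) F"
    using insert subspace_memD[OF assms(1)]
    by (intro M.finsum_insert) (auto intro!: smult_closed)
  then show ?case
    using insert by (auto intro!: subspace_add[OF assms(1)] subspace_smult[OF assms(1)])
qed

section \<open>Linear spans\<close>

lemma lin_spanI:
  assumes "finite F" "F \<subseteq> A" "c \<in> F \<rightarrow> carrier R"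
  shows "finsum M (\<lambda>v. c v \<odot>\<^bsub>M\<^esub> v) F \<in> lin_span R M A"
  unfolding lin_span_def
  by (rule CollectI, rule exI[of _ F], rule exI[of _ c]) (simp add: assms)

lemma lin_spanE:
  assumes "x \<in> lin_span R M A"
  obtains F c where "finite F" "F \<subseteq> A" "c \<in> F \<rightarrow> carrier R"
    "x = finsum M (\<lambda>v. c v \<odot>\<^bsub>M\<^esub> v) F"
  using assms unfolding lin_span_def by auto

lemma lin_span_mem:
  assumes "A \<subseteq> carrier M" "x \<in> A"
  shows "x \<in> lin_span R M A"
proof -
  have "finsum M (\<lambda>v. \<one> \<odot>\<^bsub>M\<^esub> v) {x} = x"
    using assms by (subst M.finsum_insert) (auto simp: smult_one subset_eq)
  then show ?thesis using assms unfolding lin_span_def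
    by (intro CollectI exI[of _ "{x}"] exI[of _ "\<lambda>_. \<one>"]) auto
qed

lemma lin_span_subspace:
  assumes A: "A \<subseteq> carrier M"
  shows "submodule (lin_span R M A) R M"
proof (rule subspaceI)
  show "lin_span R M A \<subseteq> carrier M"
    unfolding lin_span_def using subspace_finsum[OF subspace_carrier] A by blast
  show "\<zero>\<^bsub>M\<^esub> \<in> lin_span R M A"
    unfolding lin_span_def by (intro CollectI exI[of _ "{}"]) auto
next
  fix x y assume "x \<in> lin_span R M A" "y \<in> lin_span R M A"
  then obtain F c G d where
    F: "finite F" "F \<subseteq> A" "c \<in> F \<rightarrow> carrier R" "x = finsum M (\<lambda>v. c v \<odot>\<^bsub>M\<^esub> v) F" and
    G: "finite G" "G \<subseteq> A" "d \<in> G \<rightarrow> carrier R" "y = finsum M (\<lambda>v. d v \<odot>\<^bsub>M\<^esub> v) G"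
    unfolding lin_span_def by auto
  \<comment> \<open>Both coefficient families are extended by zero so that the two sums range over
    the same finite set \<open>F \<union> G\<close> and can be added termwise.\<close>
  define c' where "c' v = (if v \<in> F then c v else \<zero>)" for v
  define d' where "d' v = (if v \<in> G then d v else \<zero>)" for v
  have c': "c' v \<in> carrier R" and d': "d' v \<in> carrier R" for v
    using F(3) G(3) by (auto simp: c'_def d'_def)
  have UM: "v \<in> carrier M" if "v \<in> F \<union> G" for v using that F(2) G(2) A by auto
  have "x = finsum M (\<lambda>v. c' v \<odot>\<^bsub>M\<^esub> v) (F \<union> G)"
    unfolding F(4) using F(1) G(1) UM c'
    by (intro M.add.finprod_mono_neutral_cong_left)
      (auto simp: c'_def smult_l_null intro!: smult_closed)
  moreover have "y = finsum M (\<lambda>v. d' v \<odot>\<^bsub>M\<^esub> v) (F \<union> G)"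
    unfolding G(4) using F(1) G(1) UM d'
    by (intro M.add.finprod_mono_neutral_cong_left)
      (auto simp: d'_def smult_l_null intro!: smult_closed)
  ultimately have "x \<oplus>\<^bsub>M\<^esub> y = finsum M (\<lambda>v. c' v \<odot>\<^bsub>M\<^esub> v \<oplus>\<^bsub>M\<^esub> d' v \<odot>\<^bsub>M\<^esub> v) (F \<union> G)"
    using UM c' d' by (subst M.finsum_addf) (auto intro!: smult_closed)
  also have "\<dots> = finsum M (\<lambda>v. (c' v \<oplus> d' v) \<odot>\<^bsub>M\<^esub> v) (F \<union> G)"
    using UM c' d' by (intro M.finsum_cong') (auto simp: smult_l_distr intro!: smult_closed)
  finally show "x \<oplus>\<^bsub>M\<^esub> y \<in> lin_span R M A"
    unfolding lin_span_def using F(1,2) G(1,2) c' d'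
    by (intro CollectI exI[of _ "F \<union> G"] exI[of _ "\<lambda>v. c' v \<oplus> d' v"]) auto
next
  fix a x assume a: "a \<in> carrier R" and "x \<in> lin_span R M A"
  then obtain F c where
    F: "finite F" "F \<subseteq> A" "c \<in> F \<rightarrow> carrier R" "x = finsum M (\<lambda>v. c v \<odot>\<^bsub>M\<^esub> v) F"
    unfolding lin_span_def by auto
  have "a \<odot>\<^bsub>M\<^esub> finsum M (\<lambda>v. c v \<odot>\<^bsub>M\<^esub> v) F = finsum M (\<lambda>v. (a \<otimes> c v) \<odot>\<^bsub>M\<^esub> v) F"
    using F(1,2,3)
  proof (induction F rule: finite_induct)
    case empty
    then show ?case using a by (simp add: smult_r_null)
  next
    case (insert x F)
    then have x: "x \<in> carrier M" "c x \<in> carrier R" "F \<subseteq> carrier M" "c \<in> F \<rightarrow> carrier R"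
      using A by auto
    have "finsum M (\<lambda>v. c v \<odot>\<^bsub>M\<^esub> v) F \<in> carrier M"
      using x insert.hyps by (intro subspace_finsum[OF subspace_carrier]) auto
    moreover have "finsum M (\<lambda>v. c v \<odot>\<^bsub>M\<^esub> v) (insert x F) =
        c x \<odot>\<^bsub>M\<^esub> x \<oplus>\<^bsub>M\<^esub> finsum M (\<lambda>v. c v \<odot>\<^bsub>M\<^esub> v) F"
      using insert.hyps x by (intro M.finsum_insert) (auto intro!: smult_closed)
    moreover have "finsum M (\<lambda>v. (a \<otimes> c v) \<odot>\<^bsub>M\<^esub> v) (insert x F) =
        (a \<otimes> c x) \<odot>\<^bsub>M\<^esub> x \<oplus>\<^bsub>M\<^esub> finsum M (\<lambda>v. (a \<otimes> c v) \<odot>\<^bsub>M\<^esub> v) F"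
      using insert.hyps x a by (intro M.finsum_insert) (auto intro!: smult_closed)
    ultimately show ?case
      using insert x a by (simp add: smult_r_distr smult_assoc smult_closed)
  qed
  then have "a \<odot>\<^bsub>M\<^esub> x = finsum M (\<lambda>v. (a \<otimes> c v) \<odot>\<^bsub>M\<^esub> v) F" by (simp only: F(4))
  moreover have "(\<lambda>v. a \<otimes> c v) \<in> F \<rightarrow> carrier R" using F(3) a by auto
  ultimately show "a \<odot>\<^bsub>M\<^esub> x \<in> lin_span R M A"
    using lin_spanI[OF F(1,2)] by simp
qed

lemma lin_span_subset:
  assumes "submodule X R M" "A \<subseteq> X"
  shows "lin_span R M A \<subseteq> X"
proof
  fix x assume "x \<in> lin_span R M A"
  then obtain F c where "finite F" "F \<subseteq> A" "c \<in> F \<rightarrow> carrier R"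
    "x = finsum M (\<lambda>v. c v \<odot>\<^bsub>M\<^esub> v) F" by (rule lin_spanE)
  then show "x \<in> X" using subspace_finsum[OF assms(1), of F c] assms(2) by auto
qed

lemma lin_span_superset: "A \<subseteq> carrier M \<Longrightarrow> A \<subseteq> lin_span R M A"
  using lin_span_mem by blast

lemma lin_span_carrier: "A \<subseteq> carrier M \<Longrightarrow> lin_span R M A \<subseteq> carrier M"
  using lin_span_subspace subspace_subset by blast

lemma lin_span_memD: "A \<subseteq> carrier M \<Longrightarrow> x \<in> lin_span R M A \<Longrightarrow> x \<in> carrier M"
  using lin_span_carrier by blast

lemma lin_span_mono:
  assumes "A \<subseteq> B" "B \<subseteq> carrier M"
  shows "lin_span R M A \<subseteq> lin_span R M B"
  using assms by (intro lin_span_subset lin_span_subspace order_trans[OF assms(1) lin_span_superset])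

lemma lin_span_subspace_eq: "submodule X R M \<Longrightarrow> lin_span R M X = X"
  by (simp add: antisym lin_span_subset lin_span_superset subspace_subset)

lemma lin_span_empty: "lin_span R M {} = {\<zero>\<^bsub>M\<^esub>}"
  unfolding lin_span_def by auto

lemma subspace_zero_set: "submodule {\<zero>\<^bsub>M\<^esub>} R M"
  using lin_span_subspace[of "{}"] by (simp add: lin_span_empty)

lemma lin_span_Un_eq:
  assumes "X \<subseteq> carrier M" "Y \<subseteq> carrier M"
  shows "lin_span R M (X \<union> lin_span R M Y) = lin_span R M (X \<union> Y)"
proof (rule antisym)
  have "lin_span R M Y \<subseteq> lin_span R M (X \<union> Y)" using assms by (intro lin_span_mono) auto
  moreover have "X \<subseteq> lin_span R M (X \<union> Y)" using lin_span_superset[of "X \<union> Y"] assms by auto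
  ultimately show "lin_span R M (X \<union> lin_span R M Y) \<subseteq> lin_span R M (X \<union> Y)"
    using assms by (intro lin_span_subset lin_span_subspace) auto
  show "lin_span R M (X \<union> Y) \<subseteq> lin_span R M (X \<union> lin_span R M Y)"
    using assms lin_span_superset[of Y] lin_span_carrier[of Y] by (intro lin_span_mono) auto
qed

lemma sum_subspace:
  assumes "submodule X R M" "submodule Y R M"
  shows "submodule {x \<oplus>\<^bsub>M\<^esub> y | x y. x \<in> X \<and> y \<in> Y} R M"
proof (rule subspaceI)
  show "{x \<oplus>\<^bsub>M\<^esub> y | x y. x \<in> X \<and> y \<in> Y} \<subseteq> carrier M"
    using assms by (auto dest: subspace_memD)
  show "\<zero>\<^bsub>M\<^esub> \<in> {x \<oplus>\<^bsub>M\<^esub> y | x y. x \<in> X \<and> y \<in> Y}"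
    using subspace_zero[OF assms(1)] subspace_zero[OF assms(2)]
    by (intro CollectI exI[of _ "\<zero>\<^bsub>M\<^esub>"]) auto
next
  fix u v assume "u \<in> {x \<oplus>\<^bsub>M\<^esub> y | x y. x \<in> X \<and> y \<in> Y}" "v \<in> {x \<oplus>\<^bsub>M\<^esub> y | x y. x \<in> X \<and> y \<in> Y}"
  then obtain x y x' y' where xy: "x \<in> X" "y \<in> Y" "x' \<in> X" "y' \<in> Y"
    and uv: "u = x \<oplus>\<^bsub>M\<^esub> y" "v = x' \<oplus>\<^bsub>M\<^esub> y'" by auto
  have "u \<oplus>\<^bsub>M\<^esub> v = (x \<oplus>\<^bsub>M\<^esub> x') \<oplus>\<^bsub>M\<^esub> (y \<oplus>\<^bsub>M\<^esub> y')"
    using xy subspace_memD[OF assms(1)] subspace_memD[OF assms(2)] by (simp add: uv M.a_ac)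
  then show "u \<oplus>\<^bsub>M\<^esub> v \<in> {x \<oplus>\<^bsub>M\<^esub> y | x y. x \<in> X \<and> y \<in> Y}"
    using xy subspace_add[OF assms(1)] subspace_add[OF assms(2)] by blast
next
  fix a u assume a: "a \<in> carrier R" and "u \<in> {x \<oplus>\<^bsub>M\<^esub> y | x y. x \<in> X \<and> y \<in> Y}"
  then obtain x y where xy: "x \<in> X" "y \<in> Y" and u: "u = x \<oplus>\<^bsub>M\<^esub> y" by auto
  have "a \<odot>\<^bsub>M\<^esub> u = a \<odot>\<^bsub>M\<^esub> x \<oplus>\<^bsub>M\<^esub> a \<odot>\<^bsub>M\<^esub> y"
    using a xy subspace_memD[OF assms(1)] subspace_memD[OF assms(2)]
    by (simp add: u smult_r_distr)
  then show "a \<odot>\<^bsub>M\<^esub> u \<in> {x \<oplus>\<^bsub>M\<^esub> y | x y. x \<in> X \<and> y \<in> Y}"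
    using a xy subspace_smult[OF assms(1)] subspace_smult[OF assms(2)] by blast
qed

lemma lin_span_Un_subspaces:
  assumes "submodule X R M" "submodule Y R M"
  shows "lin_span R M (X \<union> Y) = {x \<oplus>\<^bsub>M\<^esub> y | x y. x \<in> X \<and> y \<in> Y}"
proof (rule antisym)
  have "x \<in> {x \<oplus>\<^bsub>M\<^esub> y | x y. x \<in> X \<and> y \<in> Y}" if "x \<in> X" for x
    using that subspace_zero[OF assms(2)] subspace_memD[OF assms(1)]
    by (intro CollectI exI[of _ x] exI[of _ "\<zero>\<^bsub>M\<^esub>"]) auto
  moreover have "y \<in> {x \<oplus>\<^bsub>M\<^esub> y | x y. x \<in> X \<and> y \<in> Y}" if "y \<in> Y" for y
    using that subspace_zero[OF assms(1)] subspace_memD[OF assms(2)]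
    by (intro CollectI exI[of _ "\<zero>\<^bsub>M\<^esub>"] exI[of _ y]) auto
  ultimately show "lin_span R M (X \<union> Y) \<subseteq> {x \<oplus>\<^bsub>M\<^esub> y | x y. x \<in> X \<and> y \<in> Y}"
    by (intro lin_span_subset sum_subspace assms) auto
  have *: "X \<union> Y \<subseteq> carrier M" using subspace_subset assms by auto
  show "{x \<oplus>\<^bsub>M\<^esub> y | x y. x \<in> X \<and> y \<in> Y} \<subseteq> lin_span R M (X \<union> Y)"
    using lin_span_mem[OF *] subspace_add[OF lin_span_subspace[OF *]] by auto
qed

lemma lin_span_Un:
  assumes "A \<subseteq> carrier M" "B \<subseteq> carrier M"
  shows "lin_span R M (A \<union> B) = {x \<oplus>\<^bsub>M\<^esub> y | x y. x \<in> lin_span R M A \<and> y \<in> lin_span R M B}"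
proof -
  have "lin_span R M (A \<union> B) = lin_span R M (lin_span R M A \<union> lin_span R M B)"
    using lin_span_Un_eq[of A B] lin_span_Un_eq[of "lin_span R M B" A] assms lin_span_carrier[of B]
    by (simp add: Un_commute)
  then show ?thesis
    using lin_span_Un_subspaces[OF lin_span_subspace[OF assms(1)] lin_span_subspace[OF assms(2)]]
    by simp
qed

lemma lin_span_singleton:
  assumes "x \<in> carrier M"
  shows "lin_span R M {x} = {a \<odot>\<^bsub>M\<^esub> x | a. a \<in> carrier R}"
proof (rule antisym)
  have "submodule {a \<odot>\<^bsub>M\<^esub> x | a. a \<in> carrier R} R M"
  proof (rule subspaceI)
    show "\<zero>\<^bsub>M\<^esub> \<in> {a \<odot>\<^bsub>M\<^esub> x | a. a \<in> carrier R}" using smult_l_null[OF assms, symmetric] by blast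
  next
    fix u v assume "u \<in> {a \<odot>\<^bsub>M\<^esub> x | a. a \<in> carrier R}" "v \<in> {a \<odot>\<^bsub>M\<^esub> x | a. a \<in> carrier R}"
    then obtain a b where "a \<in> carrier R" "b \<in> carrier R" "u = a \<odot>\<^bsub>M\<^esub> x" "v = b \<odot>\<^bsub>M\<^esub> x" by auto
    then show "u \<oplus>\<^bsub>M\<^esub> v \<in> {a \<odot>\<^bsub>M\<^esub> x | a. a \<in> carrier R}"
      using smult_l_distr[of a b x] assms by (metis (mono_tags, lifting) CollectI R.a_closed)
  next
    fix a u assume "a \<in> carrier R" "u \<in> {a \<odot>\<^bsub>M\<^esub> x | a. a \<in> carrier R}"
    then show "a \<odot>\<^bsub>M\<^esub> u \<in> {a \<odot>\<^bsub>M\<^esub> x | a. a \<in> carrier R}"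
      using smult_assoc[of a _ x, symmetric] assms by auto
  qed (use assms smult_closed in auto)
  then show "lin_span R M {x} \<subseteq> {a \<odot>\<^bsub>M\<^esub> x | a. a \<in> carrier R}"
    using smult_one[OF assms, symmetric] by (intro lin_span_subset) blast+
  show "{a \<odot>\<^bsub>M\<^esub> x | a. a \<in> carrier R} \<subseteq> lin_span R M {x}"
    using subspace_smult[OF lin_span_subspace _ lin_span_mem, of "{x}" _ x] assms by auto
qed

lemma lin_span_insert:
  assumes "x \<in> carrier M" "A \<subseteq> carrier M"
  shows "y \<in> lin_span R M (insert x A) \<longleftrightarrow>
    (\<exists>a\<in>carrier R. \<exists>z\<in>lin_span R M A. y = a \<odot>\<^bsub>M\<^esub> x \<oplus>\<^bsub>M\<^esub> z)"
  using lin_span_Un[of "{x}" A] assms lin_span_singleton[of x] by auto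

text \<open>Since \<open>y\<close> lies outside the span of \<open>A\<close>, the coefficient of
  \<open>x\<close> in an expression for \<open>y\<close> is nonzero, so the expression can be solved
  for \<open>x\<close>.\<close>

lemma lin_span_exchange:
  assumes "x \<in> carrier M" "A \<subseteq> carrier M" "y \<in> lin_span R M (insert x A)" "y \<notin> lin_span R M A"
  shows "x \<in> lin_span R M (insert y A)"
proof -
  obtain a z where a: "a \<in> carrier R" "z \<in> lin_span R M A" "y = a \<odot>\<^bsub>M\<^esub> x \<oplus>\<^bsub>M\<^esub> z"
    using assms lin_span_insert by blast
  have zM: "z \<in> carrier M" using a assms lin_span_memD by blast
  have a0: "a \<noteq> \<zero>" using a assms zM by (auto simp: smult_l_null)
  have yM: "y \<in> carrier M" using a zM assms by (simp add: smult_closed)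
  have s: "submodule (lin_span R M (insert y A)) R M" using yM assms by (intro lin_span_subspace) auto
  have z: "z \<in> lin_span R M (insert y A)" using a(2) lin_span_mono[of A "insert y A"] assms yM by auto
  have "a \<odot>\<^bsub>M\<^esub> x \<oplus>\<^bsub>M\<^esub> z \<in> lin_span R M (insert y A)"
    using lin_span_mem[of "insert y A" y] yM assms a(3) by auto
  then have "a \<odot>\<^bsub>M\<^esub> x \<in> lin_span R M (insert y A)"
    using subspace_add_cancel_right[OF s z] assms a by (simp add: smult_closed)
  then show ?thesis using subspace_smult_cancel[OF s a(1) a0 assms(1)] by simp
qed

section \<open>Linear independence and replacement\<close>

text \<open>A nonzero coefficient is invertible, so a nontrivial relation can be solved for one of
  its vectors. The right-hand side is free of coefficients, which suits arguments by
  exchange.\<close>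

lemma lin_indep_iff:
  "lin_indep R M A \<longleftrightarrow> A \<subseteq> carrier M \<and> (\<forall>a\<in>A. a \<notin> lin_span R M (A - {a}))"
proof (intro iffI conjI ballI notI)
  assume ind: "lin_indep R M A"
  then show AM: "A \<subseteq> carrier M" by (simp add: lin_indep_def)
  fix a assume a: "a \<in> A" "a \<in> lin_span R M (A - {a})"
  then obtain F c where F: "finite F" "F \<subseteq> A - {a}" "c \<in> F \<rightarrow> carrier R"
    "a = finsum M (\<lambda>v. c v \<odot>\<^bsub>M\<^esub> v) F" unfolding lin_span_def by auto
  \<comment> \<open>The coefficient \<ominus>1 at \<open>a\<close> turns an expression for
    \<open>a\<close> by other vectors into a nontrivial relation.\<close>
  define d where "d v = (if v = a then \<ominus> \<one> else c v)" for v
  have aM: "a \<in> carrier M" using a AM by auto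
  have "finsum M (\<lambda>v. d v \<odot>\<^bsub>M\<^esub> v) (insert a F)
      = d a \<odot>\<^bsub>M\<^esub> a \<oplus>\<^bsub>M\<^esub> finsum M (\<lambda>v. d v \<odot>\<^bsub>M\<^esub> v) F"
    using F aM AM by (intro M.finsum_insert) (auto simp: d_def intro!: smult_closed)
  also have "finsum M (\<lambda>v. d v \<odot>\<^bsub>M\<^esub> v) F = finsum M (\<lambda>v. c v \<odot>\<^bsub>M\<^esub> v) F"
    using F AM by (intro M.finsum_cong') (auto simp: d_def intro!: smult_closed)
  finally have "finsum M (\<lambda>v. d v \<odot>\<^bsub>M\<^esub> v) (insert a F) = \<zero>\<^bsub>M\<^esub>"
    using aM F(4) by (simp add: d_def smult_l_minus smult_one M.l_neg)
  moreover have "insert a F \<subseteq> A" "finite (insert a F)" "d \<in> insert a F \<rightarrow> carrier R"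
    using F a by (auto simp: d_def)
  ultimately have "d a = \<zero>" using ind unfolding lin_indep_def by blast
  then show False using one_not_zero by (simp add: d_def)
next
  assume *: "A \<subseteq> carrier M \<and> (\<forall>a\<in>A. a \<notin> lin_span R M (A - {a}))"
  show "lin_indep R M A" unfolding lin_indep_def
  proof (intro conjI allI impI ballI)
    show "A \<subseteq> carrier M" using * by simp
    fix F c v assume F: "finite F" "F \<subseteq> A" "c \<in> F \<rightarrow> carrier R"
      "finsum M (\<lambda>v. c v \<odot>\<^bsub>M\<^esub> v) F = \<zero>\<^bsub>M\<^esub>" "v \<in> F"
    show "c v = \<zero>"
    proof (rule ccontr)
      assume c: "c v \<noteq> \<zero>"
      have sub: "submodule (lin_span R M (A - {v})) R M" using * by (intro lin_span_subspace) auto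
      have vM: "v \<in> carrier M" and cR: "c v \<in> carrier R" using F * by auto
      have "finsum M (\<lambda>v. c v \<odot>\<^bsub>M\<^esub> v) (insert v (F - {v}))
          = c v \<odot>\<^bsub>M\<^esub> v \<oplus>\<^bsub>M\<^esub> finsum M (\<lambda>v. c v \<odot>\<^bsub>M\<^esub> v) (F - {v})"
        using F * by (intro M.finsum_insert) (auto intro!: smult_closed)
      then have "c v \<odot>\<^bsub>M\<^esub> v \<oplus>\<^bsub>M\<^esub> finsum M (\<lambda>v. c v \<odot>\<^bsub>M\<^esub> v) (F - {v}) = \<zero>\<^bsub>M\<^esub>"
        using F by (simp add: insert_absorb)
      moreover have "finsum M (\<lambda>v. c v \<odot>\<^bsub>M\<^esub> v) (F - {v}) \<in> lin_span R M (A - {v})"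
        using F by (intro lin_spanI) auto
      ultimately have "c v \<odot>\<^bsub>M\<^esub> v \<in> lin_span R M (A - {v})"
        using subspace_add_cancel_right[OF sub _ smult_closed[OF cR vM]] subspace_zero[OF sub] by auto
      then show False using subspace_smult_cancel[OF sub cR c vM] * F by auto
    qed
  qed
qed

lemma lin_indep_carrier: "lin_indep R M A \<Longrightarrow> A \<subseteq> carrier M"
  by (simp add: lin_indep_def)

lemma lin_indep_subset: "lin_indep R M A \<Longrightarrow> B \<subseteq> A \<Longrightarrow> lin_indep R M B"
  unfolding lin_indep_def by (meson order_trans)

lemma lin_indep_empty: "lin_indep R M {}"
  by (simp add: lin_indep_def)

text \<open>If an old vector became dependent on the others, exchange would put \<open>x\<close>
  into the span of \<open>A\<close>.\<close>

lemma lin_indep_insert: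
  assumes A: "lin_indep R M A" and x: "x \<in> carrier M" "x \<notin> lin_span R M A"
  shows "lin_indep R M (insert x A)"
  unfolding lin_indep_iff
proof (intro conjI ballI notI)
  have AM: "A \<subseteq> carrier M" using A by (rule lin_indep_carrier)
  then show "insert x A \<subseteq> carrier M" using x by auto
  have xA: "x \<notin> A" using x lin_span_mem[OF AM] by auto
  fix a assume a: "a \<in> insert x A" "a \<in> lin_span R M (insert x A - {a})"
  show False
  proof (cases "a = x")
    case True
    then show False using a x xA by simp
  next
    case False
    then have aA: "a \<in> A" and eq: "insert x A - {a} = insert x (A - {a})" using a by auto
    have "a \<notin> lin_span R M (A - {a})" using A aA by (auto simp: lin_indep_iff)
    then have "x \<in> lin_span R M (insert a (A - {a}))"
      using lin_span_exchange[of x "A - {a}" a] a(2) eq x AM by auto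
    then show False using aA x by (simp add: insert_absorb)
  qed
qed

text \<open>Steinitz replacement. If \<open>b \<in> B\<close> is outside \<open>C\<close>, the other
  vectors of \<open>B\<close> cannot span all of \<open>C\<close>, since they would then span
  \<open>b\<close>; a vector of \<open>C\<close> outside their span replaces \<open>b\<close>. The
  number of elements of \<open>B\<close> outside \<open>C\<close> drops while the cardinality of
  \<open>B\<close> stays the same.\<close>

lemma finite_lin_indep_card_le:
  assumes "finite C" "C \<subseteq> carrier M" "finite B" "lin_indep R M B" "B \<subseteq> lin_span R M C"
  shows "card B \<le> card C"
  using assms(3-5)
proof (induction "card (B - C)" arbitrary: B)
  case 0
  then have "B \<subseteq> C" by auto
  then show ?case using assms(1) by (rule card_mono[rotated])
next
  case (Suc m)
  then obtain b where b: "b \<in> B" "b \<notin> C"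
    by (metis Diff_eq_empty_iff card.empty nat.distinct(1) subsetI)
  have BM: "B \<subseteq> carrier M" using Suc by (simp add: lin_indep_iff)
  have "\<not> C \<subseteq> lin_span R M (B - {b})"
  proof
    assume "C \<subseteq> lin_span R M (B - {b})"
    then have "lin_span R M C \<subseteq> lin_span R M (B - {b})"
      using BM by (intro lin_span_subset lin_span_subspace) auto
    then show False using b Suc by (auto simp: lin_indep_iff)
  qed
  then obtain c where c: "c \<in> C" "c \<notin> lin_span R M (B - {b})" by auto
  define B' where "B' = insert c (B - {b})"
  have cB: "c \<notin> B - {b}" using c lin_span_mem[of "B - {b}"] BM by auto
  have "lin_indep R M B'" unfolding B'_def
    using c assms(2) by (intro lin_indep_insert lin_indep_subset[OF Suc(4)]) auto
  moreover have "B' \<subseteq> lin_span R M C"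
    using c Suc lin_span_mem[OF assms(2)] by (auto simp: B'_def)
  moreover have "B' - C = (B - C) - {b}" using c b by (auto simp: B'_def)
  then have "card (B' - C) = m" using Suc(2) b Suc(3) by simp
  ultimately have "card B' \<le> card C" using Suc(1)[of B'] Suc(3) by (simp add: B'_def)
  moreover have "card B' = card B"
    using cB Suc(3) b unfolding B'_def by (metis card.remove card_insert_disjoint finite_Diff)
  ultimately show ?case by simp
qed

text \<open>Finiteness is part of the conclusion: an infinite \<open>B\<close> would contain an
  independent set with exactly one element more than \<open>C\<close>.\<close>

lemma lin_indep_card_le:
  assumes "finite C" "C \<subseteq> carrier M" "lin_indep R M B" "B \<subseteq> lin_span R M C"
  shows "finite B \<and> card B \<le> card C"
proof -
  have "finite B"
  proof (rule ccontr)
    assume "infinite B"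
    then obtain D where D: "D \<subseteq> B" "finite D" "card D = Suc (card C)"
      by (meson infinite_arbitrarily_large)
    then show False
      using finite_lin_indep_card_le[OF assms(1,2) D(2) lin_indep_subset[OF assms(3) D(1)]] assms(4)
      by auto
  qed
  then show ?thesis using finite_lin_indep_card_le assms by auto
qed

end

text \<open>A function in place of the relation \<open>has_dim\<close>, so that dimensions can be
  added and compared. Bases are sought in the surrounding space, hence no change of carrier is
  involved. The value is arbitrary if \<open>X\<close> has no finite basis.\<close>

definition vdim :: "('a, 'r) ring_scheme \<Rightarrow> ('a, 'v, 'm) module_scheme \<Rightarrow> 'v set \<Rightarrow> nat" where
  "vdim R V X = (SOME p. \<exists>B. lin_indep R V B \<and> lin_span R V B = X \<and> finite B \<and> card B = p)"

context left_vector_space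
begin

lemma vdim_lin_span:
  assumes "lin_indep R M B" "finite B"
  shows "vdim R M (lin_span R M B) = card B"
  unfolding vdim_def
proof (rule some_equality)
  show "\<exists>B'. lin_indep R M B' \<and> lin_span R M B' = lin_span R M B \<and> finite B' \<and> card B' = card B"
    using assms by blast
next
  fix p assume "\<exists>B'. lin_indep R M B' \<and> lin_span R M B' = lin_span R M B \<and> finite B' \<and> card B' = p"
  then obtain C where C: "lin_indep R M C" "lin_span R M C = lin_span R M B" "finite C" "card C = p"
    by auto
  have "B \<subseteq> lin_span R M C" "C \<subseteq> lin_span R M B"
    using C(2) lin_span_superset lin_indep_carrier assms(1) C(1) by blast+
  then show "p = card B"
    using lin_indep_card_le[of C B] lin_indep_card_le[of B C] assms C lin_indep_carrier
    by (metis le_antisym)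
qed

section \<open>A subspace as a vector space in its own right\<close>

lemma subspace_left_vector_space:
  assumes U: "submodule U R M"
  shows "left_vector_space R (M\<lparr>carrier := U\<rparr>)"
proof -
  have sub: "subgroup U (add_monoid M)" using U by (simp add: submodule_def)
  have "comm_group (add_monoid M)" using M.a_comm_group .
  then have "comm_monoid ((add_monoid M)\<lparr>carrier := U\<rparr>)" "group ((add_monoid M)\<lparr>carrier := U\<rparr>)"
    using comm_monoid.submonoid_is_comm_monoid[OF _ subgroup.subgroup_is_submonoid[OF sub]]
      subgroup.subgroup_is_group[OF sub] by (auto simp: comm_group_def)
  then have "comm_group ((add_monoid M)\<lparr>carrier := U\<rparr>)" by (simp add: comm_group_def)
  then have "abelian_group (M\<lparr>carrier := U\<rparr>)"
    by (intro comm_group_abelian_groupI) simp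
  moreover have "left_vector_space_axioms R (M\<lparr>carrier := U\<rparr>)"
    using subspace_memD[OF U] subspace_smult[OF U]
    by unfold_locales
      (auto simp: smult_l_distr smult_r_distr smult_assoc smult_one)
  ultimately show ?thesis
    using R.skew_field_axioms by (simp add: left_vector_space_def)
qed

lemma subspace_of_subspace_iff:
  assumes U: "submodule U R M"
  shows "submodule X R (M\<lparr>carrier := U\<rparr>) \<longleftrightarrow> submodule X R M \<and> X \<subseteq> U"
proof -
  interpret U: left_vector_space R "M\<lparr>carrier := U\<rparr>"
    using U by (rule subspace_left_vector_space)
  show ?thesis
  proof (intro iffI conjI)
    assume X: "submodule X R (M\<lparr>carrier := U\<rparr>)"
    show XU: "X \<subseteq> U" using U.subspace_subset[OF X] by simp
    show "submodule X R M"
      using U.subspace_zero[OF X] U.subspace_add[OF X] U.subspace_smult[OF X] XU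
        subspace_subset[OF U]
      by (intro subspaceI) auto
  next
    assume X: "submodule X R M \<and> X \<subseteq> U"
    then show "submodule X R (M\<lparr>carrier := U\<rparr>)"
      using subspace_zero[of X] subspace_add[of X] subspace_smult[of X]
      by (intro U.subspaceI) auto
  qed
qed

lemma lin_span_of_subspace:
  assumes U: "submodule U R M" and A: "A \<subseteq> U"
  shows "lin_span R (M\<lparr>carrier := U\<rparr>) A = lin_span R M A"
proof -
  interpret U: left_vector_space R "M\<lparr>carrier := U\<rparr>"
    using U by (rule subspace_left_vector_space)
  have AM: "A \<subseteq> carrier M" using A subspace_subset[OF U] by auto
  have "submodule (lin_span R (M\<lparr>carrier := U\<rparr>) A) R M"
    using U.lin_span_subspace[of A] A subspace_of_subspace_iff[OF U] by simp
  moreover have "A \<subseteq> lin_span R (M\<lparr>carrier := U\<rparr>) A" using U.lin_span_superset[of A] A by simp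
  moreover have "submodule (lin_span R M A) R (M\<lparr>carrier := U\<rparr>)"
    using lin_span_subspace[OF AM] lin_span_subset[OF U A] subspace_of_subspace_iff[OF U] by simp
  ultimately show ?thesis
    using lin_span_superset[OF AM] by (intro antisym U.lin_span_subset lin_span_subset)
qed

lemma lin_indep_of_subspace:
  assumes U: "submodule U R M" and A: "A \<subseteq> U"
  shows "lin_indep R (M\<lparr>carrier := U\<rparr>) A \<longleftrightarrow> lin_indep R M A"
proof -
  interpret U: left_vector_space R "M\<lparr>carrier := U\<rparr>"
    using U by (rule subspace_left_vector_space)
  have "lin_span R (M\<lparr>carrier := U\<rparr>) (A - {a}) = lin_span R M (A - {a})" for a
    using A by (intro lin_span_of_subspace U) auto
  then show ?thesis
    using A subspace_subset[OF U] by (auto simp: lin_indep_iff U.lin_indep_iff)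
qed

end

section \<open>Bases and the dimension formula\<close>

locale fin_vector_space = left_vector_space +
  fixes n :: nat
  assumes has_dim: "has_dim R M n"
begin

lemma lin_indep_finite:
  assumes "lin_indep R M A"
  shows "finite A" "card A \<le> n"
proof -
  obtain B where B: "lin_indep R M B" "lin_span R M B = carrier M" "finite B" "card B = n"
    using has_dim by (auto simp: has_dim_def)
  have "finite A \<and> card A \<le> card B"
    using B lin_indep_carrier[OF B(1)] lin_indep_carrier[OF assms]
    by (intro lin_indep_card_le assms) auto
  then show "finite A" "card A \<le> n" using B by auto
qed

text \<open>Vectors of \<open>X\<close> outside the span are adjoined one at a time; independent
  sets have at most \<open>n\<close> elements, so \<open>n - card B\<close> decreases. Starting from
  the empty set gives the existence of bases.\<close>

lemma extend_to_basis:
  assumes "submodule X R M" "lin_indep R M B" "B \<subseteq> X"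
  obtains C where "B \<subseteq> C" "lin_indep R M C" "lin_span R M C = X" "finite C" "C \<subseteq> X"
proof -
  have "\<exists>C. B \<subseteq> C \<and> lin_indep R M C \<and> lin_span R M C = X \<and> C \<subseteq> X"
    using assms(2,3)
  proof (induction "n - card B" arbitrary: B rule: less_induct)
    case less
    note fin = lin_indep_finite[OF less(2)]
    show ?case
    proof (cases "lin_span R M B = X")
      case True
      then show ?thesis using less by blast
    next
      case False
      then obtain x where x: "x \<in> X" "x \<notin> lin_span R M B"
        using lin_span_subset[OF assms(1) less(3)] by auto
      then have ind: "lin_indep R M (insert x B)"
        using less subspace_memD[OF assms(1)] by (intro lin_indep_insert) auto
      have xB: "x \<notin> B" using x lin_span_mem[OF lin_indep_carrier[OF less(2)]] by auto
      then have "n - card (insert x B) < n - card B"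
        using lin_indep_finite[OF ind] fin by simp
      then have "\<exists>C. insert x B \<subseteq> C \<and> lin_indep R M C \<and> lin_span R M C = X \<and> C \<subseteq> X"
        using less(1) ind x less(3) by blast
      then show ?thesis by blast
    qed
  qed
  then show thesis using that lin_indep_finite by blast
qed

lemma obtain_basis:
  assumes "submodule X R M"
  obtains B where "lin_indep R M B" "lin_span R M B = X" "finite B" "B \<subseteq> X" "card B = vdim R M X"
  using extend_to_basis[OF assms lin_indep_empty] vdim_lin_span by (metis empty_subsetI)

lemma vdim_carrier: "vdim R M (carrier M) = n"
  using has_dim vdim_lin_span unfolding has_dim_def by metis

lemma vdim_zero: "vdim R M {\<zero>\<^bsub>M\<^esub>} = 0"
  using vdim_lin_span[OF lin_indep_empty] by (simp add: lin_span_empty)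

lemma vdim_mono:
  assumes "submodule X R M" "submodule Y R M" "X \<subseteq> Y"
  shows "vdim R M X \<le> vdim R M Y"
proof -
  obtain B where "lin_indep R M B" "lin_span R M B = X" "finite B" "B \<subseteq> X" "card B = vdim R M X"
    using obtain_basis[OF assms(1)] .
  moreover obtain C where "lin_indep R M C" "lin_span R M C = Y" "finite C" "C \<subseteq> Y" "card C = vdim R M Y"
    using obtain_basis[OF assms(2)] .
  ultimately show ?thesis
    using lin_indep_card_le[of C B] lin_indep_carrier assms by (metis order_trans)
qed

lemma vdim_insert:
  assumes "submodule X R M" "x \<in> carrier M" "x \<notin> X"
  shows "vdim R M (lin_span R M (insert x X)) = Suc (vdim R M X)"
proof -
  obtain B where B: "lin_indep R M B" "lin_span R M B = X" "finite B" "B \<subseteq> X" "card B = vdim R M X"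
    using obtain_basis[OF assms(1)] .
  have "lin_indep R M (insert x B)" using B assms by (intro lin_indep_insert) auto
  then have "vdim R M (lin_span R M (insert x B)) = card (insert x B)"
    using B by (intro vdim_lin_span) auto
  moreover have "lin_span R M (insert x B) = lin_span R M (insert x X)"
    using lin_span_Un_eq[of "{x}" B] B assms lin_indep_carrier[OF B(1)] by simp
  moreover have "x \<notin> B" using B assms by auto
  ultimately show ?thesis using B by simp
qed

lemma vdim_insert_le:
  assumes "submodule X R M" "x \<in> carrier M"
  shows "vdim R M (lin_span R M (insert x X)) \<le> Suc (vdim R M X)"
  using vdim_insert[OF assms] lin_span_subspace_eq[OF assms(1)] insert_absorb[of x X]
  by (cases "x \<in> X") auto

lemma vdim_eqD:
  assumes "submodule X R M" "submodule Y R M" "X \<subseteq> Y" "vdim R M Y \<le> vdim R M X"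
  shows "X = Y"
proof (rule ccontr)
  assume "X \<noteq> Y"
  then obtain y where y: "y \<in> Y" "y \<notin> X" using assms by auto
  have yM: "y \<in> carrier M" using subspace_memD[OF assms(2) y(1)] .
  then have "vdim R M (lin_span R M (insert y X)) \<le> vdim R M Y"
    using assms y subspace_subset[OF assms(1)]
    by (intro vdim_mono lin_span_subspace lin_span_subset) auto
  then show False using vdim_insert[OF assms(1) yM y(2)] assms(4) by simp
qed

lemma vdim_lin_span_le:
  assumes "finite T" "T \<subseteq> carrier M"
  shows "vdim R M (lin_span R M T) \<le> card T"
  using assms
proof (induction T rule: finite_induct)
  case empty
  then show ?case by (simp add: lin_span_empty vdim_zero)
next
  case (insert x T)
  have "lin_span R M (insert x T) = lin_span R M (insert x (lin_span R M T))"
    using lin_span_Un_eq[of "{x}" T] insert by simp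
  then show ?case
    using vdim_insert_le[OF lin_span_subspace, of T x] insert by auto
qed

text \<open>A basis \<open>B\<close> of the intersection is extended to a basis \<open>C\<close> of
  \<open>X\<close>. The vectors of \<open>C - B\<close> are independent modulo \<open>Y\<close>, so
  adjoining them to \<open>Y\<close> raises the dimension by one each time.\<close>

lemma vdim_Un_Int:
  assumes X: "submodule X R M" and Y: "submodule Y R M"
  shows "vdim R M (lin_span R M (X \<union> Y)) + vdim R M (X \<inter> Y) = vdim R M X + vdim R M Y"
proof -
  have I: "submodule (X \<inter> Y) R M" by (rule subspace_Int[OF X Y])
  obtain B where B: "lin_indep R M B" "lin_span R M B = X \<inter> Y" "finite B" "B \<subseteq> X \<inter> Y"
    "card B = vdim R M (X \<inter> Y)"
    using obtain_basis[OF I] .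
  obtain C where C: "B \<subseteq> C" "lin_indep R M C" "lin_span R M C = X" "finite C" "C \<subseteq> X"
    using extend_to_basis[OF X B(1)] B(4) by auto
  have CM: "C \<subseteq> carrier M" using C lin_indep_carrier by auto
  have YM: "Y \<subseteq> carrier M" using Y subspace_subset by auto
  have *: "vdim R M (lin_span R M (Y \<union> T)) = vdim R M Y + card T" if "finite T" "T \<subseteq> C - B" for T
    using that
  proof (induction T rule: finite_induct)
    case empty
    then show ?case using Y by (simp add: lin_span_subspace_eq)
  next
    case (insert t T)
    have tM: "t \<in> carrier M" and TM: "T \<subseteq> carrier M" using insert CM by auto
    \<comment> \<open>If t = y + s with \<open>s\<close> in the span of \<open>T\<close>, then
      \<open>y\<close> lies in \<open>X\<close> as well, hence in the span of \<open>B\<close>, and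
      \<open>t\<close> would depend on the other vectors of \<open>C\<close>.\<close>
    have "t \<notin> lin_span R M (Y \<union> T)"
    proof
      assume "t \<in> lin_span R M (Y \<union> T)"
      then obtain y s where ys: "y \<in> Y" "s \<in> lin_span R M T" "t = y \<oplus>\<^bsub>M\<^esub> s"
        using lin_span_Un[OF YM TM] lin_span_subspace_eq[OF Y] by auto
      have "s \<in> X" using ys(2) lin_span_subset[OF X, of T] insert C by auto
      moreover have "t \<in> X" using insert C by auto
      ultimately have "y \<in> X"
        using subspace_add_cancel_right[OF X] ys YM by auto
      then have yB: "y \<in> lin_span R M B" using ys B by auto
      have "B \<subseteq> C - {t}" "T \<subseteq> C - {t}" "C - {t} \<subseteq> carrier M" using insert C CM by auto
      then have "lin_span R M B \<subseteq> lin_span R M (C - {t})" "lin_span R M T \<subseteq> lin_span R M (C - {t})"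
        by (simp_all add: lin_span_mono)
      then have "t \<in> lin_span R M (C - {t})"
        using yB ys CM subspace_add[OF lin_span_subspace, of "C - {t}" y s] by auto
      then show False using C(2) insert by (auto simp: lin_indep_iff)
    qed
    then have "vdim R M (lin_span R M (insert t (lin_span R M (Y \<union> T)))) = Suc (vdim R M Y + card T)"
      using vdim_insert[OF lin_span_subspace tM, of "Y \<union> T"] insert YM TM by auto
    moreover have "lin_span R M (insert t (lin_span R M (Y \<union> T))) = lin_span R M (Y \<union> insert t T)"
      using lin_span_Un_eq[of "{t}" "Y \<union> T"] tM YM TM by simp
    ultimately show ?case using insert by simp
  qed
  have "lin_span R M (Y \<union> (C - B)) = lin_span R M (X \<union> Y)"
  proof (rule antisym)
    show "lin_span R M (Y \<union> (C - B)) \<subseteq> lin_span R M (X \<union> Y)"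
      using C subspace_subset[OF X] YM by (intro lin_span_mono) auto
    have s: "submodule (lin_span R M (Y \<union> (C - B))) R M"
      using YM CM by (intro lin_span_subspace) auto
    have sup: "Y \<union> (C - B) \<subseteq> lin_span R M (Y \<union> (C - B))"
      using YM CM by (intro lin_span_superset) auto
    then have "C \<subseteq> lin_span R M (Y \<union> (C - B))" using B(4) by auto
    then have "X \<subseteq> lin_span R M (Y \<union> (C - B))" using lin_span_subset[OF s] C(3) by blast
    then show "lin_span R M (X \<union> Y) \<subseteq> lin_span R M (Y \<union> (C - B))"
      using sup by (intro lin_span_subset[OF s]) auto
  qed
  then have "vdim R M (lin_span R M (X \<union> Y)) = vdim R M Y + card (C - B)"
    using *[of "C - B"] C by simp
  moreover have "card C = vdim R M X" using vdim_lin_span[OF C(2,4)] C(3) by simp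
  moreover have "card (C - B) = card C - card B" "card B \<le> card C"
    using card_Diff_subset[OF B(3) C(1)] card_mono[OF C(4) C(1)] by simp_all
  ultimately show ?thesis using B by simp
qed

lemma has_dim_of_subspace_iff:
  assumes X: "submodule X R M"
  shows "has_dim R (M\<lparr>carrier := X\<rparr>) p \<longleftrightarrow> vdim R M X = p"
proof
  assume "has_dim R (M\<lparr>carrier := X\<rparr>) p"
  then obtain B where B: "lin_indep R (M\<lparr>carrier := X\<rparr>) B" "lin_span R (M\<lparr>carrier := X\<rparr>) B = X"
    "finite B" "card B = p" by (auto simp: has_dim_def)
  have "B \<subseteq> X" using B(1) by (simp add: lin_indep_def)
  then have "lin_indep R M B" "lin_span R M B = X"
    using B lin_span_of_subspace[OF X] lin_indep_of_subspace[OF X] by auto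
  then show "vdim R M X = p" using vdim_lin_span B by auto
next
  assume p: "vdim R M X = p"
  obtain B where B: "lin_indep R M B" "lin_span R M B = X" "finite B" "B \<subseteq> X" "card B = vdim R M X"
    using obtain_basis[OF X] .
  then show "has_dim R (M\<lparr>carrier := X\<rparr>) p"
    unfolding has_dim_def using p lin_span_of_subspace[OF X B(4)] lin_indep_of_subspace[OF X B(4)]
    by auto
qed

lemma grassmannian_iff:
  "X \<in> grassmannian R M p \<longleftrightarrow> submodule X R M \<and> vdim R M X = p"
  using has_dim_of_subspace_iff by (auto simp: grassmannian_def)

lemma vdim_singleton:
  assumes "x \<in> carrier M" "x \<noteq> \<zero>\<^bsub>M\<^esub>"
  shows "vdim R M (lin_span R M {x}) = 1"
  using vdim_insert[OF subspace_zero_set, of x] lin_span_Un_eq[of "{x}" "{}"] assms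
  by (simp add: lin_span_empty vdim_zero insert_commute)

section \<open>Extending subspaces and moving between them\<close>

lemma ex_notin_subspace:
  assumes "submodule X R M" "vdim R M X < n"
  obtains x where "x \<in> carrier M" "x \<notin> X"
  using assms vdim_carrier subspace_subset by (metis less_irrefl subset_antisym subsetI)

lemma mem_lin_span_insertD:
  assumes "submodule B R M" "x \<in> carrier M" "y \<in> lin_span R M (insert x B)" "y \<notin> B"
  shows "x \<in> lin_span R M (insert y B)"
  using lin_span_exchange[of x B y] assms by (simp add: lin_span_subspace_eq subspace_subset)

text \<open>\<open>B\<close> is enlarged by vectors outside B + C, which leaves the intersection
  with \<open>C\<close> unchanged. As long as dim B < p, the sum has dimension less than p + dim C
  \<le> n, so such a vector exists.\<close>

lemma extend_disjoint:
  assumes "submodule B R M" "submodule C R M" "vdim R M B \<le> p" "p + vdim R M C \<le> n"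
  obtains X where "submodule X R M" "vdim R M X = p" "B \<subseteq> X" "X \<inter> C = B \<inter> C"
proof -
  have "\<exists>X. submodule X R M \<and> vdim R M X = p \<and> B \<subseteq> X \<and> X \<inter> C = B \<inter> C"
    using assms
  proof (induction "p - vdim R M B" arbitrary: B)
    case 0
    then show ?case by (intro exI[of _ B]) auto
  next
    case (Suc m)
    let ?S = "lin_span R M (B \<union> C)"
    have BC: "B \<union> C \<subseteq> carrier M" using Suc subspace_subset by auto
    have S: "submodule ?S R M" using BC by (rule lin_span_subspace)
    have "vdim R M ?S < n" using vdim_Un_Int[OF Suc(3,4)] Suc by linarith
    then obtain x where x: "x \<in> carrier M" "x \<notin> ?S" using ex_notin_subspace[OF S] by auto
    let ?B = "lin_span R M (insert x B)"
    have xB: "x \<notin> B" using x lin_span_mem[OF BC] by auto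
    have B': "submodule ?B R M" using x BC by (intro lin_span_subspace) auto
    have dB': "vdim R M ?B = Suc (vdim R M B)" using vdim_insert[OF Suc(3) x(1) xB] .
    have sub: "B \<subseteq> ?B" using lin_span_superset[of "insert x B"] x BC by auto
    have "y \<in> B" if y: "y \<in> ?B" "y \<in> C" for y
    proof (rule ccontr)
      assume "y \<notin> B"
      then have "x \<in> lin_span R M (insert y B)"
        using mem_lin_span_insertD[OF Suc(3) x(1) y(1)] by simp
      moreover have "lin_span R M (insert y B) \<subseteq> ?S"
        using y(2) BC by (intro lin_span_mono) auto
      ultimately show False using x by auto
    qed
    then have eq: "?B \<inter> C = B \<inter> C" using sub by auto
    obtain X where "submodule X R M" "vdim R M X = p" "?B \<subseteq> X" "X \<inter> C = ?B \<inter> C"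
    proof -
      have "m = p - vdim R M ?B" "vdim R M ?B \<le> p" using dB' Suc(2) by auto
      then show ?thesis using Suc(1)[OF _ B' Suc(4) _ Suc(6)] that by blast
    qed
    then show ?case using eq sub by (intro exI[of _ X]) auto
  qed
  then show thesis using that by blast
qed

text \<open>The condition 2p \<le> n leaves room to enlarge \<open>B\<close> without new vectors of
  \<open>C\<close>, and then \<open>C\<close> without new vectors of the result. With B = C this
  writes a subspace as an intersection of two p-dimensional ones.\<close>

lemma extend_pair:
  assumes "submodule B R M" "submodule C R M" "vdim R M B \<le> p" "vdim R M C \<le> p" "2 * p \<le> n"
  obtains X Y where "submodule X R M" "vdim R M X = p" "submodule Y R M" "vdim R M Y = p"
    "B \<subseteq> X" "C \<subseteq> Y" "X \<inter> Y = B \<inter> C"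
proof -
  obtain X where X: "submodule X R M" "vdim R M X = p" "B \<subseteq> X" "X \<inter> C = B \<inter> C"
    using extend_disjoint[OF assms(1-3)] assms by auto
  obtain Y where "submodule Y R M" "vdim R M Y = p" "C \<subseteq> Y" "Y \<inter> X = C \<inter> X"
    using extend_disjoint[OF assms(2) X(1) assms(4)] X(2) assms(5) by auto
  then show thesis using X that[of X Y] by auto
qed

text \<open>A basis of \<open>D\<close> together with \<open>x\<close> is extended to a basis of
  \<open>X\<close>; \<open>H\<close> is spanned by the basis vectors other than
  \<open>x\<close>.\<close>

lemma ex_hyperplane_between:
  assumes "submodule D R M" "submodule X R M" "D \<subseteq> X" "x \<in> X" "x \<notin> D"
  obtains H where "submodule H R M" "D \<subseteq> H" "H \<subseteq> X" "x \<notin> H" "Suc (vdim R M H) = vdim R M X"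
proof -
  obtain B where B: "lin_indep R M B" "lin_span R M B = D" "finite B" "B \<subseteq> D"
    using obtain_basis[OF assms(1)] .
  have "lin_indep R M (insert x B)"
    using B assms subspace_memD by (intro lin_indep_insert) auto
  then obtain C where C: "insert x B \<subseteq> C" "lin_indep R M C" "lin_span R M C = X" "finite C" "C \<subseteq> X"
    using extend_to_basis[OF assms(2), of "insert x B"] B assms by auto
  let ?H = "lin_span R M (C - {x})"
  have CM: "C \<subseteq> carrier M" using C lin_indep_carrier by auto
  have xB: "x \<notin> B" using B assms by auto
  show thesis
  proof (rule that[of ?H])
    show "submodule ?H R M" using CM by (intro lin_span_subspace) auto
    show "D \<subseteq> ?H" unfolding B(2)[symmetric] using C xB CM by (intro lin_span_mono) auto
    show "?H \<subseteq> X" unfolding C(3)[symmetric] using CM by (intro lin_span_mono) auto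
    show "x \<notin> ?H" using C by (auto simp: lin_indep_iff)
    have "vdim R M ?H = card (C - {x})"
      using C by (intro vdim_lin_span lin_indep_subset[OF C(2)]) auto
    moreover have "vdim R M X = card C" using vdim_lin_span[OF C(2,4)] C(3) by simp
    moreover have "Suc (card (C - {x})) = card C"
      using C by (intro card_Suc_Diff1) auto
    ultimately show "Suc (vdim R M ?H) = vdim R M X" by simp
  qed
qed

text \<open>\<open>Z\<close> is spanned by a hyperplane of \<open>X\<close> through X \<inter> Y and
  a vector of \<open>Y\<close> outside \<open>X\<close>. The step serves twice: for shortest walks
  in Grassmann graphs and for chains of (k-1)-dimensional subspaces.\<close>

lemma ex_step_towards:
  assumes "submodule X R M" "submodule Y R M" "vdim R M X = p" "vdim R M Y = p" "X \<noteq> Y"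
  obtains Z where "submodule Z R M" "vdim R M Z = p" "Suc (vdim R M (X \<inter> Z)) = p"
    "vdim R M (X \<inter> Y) < vdim R M (Z \<inter> Y)"
proof -
  have I: "submodule (X \<inter> Y) R M" by (rule subspace_Int[OF assms(1,2)])
  have "\<not> X \<subseteq> Y" "\<not> Y \<subseteq> X" using vdim_eqD assms by (metis order_refl)+
  then obtain x y where xy: "x \<in> X" "x \<notin> Y" "y \<in> Y" "y \<notin> X" by auto
  obtain H where H: "submodule H R M" "X \<inter> Y \<subseteq> H" "H \<subseteq> X" "Suc (vdim R M H) = vdim R M X"
    using ex_hyperplane_between[OF I assms(1), of x] xy by (metis Int_lower1 IntD2)
  have y: "y \<in> carrier M" "y \<notin> H" "y \<notin> X \<inter> Y" using xy H subspace_memD[OF assms(2)] by auto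
  let ?Z = "lin_span R M (insert y H)"
  have HM: "insert y H \<subseteq> carrier M" using y subspace_subset[OF H(1)] by auto
  have Z: "submodule ?Z R M" using HM by (rule lin_span_subspace)
  have dZ: "vdim R M ?Z = p" using vdim_insert[OF H(1) y(1,2)] H assms by simp
  have sup: "insert y H \<subseteq> ?Z" using HM by (rule lin_span_superset)
  have ZX: "submodule (X \<inter> ?Z) R M" by (rule subspace_Int[OF assms(1) Z])
  have "vdim R M H \<le> vdim R M (X \<inter> ?Z)" using sup H by (intro vdim_mono ZX) auto
  moreover have "vdim R M (X \<inter> ?Z) < p"
  proof (rule ccontr)
    assume "\<not> vdim R M (X \<inter> ?Z) < p"
    then have "X \<inter> ?Z = ?Z" using dZ by (intro vdim_eqD ZX Z) auto
    then show False using xy sup by auto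
  qed
  ultimately have "Suc (vdim R M (X \<inter> ?Z)) = p" using H assms by simp
  moreover have "vdim R M (X \<inter> Y) < vdim R M (?Z \<inter> Y)"
  proof -
    have "lin_span R M (insert y (X \<inter> Y)) \<subseteq> ?Z \<inter> Y"
      using sup H xy by (intro lin_span_subset subspace_Int Z assms) auto
    moreover have "insert y (X \<inter> Y) \<subseteq> carrier M" using y subspace_subset[OF I] by auto
    ultimately have "vdim R M (lin_span R M (insert y (X \<inter> Y))) \<le> vdim R M (?Z \<inter> Y)"
      by (intro vdim_mono lin_span_subspace subspace_Int Z assms)
    then show ?thesis using vdim_insert[OF I y(1,3)] by simp
  qed
  ultimately show thesis using that Z dZ by auto
qed

end

section \<open>Modular lattices with an integer rank\<close>

text \<open>The axioms are symmetric under exchanging \<open>meet\<close> and \<open>join\<close>,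
  reversing \<open>le\<close> and negating \<open>rk\<close>; this is the reason for an integer rank
  without a least value. By \<open>rk_eqD\<close>, comparable elements are equal as soon as their
  ranks are, which is how most equalities below are obtained.\<close>

locale rank_lattice =
  fixes L :: "'l set" and le :: "'l \<Rightarrow> 'l \<Rightarrow> bool" (infix \<open>\<preceq>\<close> 50)
    and meet :: "'l \<Rightarrow> 'l \<Rightarrow> 'l" (infixl \<open>\<inter>\<^sub>L\<close> 70) and join :: "'l \<Rightarrow> 'l \<Rightarrow> 'l" (infixl \<open>\<union>\<^sub>L\<close> 65)
    and rk :: "'l \<Rightarrow> int"
  assumes le_refl: "a \<in> L \<Longrightarrow> a \<preceq> a"
    and le_trans: "\<lbrakk>a \<in> L; b \<in> L; c \<in> L; a \<preceq> b; b \<preceq> c\<rbrakk> \<Longrightarrow> a \<preceq> c"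
    and meet_closed: "\<lbrakk>a \<in> L; b \<in> L\<rbrakk> \<Longrightarrow> a \<inter>\<^sub>L b \<in> L"
    and join_closed: "\<lbrakk>a \<in> L; b \<in> L\<rbrakk> \<Longrightarrow> a \<union>\<^sub>L b \<in> L"
    and meet_le1: "\<lbrakk>a \<in> L; b \<in> L\<rbrakk> \<Longrightarrow> a \<inter>\<^sub>L b \<preceq> a"
    and meet_le2: "\<lbrakk>a \<in> L; b \<in> L\<rbrakk> \<Longrightarrow> a \<inter>\<^sub>L b \<preceq> b"
    and meet_greatest: "\<lbrakk>a \<in> L; b \<in> L; c \<in> L; c \<preceq> a; c \<preceq> b\<rbrakk> \<Longrightarrow> c \<preceq> a \<inter>\<^sub>L b"
    and join_ge1: "\<lbrakk>a \<in> L; b \<in> L\<rbrakk> \<Longrightarrow> a \<preceq> a \<union>\<^sub>L b"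
    and join_ge2: "\<lbrakk>a \<in> L; b \<in> L\<rbrakk> \<Longrightarrow> b \<preceq> a \<union>\<^sub>L b"
    and join_least: "\<lbrakk>a \<in> L; b \<in> L; c \<in> L; a \<preceq> c; b \<preceq> c\<rbrakk> \<Longrightarrow> a \<union>\<^sub>L b \<preceq> c"
    and rk_mono: "\<lbrakk>a \<in> L; b \<in> L; a \<preceq> b\<rbrakk> \<Longrightarrow> rk a \<le> rk b"
    and rk_eqD: "\<lbrakk>a \<in> L; b \<in> L; a \<preceq> b; rk a = rk b\<rbrakk> \<Longrightarrow> a = b"
    and rk_modular: "\<lbrakk>a \<in> L; b \<in> L\<rbrakk> \<Longrightarrow> rk (a \<union>\<^sub>L b) + rk (a \<inter>\<^sub>L b) = rk a + rk b"
begin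

lemma dual_rank_lattice: "rank_lattice L (\<lambda>a b. b \<preceq> a) join meet (\<lambda>a. - rk a)"
proof unfold_locales
  show "\<And>a b. \<lbrakk>a \<in> L; b \<in> L\<rbrakk> \<Longrightarrow> - rk (a \<inter>\<^sub>L b) + - rk (a \<union>\<^sub>L b) = - rk a + - rk b"
    using rk_modular by fastforce
  show "\<And>a b. \<lbrakk>a \<in> L; b \<in> L; b \<preceq> a; - rk a = - rk b\<rbrakk> \<Longrightarrow> a = b"
    using rk_eqD by fastforce
qed (auto intro: le_refl le_trans meet_closed join_closed meet_le1 meet_le2 meet_greatest
       join_ge1 join_ge2 join_least rk_mono)

lemma eq_if_rk_le: "\<lbrakk>a \<in> L; b \<in> L; a \<preceq> b; rk b \<le> rk a\<rbrakk> \<Longrightarrow> a = b"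
  using rk_mono[of a b] rk_eqD[of a b] by linarith

lemma meet_idem: "a \<in> L \<Longrightarrow> a \<inter>\<^sub>L a = a"
  using eq_if_rk_le[of "a \<inter>\<^sub>L a" a] meet_closed[of a a] meet_le1[of a a]
    rk_mono[OF _ meet_closed meet_greatest, of a a a] le_refl[of a] by blast

lemma meet_triple_eq:
  assumes "a \<in> L" "b \<in> L" "c \<in> L" "a \<inter>\<^sub>L b \<preceq> c" "rk (a \<inter>\<^sub>L c) = rk (a \<inter>\<^sub>L b)"
  shows "a \<inter>\<^sub>L c = a \<inter>\<^sub>L b"
  by (rule rk_eqD[symmetric])
    (simp_all add: assms meet_closed meet_le1 meet_greatest)

text \<open>The lattice form of the classification of triangles in a Grassmann graph. If
  \<open>c\<close> is not below the join of \<open>a\<close> and \<open>b\<close>, then the join of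
  its meets with \<open>a\<close> and \<open>b\<close> is a proper part of \<open>c\<close>, hence
  of rank r - 1. Both meets coincide with it, so this element lies below \<open>a\<close> and
  \<open>b\<close> and equals their meet.\<close>

lemma triangle:
  assumes "a \<in> L" "b \<in> L" "c \<in> L" "rk c = r"
    and "rk (a \<inter>\<^sub>L b) = r - 1" "rk (a \<inter>\<^sub>L c) = r - 1" "rk (b \<inter>\<^sub>L c) = r - 1"
  shows "a \<inter>\<^sub>L b \<preceq> c \<or> c \<preceq> a \<union>\<^sub>L b"
proof (rule disjCI)
  assume nle: "\<not> c \<preceq> a \<union>\<^sub>L b"
  note cl = assms(1-3) meet_closed join_closed
  have ac: "a \<inter>\<^sub>L c \<in> L" and bc: "b \<inter>\<^sub>L c \<in> L" and ab: "a \<inter>\<^sub>L b \<in> L" using cl by auto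
  let ?j = "(a \<inter>\<^sub>L c) \<union>\<^sub>L (b \<inter>\<^sub>L c)"
  have j: "?j \<in> L" using ac bc cl by auto
  have jc: "?j \<preceq> c" using cl ac bc by (intro join_least meet_le2) auto
  have abj: "a \<union>\<^sub>L b \<in> L" using cl by auto
  have "a \<inter>\<^sub>L c \<preceq> a \<union>\<^sub>L b" using le_trans[OF ac _ abj meet_le1 join_ge1] cl by auto
  moreover have "b \<inter>\<^sub>L c \<preceq> a \<union>\<^sub>L b" using le_trans[OF bc _ abj meet_le1 join_ge2] cl by auto
  ultimately have jab: "?j \<preceq> a \<union>\<^sub>L b" using ac bc abj by (intro join_least) auto
  have "rk ?j < r"
  proof (rule ccontr)
    assume "\<not> rk ?j < r"
    then have "?j = c" using eq_if_rk_le[OF j _ jc] cl assms(4) by auto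
    then show False using jab nle by simp
  qed
  then have r: "rk ?j = r - 1" using rk_mono[OF ac j join_ge1[OF ac bc]] assms by linarith
  then have "a \<inter>\<^sub>L c = ?j" "b \<inter>\<^sub>L c = ?j"
    using rk_eqD[OF ac j join_ge1[OF ac bc]] rk_eqD[OF bc j join_ge2[OF ac bc]] assms by auto
  then have eq: "a \<inter>\<^sub>L c = b \<inter>\<^sub>L c" by simp
  then have "a \<inter>\<^sub>L c \<preceq> b" using meet_le1[of b c] cl by simp
  then have "a \<inter>\<^sub>L c \<preceq> a \<inter>\<^sub>L b" using meet_greatest[of a b "a \<inter>\<^sub>L c"] meet_le1[of a c] cl ac by simp
  then have "a \<inter>\<^sub>L c = a \<inter>\<^sub>L b" using rk_eqD[OF ac ab] assms by simp
  then show "a \<inter>\<^sub>L b \<preceq> c" using meet_le2[of a c] cl by simp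
qed

end


section \<open>Images of stars and tops\<close>

context fin_vector_space
begin

lemma Int_eq_of_covers:
  assumes "submodule A R M" "submodule X R M" "submodule Y R M" "A \<subseteq> X" "A \<subseteq> Y" "X \<noteq> Y"
    and "vdim R M X = Suc (vdim R M A)" "vdim R M Y = Suc (vdim R M A)"
  shows "X \<inter> Y = A" "vdim R M (lin_span R M (X \<union> Y)) = Suc (Suc (vdim R M A))"
proof -
  have I: "submodule (X \<inter> Y) R M" by (rule subspace_Int[OF assms(2,3)])
  have "vdim R M (X \<inter> Y) < vdim R M X"
  proof (rule ccontr)
    assume "\<not> vdim R M (X \<inter> Y) < vdim R M X"
    then have "X \<inter> Y = X" "X \<inter> Y = Y"
      using vdim_eqD[OF I assms(2)] vdim_eqD[OF I assms(3)] assms(7,8) by auto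
    then show False using assms(6) by simp
  qed
  then show "X \<inter> Y = A" using assms by (intro vdim_eqD[symmetric] I) auto
  then show "vdim R M (lin_span R M (X \<union> Y)) = Suc (Suc (vdim R M A))"
    using vdim_Un_Int[OF assms(2,3)] assms by simp
qed

lemma lin_span_Un_eq_of_covers:
  assumes "submodule A R M" "submodule X R M" "submodule Y R M" "A \<subseteq> X" "A \<subseteq> Y" "X \<noteq> Y"
    and "vdim R M X = Suc (vdim R M A)" "vdim R M Y = Suc (vdim R M A)"
    and "submodule B R M" "X \<subseteq> B" "Y \<subseteq> B" "vdim R M B = Suc (Suc (vdim R M A))"
  shows "lin_span R M (X \<union> Y) = B"
proof (rule vdim_eqD[OF _ assms(9)])
  have "X \<union> Y \<subseteq> carrier M" using subspace_subset assms(2,3) by blast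
  then show "submodule (lin_span R M (X \<union> Y)) R M" by (rule lin_span_subspace)
  show "lin_span R M (X \<union> Y) \<subseteq> B" using assms(9-11) by (intro lin_span_subset) blast+
  show "vdim R M B \<le> vdim R M (lin_span R M (X \<union> Y))"
    using Int_eq_of_covers(2)[OF assms(1-8)] assms(12) by simp
qed

lemma ex_cover_outside:
  assumes "submodule A R M" "submodule B R M" "A \<subseteq> B" "vdim R M B < n"
  obtains Z where "submodule Z R M" "A \<subseteq> Z" "vdim R M Z = Suc (vdim R M A)" "\<not> Z \<subseteq> B"
proof -
  obtain z where z: "z \<in> carrier M" "z \<notin> B" using ex_notin_subspace assms by blast
  have sub: "insert z A \<subseteq> carrier M" using z subspace_subset[OF assms(1)] by auto
  show thesis
    by (rule that[OF lin_span_subspace[OF sub] _ vdim_insert[OF assms(1) z(1)]])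
      (use z assms(3) lin_span_superset[OF sub] in auto)
qed

lemma ex_cover_within:
  assumes "submodule A R M" "submodule B R M" "A \<subseteq> B" "submodule X R M" "\<not> B \<subseteq> X" "A \<subseteq> X"
  obtains Z where "submodule Z R M" "A \<subseteq> Z" "Z \<subseteq> B" "vdim R M Z = Suc (vdim R M A)" "\<not> Z \<subseteq> X"
proof -
  obtain z where z: "z \<in> B" "z \<notin> X" using assms by auto
  have zM: "z \<in> carrier M" using z subspace_memD[OF assms(2)] by auto
  then have sub: "insert z A \<subseteq> carrier M" using subspace_subset[OF assms(1)] by auto
  have "lin_span R M (insert z A) \<subseteq> B" using z assms by (intro lin_span_subset) auto
  moreover have "z \<notin> A" using z assms(6) by auto
  ultimately show thesis
    using that[OF lin_span_subspace[OF sub] _ _ vdim_insert[OF assms(1) zM]]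
      z lin_span_superset[OF sub] by (meson insert_subset subsetD)
qed

end

text \<open>\<open>rk_f_meet\<close> is preservation of distances with the graphs removed. The
  formula for joins follows by modularity, which makes the assumptions self-dual. \<open>K\<close>
  is k' for the subspaces of the target space and -k' for the reversed order.\<close>

locale grassmann_rank_map = fin_vector_space R M n + rank_lattice L le meet join rk
  for R :: "('a, 'r) ring_scheme" (structure) and M :: "('a, 'v, 'm) module_scheme" (structure)
    and n :: nat and L :: "'l set" and le (infix \<open>\<preceq>\<close> 50) and meet (infixl \<open>\<inter>\<^sub>L\<close> 70)
    and join (infixl \<open>\<union>\<^sub>L\<close> 65) and rk +
  fixes k :: nat and K :: int and f :: "'v set \<Rightarrow> 'l"
  assumes k_ge_2: "2 \<le> k" and k_le: "2 * k \<le> n"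
    and f_closed: "\<lbrakk>submodule X R M; vdim R M X = k\<rbrakk> \<Longrightarrow> f X \<in> L"
    and rk_f_self: "\<lbrakk>submodule X R M; vdim R M X = k\<rbrakk> \<Longrightarrow> rk (f X) = K"
    and rk_f_meet: "\<lbrakk>submodule X R M; vdim R M X = k; submodule Y R M; vdim R M Y = k\<rbrakk> \<Longrightarrow>
      rk (f X \<inter>\<^sub>L f Y) = K - int k + int (vdim R M (X \<inter> Y))"
begin

lemma rk_f_join:
  assumes "submodule X R M" "vdim R M X = k" "submodule Y R M" "vdim R M Y = k"
  shows "rk (f X \<union>\<^sub>L f Y) = K + int k - int (vdim R M (X \<inter> Y))"
  using rk_modular[OF f_closed[OF assms(1,2)] f_closed[OF assms(3,4)]] rk_f_meet[OF assms]
    rk_f_self[OF assms(1,2)] rk_f_self[OF assms(3,4)] by linarith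

text \<open>With d the dimension of the intersection, -(K + k - d) = (-K) - k + d: the join formula
  is the meet formula for \<open>- K\<close>.\<close>

lemma dual: "grassmann_rank_map R M n L (\<lambda>a b. b \<preceq> a) join meet (\<lambda>a. - rk a) k (- K) f"
proof -
  interpret D: rank_lattice L "\<lambda>a b. b \<preceq> a" join meet "\<lambda>a. - rk a" by (rule dual_rank_lattice)
  show ?thesis
    by (intro grassmann_rank_map.intro fin_vector_space_axioms D.rank_lattice_axioms
        grassmann_rank_map_axioms.intro)
      (use k_ge_2 k_le f_closed rk_f_self rk_f_join in auto)
qed

text \<open>Under reversal of the order of \<open>L\<close>, \<open>star_to_star\<close> becomes \<open>star_to_top\<close> and vice versa.\<close>

definition star :: "'v set \<Rightarrow> 'v set set" where
  "star A = {X. submodule X R M \<and> vdim R M X = k \<and> A \<subseteq> X}"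

definition star_to_star :: "'v set \<Rightarrow> bool" where
  "star_to_star A \<longleftrightarrow> (\<forall>X\<in>star A. \<forall>Y\<in>star A. \<forall>Z\<in>star A. X \<noteq> Y \<longrightarrow> f X \<inter>\<^sub>L f Y \<preceq> f Z)"

definition star_to_top :: "'v set \<Rightarrow> bool" where
  "star_to_top A \<longleftrightarrow> (\<forall>X\<in>star A. \<forall>Y\<in>star A. \<forall>Z\<in>star A. X \<noteq> Y \<longrightarrow> f Z \<preceq> f X \<union>\<^sub>L f Y)"

lemma starD:
  assumes "X \<in> star A"
  shows "submodule X R M" "vdim R M X = k" "A \<subseteq> X" "f X \<in> L" "rk (f X) = K" "X \<subseteq> carrier M"
proof -
  show X: "submodule X R M" "vdim R M X = k" "A \<subseteq> X" using assms by (simp_all add: star_def)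
  show "f X \<in> L" "rk (f X) = K" "X \<subseteq> carrier M"
    using f_closed[OF X(1,2)] rk_f_self[OF X(1,2)] subspace_subset[OF X(1)] by simp_all
qed

context
  fixes A assumes A: "submodule A R M" "Suc (vdim R M A) = k"
begin

lemma star_Int:
  assumes "X \<in> star A" "Y \<in> star A" "X \<noteq> Y"
  shows "X \<inter> Y = A" "vdim R M (lin_span R M (X \<union> Y)) = Suc k" "rk (f X \<inter>\<^sub>L f Y) = K - 1"
proof -
  note x = starD[OF assms(1)] and y = starD[OF assms(2)]
  have d: "vdim R M X = Suc (vdim R M A)" "vdim R M Y = Suc (vdim R M A)" using x y A by auto
  show *: "X \<inter> Y = A"
    by (rule Int_eq_of_covers(1)[OF A(1) x(1) y(1) x(3) y(3) assms(3) d])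
  show "vdim R M (lin_span R M (X \<union> Y)) = Suc k"
    using Int_eq_of_covers(2)[OF A(1) x(1) y(1) x(3) y(3) assms(3) d] A(2) by simp
  show "rk (f X \<inter>\<^sub>L f Y) = K - 1"
    using rk_f_meet[OF x(1,2) y(1,2)] A(2) unfolding * by linarith
qed

lemma star_join_eq:
  assumes "X \<in> star A" "Y \<in> star A" "Z \<in> star A" "X \<noteq> Y" "X \<noteq> Z" "Z \<subseteq> lin_span R M (X \<union> Y)"
  shows "lin_span R M (X \<union> Z) = lin_span R M (X \<union> Y)"
proof -
  note x = starD[OF assms(1)] and y = starD[OF assms(2)] and z = starD[OF assms(3)]
  have XY: "X \<union> Y \<subseteq> carrier M" using x y by auto
  have d: "vdim R M X = Suc (vdim R M A)" "vdim R M Z = Suc (vdim R M A)"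
    "vdim R M (lin_span R M (X \<union> Y)) = Suc (Suc (vdim R M A))"
    using x(2) z(2) A(2) star_Int(2)[OF assms(1,2,4)] by simp_all
  have "X \<subseteq> lin_span R M (X \<union> Y)" using lin_span_superset[OF XY] by blast
  from lin_span_Un_eq_of_covers[OF A(1) x(1) z(1) x(3) z(3) assms(5) d(1,2)
      lin_span_subspace[OF XY] this assms(6) d(3)]
  show ?thesis .
qed

text \<open>\<open>Z\<close> and \<open>W\<close> intersect in W \<inter> A, of dimension k - 2, so
  their images meet in rank K - 2 and join in rank K + 2. Hence these images cannot both lie above
  the meet of \<open>f X\<close> and \<open>f Y\<close>, which has rank K - 1, nor both below the
  join, which has rank K + 1. As \<open>triangle\<close> leaves each of them one of the two
  alternatives, they behave oppositely. This couples the vertices through \<open>A\<close> to the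
  vertices inside X + Y.\<close>

lemma flag_dichotomy:
  assumes X: "X \<in> star A" and Y: "Y \<in> star A" and ne: "X \<noteq> Y"
    and Z: "Z \<in> star A" "\<not> Z \<subseteq> lin_span R M (X \<union> Y)"
    and W: "submodule W R M" "vdim R M W = k" "W \<subseteq> lin_span R M (X \<union> Y)" "\<not> A \<subseteq> W"
  shows "f X \<inter>\<^sub>L f Y \<preceq> f Z \<and> f W \<preceq> f X \<union>\<^sub>L f Y \<and> \<not> f X \<inter>\<^sub>L f Y \<preceq> f W \<and> \<not> f Z \<preceq> f X \<union>\<^sub>L f Y
    \<or> f Z \<preceq> f X \<union>\<^sub>L f Y \<and> f X \<inter>\<^sub>L f Y \<preceq> f W \<and> \<not> f X \<inter>\<^sub>L f Y \<preceq> f Z \<and> \<not> f W \<preceq> f X \<union>\<^sub>L f Y"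
proof -
  let ?B = "lin_span R M (X \<union> Y)"
  note x = starD[OF X] and y = starD[OF Y] and z = starD[OF Z(1)]
  have XY: "X \<union> Y \<subseteq> carrier M" using x y by auto
  have B: "submodule ?B R M" using XY by (rule lin_span_subspace)
  have XB: "X \<subseteq> ?B" "Y \<subseteq> ?B" using lin_span_superset[OF XY] by auto
  have dB: "vdim R M ?B = Suc k" using star_Int(2)[OF X Y ne] .
  have fW: "f W \<in> L" "rk (f W) = K" using f_closed rk_f_self W by auto
  \<comment> \<open>Two distinct hyperplanes of the (k+1)-dimensional X + Y intersect in dimension k
    - 1; \<open>U\<close> and \<open>W\<close> are distinct because only \<open>U\<close> contains
    \<open>A\<close>.\<close>
  have meet_W: "rk (f U \<inter>\<^sub>L f W) = K - 1" if U: "U \<in> star A" "U \<subseteq> ?B" for U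
  proof -
    note u = starD[OF U(1)]
    have UW: "submodule (U \<inter> W) R M" by (rule subspace_Int[OF u(1) W(1)])
    have "lin_span R M (U \<union> W) \<subseteq> ?B" using U(2) W(3) by (intro lin_span_subset B) auto
    then have "vdim R M (lin_span R M (U \<union> W)) \<le> Suc k"
      unfolding dB[symmetric] using u W subspace_subset by (intro vdim_mono lin_span_subspace B) auto
    then have "k \<le> Suc (vdim R M (U \<inter> W))" using vdim_Un_Int[OF u(1) W(1)] u W by simp
    moreover have "vdim R M (U \<inter> W) < k"
    proof (rule ccontr)
      assume "\<not> vdim R M (U \<inter> W) < k"
      then have "U \<inter> W = W" "U \<inter> W = U"
        using vdim_eqD[OF UW W(1)] vdim_eqD[OF UW u(1)] u W by auto
      then show False using u W by auto
    qed
    ultimately have "int (vdim R M (U \<inter> W)) = int k - 1" by linarith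
    then show ?thesis using rk_f_meet[of U W] u W by simp
  qed
  have ZB: "Z \<inter> ?B = A"
  proof -
    have I: "submodule (Z \<inter> ?B) R M" by (rule subspace_Int[OF z(1) B])
    have "vdim R M (Z \<inter> ?B) < k"
    proof (rule ccontr)
      assume "\<not> vdim R M (Z \<inter> ?B) < k"
      then have "Z \<inter> ?B = Z" using z by (intro vdim_eqD I) auto
      then show False using Z by auto
    qed
    then show ?thesis using z x XB A by (intro vdim_eqD[symmetric] I) auto
  qed
  have WZ: "W \<inter> Z = W \<inter> A" using ZB W z by auto
  \<comment> \<open>The bound from below is the dimension formula inside X + Y; the bound from above
    holds because \<open>A\<close> is not contained in \<open>W\<close>.\<close>
  have "vdim R M (W \<inter> A) + 2 = k"
  proof -
    have I: "submodule (W \<inter> A) R M" by (rule subspace_Int[OF W(1) A(1)])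
    have "lin_span R M (W \<union> A) \<subseteq> ?B" using x XB W by (intro lin_span_subset B) auto
    then have "vdim R M (lin_span R M (W \<union> A)) \<le> Suc k"
      unfolding dB[symmetric] using A W subspace_subset by (intro vdim_mono lin_span_subspace B) auto
    moreover have "vdim R M (W \<inter> A) < vdim R M A"
    proof (rule ccontr)
      assume "\<not> vdim R M (W \<inter> A) < vdim R M A"
      then have "W \<inter> A = A" by (intro vdim_eqD I A) auto
      then show False using W by auto
    qed
    ultimately show ?thesis using vdim_Un_Int[OF W(1) A(1)] A W by linarith
  qed
  then have WZ_meet: "rk (f W \<inter>\<^sub>L f Z) = K - 2" and WZ_join: "rk (f W \<union>\<^sub>L f Z) = K + 2"
    using rk_f_meet[OF W(1,2) z(1,2)] rk_f_join[OF W(1,2) z(1,2)] WZ by auto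
  have m: "f X \<inter>\<^sub>L f Y \<in> L" "rk (f X \<inter>\<^sub>L f Y) = K - 1" and j: "f X \<union>\<^sub>L f Y \<in> L" "rk (f X \<union>\<^sub>L f Y) = K + 1"
    using meet_closed join_closed star_Int[OF X Y ne] x y A rk_f_join[OF x(1,2) y(1,2)] by auto
  have "\<not> (f X \<inter>\<^sub>L f Y \<preceq> f Z \<and> f X \<inter>\<^sub>L f Y \<preceq> f W)"
    using rk_mono[OF m(1) meet_closed[of "f W" "f Z"]] meet_greatest[of "f W" "f Z", OF _ _ m(1)] fW z m WZ_meet
    by auto
  moreover have "\<not> (f Z \<preceq> f X \<union>\<^sub>L f Y \<and> f W \<preceq> f X \<union>\<^sub>L f Y)"
    using rk_mono[OF join_closed[of "f W" "f Z"] j(1)] join_least[of "f W" "f Z", OF _ _ j(1)] fW z j WZ_join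
    by auto
  moreover have "f X \<inter>\<^sub>L f Y \<preceq> f Z \<or> f Z \<preceq> f X \<union>\<^sub>L f Y"
  proof (rule triangle[of _ _ _ K])
    have "X \<noteq> Z" "Y \<noteq> Z" using XB Z by auto
    then show "rk (f X \<inter>\<^sub>L f Z) = K - 1" "rk (f Y \<inter>\<^sub>L f Z) = K - 1"
      using star_Int(3) X Y Z by auto
  qed (use x y z m in auto)
  moreover have "f X \<inter>\<^sub>L f Y \<preceq> f W \<or> f W \<preceq> f X \<union>\<^sub>L f Y"
    by (rule triangle[of _ _ _ K]) (use x y fW m meet_W X Y XB in auto)
  ultimately show ?thesis by blast
qed

text \<open>Because k \<ge> 2, there is a nonzero vector in \<open>A\<close>; a hyperplane of X + Y
  that avoids it is the required \<open>W\<close>.\<close>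

lemma ex_avoiding:
  assumes X: "X \<in> star A" and Y: "Y \<in> star A" and ne: "X \<noteq> Y"
  obtains W where "submodule W R M" "vdim R M W = k" "W \<subseteq> lin_span R M (X \<union> Y)" "\<not> A \<subseteq> W"
proof -
  let ?B = "lin_span R M (X \<union> Y)"
  note x = starD[OF X] and y = starD[OF Y]
  have XY: "X \<union> Y \<subseteq> carrier M" using x y by auto
  have B: "submodule ?B R M" using XY by (rule lin_span_subspace)
  have "A \<noteq> {\<zero>\<^bsub>M\<^esub>}" using A k_ge_2 vdim_zero by auto
  then obtain a where a: "a \<in> A" "a \<noteq> \<zero>\<^bsub>M\<^esub>" using subspace_zero[OF A(1)] by auto
  have aB: "a \<in> ?B" using a x lin_span_superset[OF XY] by auto
  obtain W where "submodule W R M" "W \<subseteq> ?B" "a \<notin> W" "Suc (vdim R M W) = vdim R M ?B"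
    using ex_hyperplane_between[OF subspace_zero_set B _ aB] a subspace_zero[OF B] by auto
  then show thesis using that[of W] a star_Int(2)[OF X Y ne] by auto
qed

text \<open>X + Y has dimension k + 1, so k + 2 \<le> n leaves room for a third vertex of the star
  outside it.\<close>

lemma ex_star_triple:
  obtains X Y Z where "X \<in> star A" "Y \<in> star A" "Z \<in> star A" "X \<noteq> Y" "\<not> Z \<subseteq> lin_span R M (X \<union> Y)"
proof -
  have n: "k + 2 \<le> n" using k_ge_2 k_le by linarith
  obtain X where X: "submodule X R M" "A \<subseteq> X" "vdim R M X = Suc (vdim R M A)"
    using ex_cover_outside[OF A(1) A(1)] A n by auto
  obtain Y where Y: "submodule Y R M" "A \<subseteq> Y" "vdim R M Y = Suc (vdim R M A)" "\<not> Y \<subseteq> X"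
    using ex_cover_outside[OF A(1) X(1,2)] A n X by auto
  have XY: "X \<in> star A" "Y \<in> star A" "X \<noteq> Y" using X Y A by (auto simp: star_def)
  have sub: "X \<union> Y \<subseteq> carrier M" using X Y subspace_subset by auto
  have "A \<subseteq> lin_span R M (X \<union> Y)" "vdim R M (lin_span R M (X \<union> Y)) < n"
    using lin_span_superset[OF sub] X star_Int(2)[OF XY] n by auto
  then obtain Z where "submodule Z R M" "A \<subseteq> Z" "vdim R M Z = Suc (vdim R M A)"
    "\<not> Z \<subseteq> lin_span R M (X \<union> Y)"
    using ex_cover_outside[OF A(1) lin_span_subspace[OF sub]] by blast
  then show thesis using that[OF XY(1,2) _ XY(3), of Z] A by (auto simp: star_def)
qed

text \<open>One triple in general position decides the type. Comparison with a fixed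
  \<open>W\<close> in \<open>flag_dichotomy\<close> transfers the behaviour of \<open>Z\<close> to
  every vertex of the star outside X + Y. For a vertex inside X + Y, the pair \<open>X\<close>,
  \<open>Y\<close> is exchanged for \<open>X\<close>, \<open>Z\<close>: the meet of the images is
  the same, and the vertex is outside X + Z unless it equals \<open>X\<close>.\<close>

lemma star_to_starI:
  assumes X: "X \<in> star A" and Y: "Y \<in> star A" and ne: "X \<noteq> Y"
    and Z: "Z \<in> star A" "\<not> Z \<subseteq> lin_span R M (X \<union> Y)" and le: "f X \<inter>\<^sub>L f Y \<preceq> f Z"
  shows "star_to_star A"
proof -
  have outside: "f X \<inter>\<^sub>L f Y \<preceq> f T"
    if XYZ: "X \<in> star A" "Y \<in> star A" "X \<noteq> Y" "Z \<in> star A" "\<not> Z \<subseteq> lin_span R M (X \<union> Y)" "f X \<inter>\<^sub>L f Y \<preceq> f Z"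
      and T: "T \<in> star A" "\<not> T \<subseteq> lin_span R M (X \<union> Y)" for X Y Z T
  proof -
    obtain W where W: "submodule W R M" "vdim R M W = k" "W \<subseteq> lin_span R M (X \<union> Y)" "\<not> A \<subseteq> W"
      using ex_avoiding[OF XYZ(1-3)] .
    show ?thesis using flag_dichotomy[OF XYZ(1-5) W] flag_dichotomy[OF XYZ(1-3) T W] XYZ(6) by blast
  qed
  have m: "f X \<inter>\<^sub>L f Y \<in> L" "rk (f X \<inter>\<^sub>L f Y) = K - 1"
    using star_Int(3) X Y ne starD meet_closed by auto
  have all: "f X \<inter>\<^sub>L f Y \<preceq> f T" if T: "T \<in> star A" for T
  proof (cases "T \<subseteq> lin_span R M (X \<union> Y)")
    case False
    then show ?thesis using outside[OF X Y ne Z le T] by blast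
  next
    case True
    have XY: "X \<union> Y \<subseteq> carrier M" using starD X Y by auto
    have XZ: "X \<union> Z \<subseteq> carrier M" using starD X Z by auto
    have XneZ: "X \<noteq> Z" using Z lin_span_superset[OF XY] by auto
    have eq: "f X \<inter>\<^sub>L f Z = f X \<inter>\<^sub>L f Y"
      using meet_triple_eq[of "f X" "f Y" "f Z"] le starD X Y Z star_Int(3)[OF X Z(1) XneZ] m by auto
    have YXZ: "\<not> Y \<subseteq> lin_span R M (X \<union> Z)"
      using star_join_eq[OF X Z(1) Y XneZ ne] Z(2) lin_span_superset[OF XZ] by auto
    show ?thesis
    proof (cases "T = X")
      case True
      then show ?thesis using meet_le1 starD X Y by auto
    next
      case False
      have "\<not> T \<subseteq> lin_span R M (X \<union> Z)"
        using star_join_eq[OF X Z(1) T XneZ] star_join_eq[OF X Y T ne] False True YXZ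
          lin_span_superset[OF XY] by auto
      \<comment> \<open>\<open>Y\<close> and \<open>Z\<close> have changed roles: \<open>Y\<close>
        is now the known vertex outside the span, with image above the common meet.\<close>
      then have "f X \<inter>\<^sub>L f Z \<preceq> f T"
        using outside[OF X Z(1) XneZ Y YXZ _ T] eq meet_le2[of "f X" "f Y"] starD X Y by auto
      then show ?thesis using eq by simp
    qed
  qed
  \<comment> \<open>Any other pair of the star has images above the same element, and by rank that
    element is the meet of this pair, too.\<close>
  show ?thesis unfolding star_to_star_def
  proof (intro ballI impI)
    fix S T U assume S: "S \<in> star A" and T: "T \<in> star A" and U: "U \<in> star A" and "S \<noteq> T"
    have "f X \<inter>\<^sub>L f Y \<preceq> f S \<inter>\<^sub>L f T"
      using all S T m starD by (intro meet_greatest) auto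
    then have "f X \<inter>\<^sub>L f Y = f S \<inter>\<^sub>L f T"
      using m star_Int(3)[OF S T \<open>S \<noteq> T\<close>] meet_closed starD[OF S] starD[OF T] by (intro rk_eqD) auto
    then show "f S \<inter>\<^sub>L f T \<preceq> f U" using all[OF U] by simp
  qed
qed

end

lemma star_dual:
  "grassmann_rank_map.star_to_star R M (\<lambda>a b. b \<preceq> a) join k f A = star_to_top A"
  "grassmann_rank_map.star_to_top R M (\<lambda>a b. b \<preceq> a) meet k f A = star_to_star A"
proof -
  interpret D: grassmann_rank_map R M n L "\<lambda>a b. b \<preceq> a" join meet "\<lambda>a. - rk a" k "- K" f by (rule dual)
  show "D.star_to_star A = star_to_top A" "D.star_to_top A = star_to_star A"
    unfolding D.star_to_star_def D.star_to_top_def star_to_star_def star_to_top_def by (rule refl)+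
qed

text \<open>The two outcomes of \<open>triangle\<close> for a triple in general position are
  exchanged by reversing the order, so the second is settled by \<open>star_to_starI\<close> for the
  dual map.\<close>

lemma star_to_star_or_top:
  assumes "submodule A R M" "Suc (vdim R M A) = k"
  shows "star_to_star A \<or> star_to_top A"
proof -
  interpret D: grassmann_rank_map R M n L "\<lambda>a b. b \<preceq> a" join meet "\<lambda>a. - rk a" k "- K" f by (rule dual)
  obtain X Y Z where *: "X \<in> star A" "Y \<in> star A" "X \<noteq> Y" "Z \<in> star A" "\<not> Z \<subseteq> lin_span R M (X \<union> Y)"
    using ex_star_triple[OF assms] .
  have "X \<union> Y \<subseteq> carrier M" using * starD by auto
  from lin_span_superset[OF this] have "X \<noteq> Z" "Y \<noteq> Z" using *(5) by auto
  then have "f X \<inter>\<^sub>L f Y \<preceq> f Z \<or> f Z \<preceq> f X \<union>\<^sub>L f Y"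
    using * starD star_Int(3)[OF assms] by (intro triangle[of _ _ _ K]) auto
  then show ?thesis
  proof
    assume "f X \<inter>\<^sub>L f Y \<preceq> f Z"
    then show ?thesis using star_to_starI[OF assms *] by simp
  next
    assume "f Z \<preceq> f X \<union>\<^sub>L f Y"
    then have "D.star_to_star A" using D.star_to_starI[OF assms *] by simp
    then show ?thesis by (simp add: star_dual)
  qed
qed

text \<open>The vertex A + A' belongs to both stars. Suppose the types differ, and take
  \<open>Y\<close> through \<open>A\<close> and \<open>W\<close> through \<open>A'\<close> in one
  common (k+1)-dimensional space. Star type at \<open>A\<close> keeps \<open>f W\<close> from lying
  above the meet of f(A + A') and \<open>f Y\<close>; top type at \<open>A'\<close> puts the meet of
  f(A + A') and \<open>f W\<close> below \<open>f Y\<close>. By rank the two meets coincide, a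
  contradiction.\<close>

lemma star_to_star_adjacent:
  assumes A: "submodule A R M" "Suc (vdim R M A) = k"
    and A': "submodule A' R M" "Suc (vdim R M A') = k"
    and adj: "Suc (Suc (vdim R M (A \<inter> A'))) = k" and T: "star_to_star A"
  shows "star_to_star A'"
proof (rule ccontr)
  assume "\<not> star_to_star A'"
  then have T': "star_to_top A'" using star_to_star_or_top[OF A'] by blast
  let ?X = "lin_span R M (A \<union> A')"
  have AA: "A \<union> A' \<subseteq> carrier M" using A A' subspace_subset by auto
  have sX: "submodule ?X R M" using AA by (rule lin_span_subspace)
  have AX: "A \<subseteq> ?X" "A' \<subseteq> ?X" using lin_span_superset[OF AA] by auto
  have dX: "vdim R M ?X = k" using vdim_Un_Int[OF A(1) A'(1)] A A' adj by simp
  have X: "?X \<in> star A" "?X \<in> star A'" using sX AX dX by (auto simp: star_def)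
  have n: "k + 2 \<le> n" using k_ge_2 k_le by linarith
  obtain Y where Y: "submodule Y R M" "A \<subseteq> Y" "vdim R M Y = Suc (vdim R M A)" "\<not> Y \<subseteq> ?X"
    using ex_cover_outside[OF A(1) sX AX(1)] dX n by auto
  have Ys: "Y \<in> star A" "?X \<noteq> Y" using Y A by (auto simp: star_def)
  let ?B = "lin_span R M (?X \<union> Y)"
  have XY: "?X \<union> Y \<subseteq> carrier M" using sX Y subspace_subset by auto
  have sB: "submodule ?B R M" using XY by (rule lin_span_subspace)
  have XB: "?X \<subseteq> ?B" "Y \<subseteq> ?B" using lin_span_superset[OF XY] by auto
  have dB: "vdim R M ?B = Suc k" using star_Int(2)[OF A X(1) Ys] .
  \<comment> \<open>\<open>W\<close> is taken inside \<open>?B\<close> so that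
    \<open>flag_dichotomy\<close> can be applied at \<open>A\<close> with \<open>W\<close> as the
    vertex avoiding \<open>A\<close>, and at \<open>A'\<close> with \<open>Y\<close> as the vertex
    avoiding \<open>A'\<close>.\<close>
  obtain W where W: "submodule W R M" "A' \<subseteq> W" "W \<subseteq> ?B" "vdim R M W = Suc (vdim R M A')" "\<not> W \<subseteq> ?X"
    using ex_cover_within[OF A'(1) sB _ sX _ AX(2)] XB AX Y by blast
  have Ws: "W \<in> star A'" "?X \<noteq> W" using W A' by (auto simp: star_def)
  have AA': "A \<noteq> A'" using A adj by auto
  have nAW: "\<not> A \<subseteq> W"
  proof
    assume "A \<subseteq> W"
    then have "?X \<subseteq> W" using W by (intro lin_span_subset) auto
    then have "?X = W" using dX W A' by (intro vdim_eqD sX) auto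
    then show False using Ws by simp
  qed
  have nAY: "\<not> A' \<subseteq> Y"
  proof
    assume "A' \<subseteq> Y"
    then have "?X \<subseteq> Y" using Y by (intro lin_span_subset) auto
    then have "?X = Y" using dX Y A by (intro vdim_eqD sX) auto
    then show False using Ys by simp
  qed
  have B': "lin_span R M (?X \<union> W) = ?B"
    using A' X W sB dX dB XB AX Ws(2) by (intro lin_span_Un_eq_of_covers[of A'] sX) auto
  have AB: "A \<subseteq> ?B" "A' \<subseteq> ?B" "vdim R M ?B < n" using AX XB dB n by auto
  obtain Z where "submodule Z R M" "A \<subseteq> Z" "vdim R M Z = Suc (vdim R M A)" "\<not> Z \<subseteq> ?B"
    by (rule ex_cover_outside[OF A(1) sB AB(1,3)])
  then have Z: "Z \<in> star A" "\<not> Z \<subseteq> ?B" using A(2) by (simp_all add: star_def)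
  obtain Z' where "submodule Z' R M" "A' \<subseteq> Z'" "vdim R M Z' = Suc (vdim R M A')" "\<not> Z' \<subseteq> ?B"
    by (rule ex_cover_outside[OF A'(1) sB AB(2,3)])
  then have Z': "Z' \<in> star A'" "\<not> Z' \<subseteq> ?B" using A'(2) by (simp_all add: star_def)
  have 1: "f ?X \<inter>\<^sub>L f Y \<preceq> f Z" using T X Ys Z unfolding star_to_star_def by blast
  have 2: "f Z' \<preceq> f ?X \<union>\<^sub>L f W" using T' X Ws Z' unfolding star_to_top_def by blast
  have 3: "\<not> f ?X \<inter>\<^sub>L f Y \<preceq> f W"
    using flag_dichotomy[OF A X(1) Ys Z W(1) _ W(3) nAW] 1 W A' by auto
  have 4: "f ?X \<inter>\<^sub>L f W \<preceq> f Y"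
    using flag_dichotomy[OF A' X(2) Ws Z'(1) _ Y(1) _ _ nAY] 2 Y A B' Z' XB by auto
  have "f ?X \<inter>\<^sub>L f Y = f ?X \<inter>\<^sub>L f W"
    using meet_triple_eq[OF _ _ _ 4] starD[OF X(1)] starD[OF Ys(1)] starD[OF Ws(1)]
      star_Int(3)[OF A X(1) Ys] star_Int(3)[OF A' X(2) Ws] by simp
  then show False using 3 meet_le2[of "f ?X" "f W"] starD[OF X(1)] starD[OF Ws(1)] by simp
qed

text \<open>Any two (k-1)-dimensional subspaces are joined by a chain of adjacent ones, each step
  enlarging the intersection with \<open>A'\<close>.\<close>

lemma star_to_star_connected:
  assumes "submodule A R M" "Suc (vdim R M A) = k" "star_to_star A"
    and A': "submodule A' R M" "Suc (vdim R M A') = k"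
  shows "star_to_star A'"
  using assms(1-3)
proof (induction "k - vdim R M (A \<inter> A')" arbitrary: A rule: less_induct)
  case less
  show ?case
  proof (cases "A = A'")
    case True
    then show ?thesis using less by simp
  next
    case False
    obtain p where p: "vdim R M A = p" "vdim R M A' = p" "Suc p = k" using less(3) A' by auto
    obtain Z where Z: "submodule Z R M" "vdim R M Z = p" "Suc (vdim R M (A \<inter> Z)) = p"
      "vdim R M (A \<inter> A') < vdim R M (Z \<inter> A')"
      using ex_step_towards[OF less(2) A'(1) p(1,2) False] .
    have "star_to_star Z" using star_to_star_adjacent[OF less(2,3) Z(1) _ _ less(4)] Z p by auto
    moreover have "vdim R M (Z \<inter> A') \<le> p" using vdim_mono[OF subspace_Int[OF Z(1) A'(1)] Z(1)] Z by auto
    ultimately show ?thesis using less(1)[OF _ Z(1)] Z p by simp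
  qed
qed

theorem star_type_constant:
  "(\<forall>A. submodule A R M \<and> Suc (vdim R M A) = k \<longrightarrow> star_to_star A) \<or>
   (\<forall>A. submodule A R M \<and> Suc (vdim R M A) = k \<longrightarrow> star_to_top A)"
proof (cases "\<exists>A. submodule A R M \<and> Suc (vdim R M A) = k \<and> star_to_star A")
  case True
  then show ?thesis using star_to_star_connected by auto
next
  case False
  then show ?thesis using star_to_star_or_top by auto
qed

end

section \<open>The induced map on smaller subspaces\<close>

context rank_lattice
begin

lemma meet_mono:
  assumes "a \<in> L" "b \<in> L" "c \<in> L" "d \<in> L" "a \<preceq> c" "b \<preceq> d"
  shows "a \<inter>\<^sub>L b \<preceq> c \<inter>\<^sub>L d"
proof -
  have "a \<inter>\<^sub>L b \<in> L" using assms by (intro meet_closed)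
  moreover have "a \<inter>\<^sub>L b \<preceq> c" using le_trans[OF calculation assms(1,3) meet_le1] assms by simp
  moreover have "a \<inter>\<^sub>L b \<preceq> d" using le_trans[OF calculation(1) assms(2,4) meet_le2] assms by simp
  ultimately show ?thesis using meet_greatest assms by simp
qed

end

context grassmann_rank_map
begin

definition kspaces :: "'v set set" where
  "kspaces = {X. submodule X R M \<and> vdim R M X = k}"

text \<open>The invariant of the downward induction. It compares a meet with a single third vertex;
  equality of two meets follows by rank, and monotonicity of the extended map comes from the same
  inequality.\<close>

definition meets_le :: "nat \<Rightarrow> bool" where
  "meets_le i \<longleftrightarrow> (\<forall>X\<in>kspaces. \<forall>Y\<in>kspaces. \<forall>Z\<in>kspaces.
     i \<le> vdim R M (X \<inter> Y) \<longrightarrow> X \<inter> Y \<subseteq> Z \<longrightarrow> f X \<inter>\<^sub>L f Y \<preceq> f Z)"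

text \<open>The choice is over all representations of \<open>A\<close> as an intersection of two
  vertices; \<open>meets_le\<close> guarantees independence of the representation for the dimensions
  that it covers.\<close>

definition induced :: "'v set \<Rightarrow> 'l" where
  "induced A = (SOME a. \<exists>X\<in>kspaces. \<exists>Y\<in>kspaces. X \<inter> Y = A \<and> a = f X \<inter>\<^sub>L f Y)"

lemma kspacesD:
  assumes "X \<in> kspaces"
  shows "submodule X R M" "vdim R M X = k" "f X \<in> L" "rk (f X) = K"
proof -
  show X: "submodule X R M" "vdim R M X = k" using assms by (simp_all add: kspaces_def)
  show "f X \<in> L" "rk (f X) = K" using f_closed[OF X] rk_f_self[OF X] by simp_all
qed

lemma kspaces_Int:
  assumes "X \<in> kspaces" "Y \<in> kspaces"
  shows "submodule (X \<inter> Y) R M" "f X \<inter>\<^sub>L f Y \<in> L"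
    "rk (f X \<inter>\<^sub>L f Y) = K - int k + int (vdim R M (X \<inter> Y))"
  using subspace_Int[OF kspacesD(1)[OF assms(1)] kspacesD(1)[OF assms(2)]]
    meet_closed[OF kspacesD(3)[OF assms(1)] kspacesD(3)[OF assms(2)]]
    rk_f_meet[OF kspacesD(1,2)[OF assms(1)] kspacesD(1,2)[OF assms(2)]] by simp_all

text \<open>By \<open>k_le\<close> there is room for two vertices that share nothing beyond
  \<open>A\<close>; hence the choice in \<open>induced\<close> ranges over a nonempty set.\<close>

lemma ex_kspaces_Int:
  assumes "submodule A R M" "vdim R M A \<le> k"
  obtains X Y where "X \<in> kspaces" "Y \<in> kspaces" "X \<inter> Y = A"
proof -
  obtain X Y where "submodule X R M" "vdim R M X = k" "submodule Y R M" "vdim R M Y = k" "X \<inter> Y = A \<inter> A"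
    by (rule extend_pair[OF assms(1) assms(1) assms(2) assms(2) k_le])
  then show thesis using that[of X Y] by (simp add: kspaces_def)
qed

context
  fixes i assumes i: "meets_le i"
begin

lemma meets_leD:
  "\<lbrakk>X \<in> kspaces; Y \<in> kspaces; Z \<in> kspaces; i \<le> vdim R M (X \<inter> Y); X \<inter> Y \<subseteq> Z\<rbrakk> \<Longrightarrow> f X \<inter>\<^sub>L f Y \<preceq> f Z"
  using i unfolding meets_le_def by blast

text \<open>Applied to both members of another representation, \<open>meets_le\<close> bounds one
  meet by the other, and the two have equal rank.\<close>

lemma induced_Int:
  assumes "X \<in> kspaces" "Y \<in> kspaces" "i \<le> vdim R M (X \<inter> Y)"
  shows "induced (X \<inter> Y) = f X \<inter>\<^sub>L f Y"
  unfolding induced_def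
proof (rule some_equality)
  fix a assume "\<exists>X'\<in>kspaces. \<exists>Y'\<in>kspaces. X' \<inter> Y' = X \<inter> Y \<and> a = f X' \<inter>\<^sub>L f Y'"
  then obtain X' Y' where *: "X' \<in> kspaces" "Y' \<in> kspaces" "X' \<inter> Y' = X \<inter> Y" "a = f X' \<inter>\<^sub>L f Y'"
    by blast
  have "f X \<inter>\<^sub>L f Y \<preceq> f X'" "f X \<inter>\<^sub>L f Y \<preceq> f Y'"
    using meets_leD[OF assms(1,2) *(1) assms(3)] meets_leD[OF assms(1,2) *(2) assms(3)] *(3) by auto
  then have "f X \<inter>\<^sub>L f Y \<preceq> f X' \<inter>\<^sub>L f Y'"
    using kspacesD(3) kspaces_Int(2) assms * by (intro meet_greatest) auto
  then have "f X \<inter>\<^sub>L f Y = f X' \<inter>\<^sub>L f Y'"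
    using kspaces_Int[OF assms(1,2)] kspaces_Int[OF *(1,2)] *(3) by (intro rk_eqD) auto
  then show "a = f X \<inter>\<^sub>L f Y" using * by simp
qed (use assms in blast)

lemma induced_kspace:
  assumes "X \<in> kspaces" "i \<le> k"
  shows "induced X = f X"
  using induced_Int[of X X] kspacesD[OF assms(1)] assms meet_idem by simp

lemma induced_closed:
  assumes "submodule A R M" "i \<le> vdim R M A" "vdim R M A \<le> k"
  shows "induced A \<in> L" "rk (induced A) = K - int k + int (vdim R M A)"
proof -
  obtain X Y where *: "X \<in> kspaces" "Y \<in> kspaces" "X \<inter> Y = A" using ex_kspaces_Int assms by blast
  show "induced A \<in> L" "rk (induced A) = K - int k + int (vdim R M A)"
    using induced_Int[of X Y] kspaces_Int[of X Y] * assms by auto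
qed

lemma induced_mono:
  assumes "submodule A R M" "submodule B R M" "A \<subseteq> B" "i \<le> vdim R M A" "vdim R M B \<le> k"
  shows "induced A \<preceq> induced B"
proof -
  have d: "vdim R M A \<le> vdim R M B" using vdim_mono assms by blast
  then have "vdim R M A \<le> k" using assms by linarith
  then obtain X Y where X: "X \<in> kspaces" "Y \<in> kspaces" "X \<inter> Y = A" using ex_kspaces_Int assms by blast
  obtain Z W where Z: "Z \<in> kspaces" "W \<in> kspaces" "Z \<inter> W = B" using ex_kspaces_Int assms by blast
  have "f X \<inter>\<^sub>L f Y \<preceq> f Z" "f X \<inter>\<^sub>L f Y \<preceq> f W"
    using meets_leD[OF X(1,2) Z(1)] meets_leD[OF X(1,2) Z(2)] X Z assms by auto
  then have "f X \<inter>\<^sub>L f Y \<preceq> f Z \<inter>\<^sub>L f W"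
    using kspacesD(3) kspaces_Int(2) X Z by (intro meet_greatest) auto
  then show ?thesis using induced_Int[OF X(1,2)] induced_Int[OF Z(1,2)] X Z assms d by auto
qed

text \<open>\<open>A\<close> and \<open>B\<close> are enlarged to vertices whose intersection is
  still A \<inter> B. That intersection may have dimension below \<open>i\<close>, and this is how
  the induction obtains information one level down.\<close>

lemma rk_induced_meet_le:
  assumes "submodule A R M" "i \<le> vdim R M A" "vdim R M A \<le> k"
    and "submodule B R M" "i \<le> vdim R M B" "vdim R M B \<le> k"
  shows "rk (induced A \<inter>\<^sub>L induced B) \<le> K - int k + int (vdim R M (A \<inter> B))"
proof -
  obtain X Y where X: "submodule X R M" "vdim R M X = k" "A \<subseteq> X" and Y: "submodule Y R M" "vdim R M Y = k" "B \<subseteq> Y"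
    and I: "X \<inter> Y = A \<inter> B"
    using extend_pair[OF assms(1,4,3,6) k_le] by blast
  have V: "X \<in> kspaces" "Y \<in> kspaces" using X Y by (auto simp: kspaces_def)
  have "i \<le> k" using assms by linarith
  then have "induced A \<preceq> f X" "induced B \<preceq> f Y"
    using induced_mono[OF assms(1) X(1,3) assms(2)] induced_mono[OF assms(4) Y(1,3) assms(5)]
      X Y induced_kspace V by auto
  then have "induced A \<inter>\<^sub>L induced B \<preceq> f X \<inter>\<^sub>L f Y"
    using induced_closed(1) assms kspacesD V by (intro meet_mono) auto
  then have "rk (induced A \<inter>\<^sub>L induced B) \<le> rk (f X \<inter>\<^sub>L f Y)"
    using meet_closed[OF induced_closed(1)[OF assms(1-3)] induced_closed(1)[OF assms(4-6)]] kspaces_Int(2)[OF V]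
    by (intro rk_mono)
  then show ?thesis using kspaces_Int(3)[OF V] I by simp
qed

end

text \<open>If the images of three covers of \<open>A\<close> that do not lie in a common line lay in a common top, then
  the two distinct spans of pairs of these covers would have the same image.\<close>

lemma induced_star_meet:
  assumes i: "meets_le (Suc i)" "i + 2 \<le> k"
    and A: "submodule A R M" "vdim R M A = i"
    and X: "submodule X R M" "vdim R M X = Suc i" "A \<subseteq> X"
    and Y: "submodule Y R M" "vdim R M Y = Suc i" "A \<subseteq> Y"
    and Z: "submodule Z R M" "vdim R M Z = Suc i" "A \<subseteq> Z"
    and ne: "X \<noteq> Y"
  shows "induced X \<inter>\<^sub>L induced Y \<preceq> induced Z"
    "rk (induced X \<inter>\<^sub>L induced Y) = K - int k + int i"
proof -
  \<comment> \<open>The rank expected of the image of \<open>A\<close>, one less than the rank of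
    the images of its covers.\<close>
  define \<rho> where "\<rho> = K - int k + int i"
  define cov where "cov X \<longleftrightarrow> submodule X R M \<and> vdim R M X = Suc i \<and> A \<subseteq> X" for X
  have cl: "induced X \<in> L" "rk (induced X) = \<rho> + 1" if "cov X" for X
    using induced_closed[OF i(1), of X] that i(2) by (auto simp: cov_def \<rho>_def)
  have span: "submodule (lin_span R M (X \<union> Y)) R M" "X \<subseteq> lin_span R M (X \<union> Y)" "Y \<subseteq> lin_span R M (X \<union> Y)"
    if "cov X" "cov Y" for X Y
    using that lin_span_subspace[of "X \<union> Y"] lin_span_superset[of "X \<union> Y"] subspace_subset
    by (auto simp: cov_def)
  have pair: "X \<inter> Y = A" "vdim R M (lin_span R M (X \<union> Y)) = i + 2" if "cov X" "cov Y" "X \<noteq> Y" for X Y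
    using Int_eq_of_covers[OF A(1), of X Y] that A(2) by (auto simp: cov_def)
  have sp: "induced (lin_span R M (X \<union> Y)) \<in> L" "rk (induced (lin_span R M (X \<union> Y))) = \<rho> + 2"
    if "cov X" "cov Y" "X \<noteq> Y" for X Y
    using induced_closed[OF i(1), of "lin_span R M (X \<union> Y)"] span(1)[OF that(1,2)] pair(2)[OF that] i(2)
    by (auto simp: \<rho>_def)
  have le_sp: "induced X \<preceq> induced (lin_span R M (X \<union> Y))" "induced Y \<preceq> induced (lin_span R M (X \<union> Y))"
    if "cov X" "cov Y" "X \<noteq> Y" for X Y
    using induced_mono[OF i(1), of X "lin_span R M (X \<union> Y)"] induced_mono[OF i(1), of Y "lin_span R M (X \<union> Y)"]
      span[OF that(1,2)] pair(2)[OF that] i(2) that by (auto simp: cov_def)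
  have join: "induced X \<union>\<^sub>L induced Y = induced (lin_span R M (X \<union> Y))"
    and meet: "rk (induced X \<inter>\<^sub>L induced Y) = \<rho>" "induced X \<inter>\<^sub>L induced Y \<in> L"
    if c: "cov X" "cov Y" "X \<noteq> Y" for X Y
  proof -
    have jL: "induced X \<union>\<^sub>L induced Y \<in> L" using cl c join_closed by auto
    have le: "induced X \<union>\<^sub>L induced Y \<preceq> induced (lin_span R M (X \<union> Y))"
      using cl c sp[OF c] le_sp[OF c] by (intro join_least) auto
    \<comment> \<open>The meet has rank at most \<rho>, the join rank at most \<rho> + 2, and by
      modularity the two ranks add up to 2\<rho> + 2; so both bounds are attained.\<close>
    have "rk (induced X \<inter>\<^sub>L induced Y) \<le> \<rho>"
      using rk_induced_meet_le[OF i(1), of X Y] c pair(1)[OF c] A i(2) by (auto simp: cov_def \<rho>_def)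
    moreover have "rk (induced X \<union>\<^sub>L induced Y) \<le> \<rho> + 2" using rk_mono[OF jL _ le] sp[OF c] by simp
    moreover have "rk (induced X \<union>\<^sub>L induced Y) + rk (induced X \<inter>\<^sub>L induced Y) = 2 * \<rho> + 2"
      using rk_modular[of "induced X" "induced Y"] cl c by simp
    ultimately have r: "rk (induced X \<inter>\<^sub>L induced Y) = \<rho>" "rk (induced X \<union>\<^sub>L induced Y) = \<rho> + 2" by auto
    show "induced X \<union>\<^sub>L induced Y = induced (lin_span R M (X \<union> Y))"
      using rk_eqD[OF jL _ le] sp[OF c] r by simp
    show "rk (induced X \<inter>\<^sub>L induced Y) = \<rho>" "induced X \<inter>\<^sub>L induced Y \<in> L"
      using r meet_closed cl c by auto
  qed
  have outside: "induced X \<inter>\<^sub>L induced Y \<preceq> induced Z"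
    if c: "cov X" "cov Y" "X \<noteq> Y" "cov Z" "\<not> Z \<subseteq> lin_span R M (X \<union> Y)" for X Y Z
  proof (rule ccontr)
    assume nle: "\<not> induced X \<inter>\<^sub>L induced Y \<preceq> induced Z"
    have ne: "X \<noteq> Z" "Y \<noteq> Z" using span[OF c(1,2)] c(5) by auto
    have "induced X \<inter>\<^sub>L induced Y \<preceq> induced Z \<or> induced Z \<preceq> induced X \<union>\<^sub>L induced Y"
      by (rule triangle[of _ _ _ "\<rho> + 1"]) (use cl c meet ne in auto)
    then have Z: "induced Z \<preceq> induced (lin_span R M (X \<union> Y))" using nle join[OF c(1-3)] by simp
    have "induced X \<union>\<^sub>L induced Z \<preceq> induced (lin_span R M (X \<union> Y))"
      using Z le_sp[OF c(1-3)] cl c sp[OF c(1-3)] by (intro join_least) auto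
    then have eq: "induced (lin_span R M (X \<union> Z)) = induced (lin_span R M (X \<union> Y))"
      unfolding join[OF c(1,4) ne(1)] using sp[OF c(1-3)] sp[OF c(1,4) ne(1)] by (intro rk_eqD) auto
    let ?D = "lin_span R M (X \<union> Z)" and ?E = "lin_span R M (X \<union> Y)"
    have DE: "submodule (?D \<inter> ?E) R M" using span(1) c by (intro subspace_Int) auto
    \<comment> \<open>The images of \<open>?D\<close> and \<open>?E\<close> coincide, so their meet
      has the full rank \<rho> + 2, and the rank bound forces the intersection of \<open>?D\<close>
      and \<open>?E\<close> to have dimension i + 2.\<close>
    have "rk (induced ?D \<inter>\<^sub>L induced ?E) \<le> K - int k + int (vdim R M (?D \<inter> ?E))"
      using rk_induced_meet_le[OF i(1), of ?D ?E] span(1) c pair(2) ne i(2) by auto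
    then have "i + 2 \<le> vdim R M (?D \<inter> ?E)"
      using eq meet_idem sp[OF c(1-3)] by (simp add: \<rho>_def)
    then have "?D \<inter> ?E = ?D" "?D \<inter> ?E = ?E"
      using vdim_eqD[OF DE span(1)[OF c(1,4)]] vdim_eqD[OF DE span(1)[OF c(1,2)]]
        pair(2)[OF c(1-3)] pair(2)[OF c(1,4) ne(1)] by auto
    then have "?D = ?E" by simp
    then show False using span(3)[OF c(1,4)] c(5) by simp
  qed
  have c: "cov X" "cov Y" "cov Z" using X Y Z by (auto simp: cov_def)
  show "rk (induced X \<inter>\<^sub>L induced Y) = K - int k + int i" using meet[OF c(1,2) ne] by (simp add: \<rho>_def)
  show "induced X \<inter>\<^sub>L induced Y \<preceq> induced Z"
  proof (cases "Z \<subseteq> lin_span R M (X \<union> Y)")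
    case False
    then show ?thesis using outside c ne by blast
  next
    case True
    show ?thesis
    proof (cases "Z = X")
      case True
      then show ?thesis using meet_le1 cl c by simp
    next
      case False
      have "A \<subseteq> lin_span R M (X \<union> Y)" "vdim R M (lin_span R M (X \<union> Y)) < n"
        using span[OF c(1,2)] X pair(2)[OF c(1,2) ne] i(2) k_le k_ge_2 by auto
      \<comment> \<open>As for stars of vertices, a cover \<open>T\<close> outside the span replaces
        \<open>Y\<close>: the meet of the images stays the same, and \<open>Z\<close> is outside the
        span of \<open>X\<close> and \<open>T\<close>.\<close>
      then obtain T where "submodule T R M" "A \<subseteq> T" "vdim R M T = Suc (vdim R M A)"
        and T: "\<not> T \<subseteq> lin_span R M (X \<union> Y)"
        using ex_cover_outside[OF A(1) span(1)[OF c(1,2)]] by blast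
      then have cT: "cov T" using A by (simp add: cov_def)
      have XT: "X \<noteq> T" using T span[OF c(1,2)] by auto
      have le: "induced X \<inter>\<^sub>L induced Y \<preceq> induced T" using outside[OF c(1,2) ne cT T] .
      have eq: "induced X \<inter>\<^sub>L induced T = induced X \<inter>\<^sub>L induced Y"
        using meet_triple_eq[OF _ _ _ le] cl c cT meet XT ne by simp
      have "\<not> Z \<subseteq> lin_span R M (X \<union> T)"
      proof
        assume ZT: "Z \<subseteq> lin_span R M (X \<union> T)"
        have d: "vdim R M Q = Suc (vdim R M A)" if "cov Q" for Q using that A by (simp add: cov_def)
        have XZ: "lin_span R M (X \<union> Z) = lin_span R M (X \<union> T)"
          using lin_span_Un_eq_of_covers[OF A(1) X(1) Z(1) X(3) Z(3) False[symmetric] d[OF c(1)] d[OF c(3)]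
              span(1)[OF c(1) cT] span(2)[OF c(1) cT] ZT] pair(2)[OF c(1) cT XT] A by simp
        have "lin_span R M (X \<union> Z) = lin_span R M (X \<union> Y)"
          using lin_span_Un_eq_of_covers[OF A(1) X(1) Z(1) X(3) Z(3) False[symmetric] d[OF c(1)] d[OF c(3)]
              span(1)[OF c(1,2)] span(2)[OF c(1,2)] True] pair(2)[OF c(1,2) ne] A by simp
        then show False using XZ T span(3)[OF c(1) cT] by simp
      qed
      then show ?thesis using outside[OF c(1) cT XT c(3)] eq by simp
    qed
  qed
qed

text \<open>The images of two covers of X \<inter> Y meet in an element of rank K - k + i. It lies
  below the image of every vertex \<open>T\<close> containing X \<inter> Y, because \<open>T\<close>
  contains some cover of X \<inter> Y and the images of all covers lie above that element. In
  particular it is below \<open>f X\<close> and \<open>f Y\<close>, and by rank it is their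
  meet.\<close>

lemma meets_le_step:
  assumes i: "meets_le (Suc i)" "i + 2 \<le> k"
  shows "meets_le i"
  unfolding meets_le_def
proof (intro ballI impI)
  fix X Y Z assume V: "X \<in> kspaces" "Y \<in> kspaces" "Z \<in> kspaces"
    and d: "i \<le> vdim R M (X \<inter> Y)" and XYZ: "X \<inter> Y \<subseteq> Z"
  show "f X \<inter>\<^sub>L f Y \<preceq> f Z"
  proof (cases "vdim R M (X \<inter> Y) = i")
    case False
    then show ?thesis using meets_leD[OF i(1) V _ XYZ] d by simp
  next
    case True
    let ?A = "X \<inter> Y"
    have A: "submodule ?A R M" using kspaces_Int V by blast
    have dn: "vdim R M ?A < n" using True i(2) k_le by linarith
    obtain P where P: "submodule P R M" "?A \<subseteq> P" "vdim R M P = Suc i"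
      using ex_cover_outside[OF A A order_refl dn] True by metis
    obtain Q where Q: "submodule Q R M" "?A \<subseteq> Q" "vdim R M Q = Suc i" "\<not> Q \<subseteq> P"
      using ex_cover_outside[OF A P(1,2)] True P i(2) k_le by auto
    have PQ: "P \<noteq> Q" using Q by auto
    have le: "induced P \<inter>\<^sub>L induced Q \<preceq> f T" if T: "T \<in> kspaces" "?A \<subseteq> T" for T
    proof -
      have "\<not> T \<subseteq> ?A" using vdim_mono[OF kspacesD(1)[OF T(1)] A] kspacesD(2)[OF T(1)] True i(2) by auto
      then obtain B where B: "submodule B R M" "?A \<subseteq> B" "B \<subseteq> T" "vdim R M B = Suc (vdim R M ?A)"
        using ex_cover_within[OF A kspacesD(1)[OF T(1)] T(2) A] by blast
      have "induced P \<inter>\<^sub>L induced Q \<preceq> induced B"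
        using induced_star_meet(1)[OF i A True P(1,3,2) Q(1,3,2) B(1) _ B(2) PQ] B True by simp
      moreover have "induced B \<preceq> f T"
        using induced_mono[OF i(1) B(1) kspacesD(1)[OF T(1)] B(3)] induced_kspace[OF i(1) T(1)] kspacesD[OF T(1)] B True i(2)
        by auto
      moreover have "induced B \<in> L" "induced P \<in> L" "induced Q \<in> L"
        using induced_closed(1)[OF i(1)] B P Q True i(2) by auto
      ultimately show ?thesis
        using le_trans[of "induced P \<inter>\<^sub>L induced Q" "induced B" "f T"] meet_closed kspacesD(3)[OF T(1)] by auto
    qed
    have L: "induced P \<in> L" "induced Q \<in> L" using induced_closed(1)[OF i(1)] P Q i(2) by auto
    have "induced P \<inter>\<^sub>L induced Q \<preceq> f X \<inter>\<^sub>L f Y"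
      using le[OF V(1)] le[OF V(2)] meet_closed[OF L] kspacesD(3) V by (intro meet_greatest) auto
    then have "induced P \<inter>\<^sub>L induced Q = f X \<inter>\<^sub>L f Y"
      using meet_closed[OF L] kspaces_Int[OF V(1,2)] True
        induced_star_meet(2)[OF i A True P(1,3,2) Q(1,3,2) P(1,3,2) PQ] by (intro rk_eqD) auto
    then show ?thesis using le[OF V(3) XYZ] by simp
  qed
qed

text \<open>At level k - 1 the invariant says that stars go to stars; from there
  \<open>meets_le_step\<close> applies as long as i + 2 \<le> k.\<close>

lemma meets_le_zero:
  assumes "\<And>A. submodule A R M \<Longrightarrow> Suc (vdim R M A) = k \<Longrightarrow> star_to_star A"
  shows "meets_le 0"
proof -
  \<comment> \<open>\<open>j\<close> counts the levels below k - 1, which turns the descent into an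
    ordinary induction.\<close>
  have "meets_le (k - 1 - j)" if "j \<le> k - 1" for j
    using that
  proof (induction j)
    case 0
    show ?case unfolding meets_le_def
    proof (intro ballI impI)
      fix X Y Z assume V: "X \<in> kspaces" "Y \<in> kspaces" "Z \<in> kspaces"
        and d: "k - 1 - 0 \<le> vdim R M (X \<inter> Y)" and XYZ: "X \<inter> Y \<subseteq> Z"
      note I = kspaces_Int(1)[OF V(1,2)]
      show "f X \<inter>\<^sub>L f Y \<preceq> f Z"
      proof (cases "X = Y")
        case True
        then have "X = Z" using vdim_eqD[of X Z] XYZ kspacesD V by auto
        then show ?thesis using True meet_le1 kspacesD V by auto
      next
        case False
        have "vdim R M (X \<inter> Y) < k"
        proof (rule ccontr)
          assume "\<not> vdim R M (X \<inter> Y) < k"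
          then have "X \<inter> Y = X" "X \<inter> Y = Y"
            using vdim_eqD[OF I kspacesD(1)[OF V(1)]] vdim_eqD[OF I kspacesD(1)[OF V(2)]] kspacesD(2) V by auto
          then show False using False by simp
        qed
        then have "Suc (vdim R M (X \<inter> Y)) = k" using d by simp
        moreover have "X \<in> star (X \<inter> Y)" "Y \<in> star (X \<inter> Y)" "Z \<in> star (X \<inter> Y)"
          using V XYZ by (auto simp: kspaces_def star_def)
        ultimately show ?thesis using assms[OF I] False unfolding star_to_star_def by blast
      qed
    qed
  next
    case (Suc j)
    have "Suc (k - 1 - Suc j) = k - 1 - j" using Suc by simp
    then have "meets_le (Suc (k - 1 - Suc j))" "k - 1 - Suc j + 2 \<le> k" using Suc by simp_all
    then show ?case by (rule meets_le_step)
  qed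
  from this[of "k - 1"] show ?thesis by simp
qed

end

text \<open>The situation in which stars go to stars. Both cases of the theorem are instances, the
  second with the order of the target reversed.\<close>

locale grassmann_star_map = grassmann_rank_map +
  assumes meets_le_0: "meets_le 0"
begin

lemmas induced_kspace_eq = induced_kspace[OF meets_le_0 _ le0]
  and induced_in_L = induced_closed(1)[OF meets_le_0 _ le0]
  and rk_induced = induced_closed(2)[OF meets_le_0 _ le0]
  and induced_le = induced_mono[OF meets_le_0 _ _ _ le0]

text \<open>Monotonicity gives one inequality, and \<open>rk_induced_meet_le\<close> keeps the rank
  of the meet from being larger.\<close>

lemma induced_Int_eq:
  assumes A: "submodule A R M" "vdim R M A \<le> k" and B: "submodule B R M" "vdim R M B \<le> k"
  shows "induced A \<inter>\<^sub>L induced B = induced (A \<inter> B)"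
proof (rule eq_if_rk_le[symmetric])
  have I: "submodule (A \<inter> B) R M" by (rule subspace_Int[OF A(1) B(1)])
  have d: "vdim R M (A \<inter> B) \<le> k" using vdim_mono[OF I A(1)] A(2) by auto
  show "induced (A \<inter> B) \<in> L" using induced_in_L[OF I d] .
  show "induced A \<inter>\<^sub>L induced B \<in> L" using induced_in_L A B by (intro meet_closed) auto
  show "induced (A \<inter> B) \<preceq> induced A \<inter>\<^sub>L induced B"
    using induced_in_L induced_le[OF I A(1) _ A(2)] induced_le[OF I B(1) _ B(2)] I d A B
    by (intro meet_greatest) auto
  show "rk (induced A \<inter>\<^sub>L induced B) \<le> rk (induced (A \<inter> B))"
    using rk_induced_meet_le[OF meets_le_0 A(1) le0 A(2) B(1) le0 B(2)] rk_induced[OF I d] by simp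
qed

text \<open>The join and the image of the sum have the same rank: one by the modular law together
  with \<open>induced_Int_eq\<close>, the other by the dimension formula. The sum must have
  dimension at most \<open>k\<close> to be in the range where \<open>induced\<close> is
  controlled.\<close>

lemma induced_Un_eq:
  assumes A: "submodule A R M" and B: "submodule B R M" and AB: "vdim R M (lin_span R M (A \<union> B)) \<le> k"
  shows "induced A \<union>\<^sub>L induced B = induced (lin_span R M (A \<union> B))"
proof (rule eq_if_rk_le)
  let ?S = "lin_span R M (A \<union> B)"
  have sub: "A \<union> B \<subseteq> carrier M" using A B subspace_subset by auto
  have S: "submodule ?S R M" using lin_span_subspace[OF sub] .
  have le: "A \<subseteq> ?S" "B \<subseteq> ?S" using lin_span_superset[OF sub] by auto
  have d: "vdim R M A \<le> k" "vdim R M B \<le> k"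
    using vdim_mono[OF A S le(1)] vdim_mono[OF B S le(2)] AB by auto
  have I: "submodule (A \<inter> B) R M" by (rule subspace_Int[OF A B])
  have dI: "vdim R M (A \<inter> B) \<le> k" using vdim_mono[OF I A] d by auto
  show L: "induced A \<union>\<^sub>L induced B \<in> L" using induced_in_L A B d by (intro join_closed) auto
  show "induced ?S \<in> L" using induced_in_L[OF S AB] .
  show "induced A \<union>\<^sub>L induced B \<preceq> induced ?S"
    using induced_in_L induced_le[OF A S le(1) AB] induced_le[OF B S le(2) AB] A B d S AB
    by (intro join_least) auto
  show "rk (induced ?S) \<le> rk (induced A \<union>\<^sub>L induced B)"
    using rk_modular[of "induced A" "induced B"] induced_Int_eq[OF A d(1) B d(2)] induced_in_L[OF A d(1)]
      induced_in_L[OF B d(2)] rk_induced[OF A d(1)] rk_induced[OF B d(2)] rk_induced[OF I dI] rk_induced[OF S AB]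
      vdim_Un_Int[OF A B] by simp
qed

end

section \<open>The fundamental theorem of projective geometry\<close>

context left_vector_space
begin

lemma lin_span_singleton_eq:
  assumes "p \<in> carrier M" "u \<in> lin_span R M {p}" "u \<noteq> \<zero>\<^bsub>M\<^esub>"
  shows "lin_span R M {u} = lin_span R M {p}"
proof -
  have u: "u \<in> carrier M" using assms lin_span_memD[of "{p}"] by auto
  have "p \<in> lin_span R M {u}"
    using lin_span_exchange[of p "{}" u] assms by (simp add: lin_span_empty)
  then have "lin_span R M {p} \<subseteq> lin_span R M {u}"
    using u by (intro lin_span_subset lin_span_subspace) simp_all
  moreover have "lin_span R M {u} \<subseteq> lin_span R M {p}"
    using assms(1,2) by (intro lin_span_subset lin_span_subspace) simp_all
  ultimately show ?thesis by (rule antisym[rotated])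
qed

lemma lin_span_insert_cong:
  assumes "p \<in> carrier M" "u \<in> carrier M" "A \<subseteq> carrier M" "lin_span R M {u} = lin_span R M {p}"
  shows "lin_span R M (insert u A) = lin_span R M (insert p A)"
  using lin_span_Un[of "{u}" A] lin_span_Un[of "{p}" A] assms by simp

lemma lin_span_pair_iff:
  assumes "x \<in> carrier M" "y \<in> carrier M"
  shows "z \<in> lin_span R M {x, y} \<longleftrightarrow>
    (\<exists>a\<in>carrier R. \<exists>b\<in>carrier R. z = a \<odot>\<^bsub>M\<^esub> x \<oplus>\<^bsub>M\<^esub> b \<odot>\<^bsub>M\<^esub> y)"
  using lin_span_insert[of x "{y}" z] lin_span_singleton[of y] assms by auto

lemma smult_mem_lin_span_singleton: "x \<in> carrier M \<Longrightarrow> a \<in> carrier R \<Longrightarrow> a \<odot>\<^bsub>M\<^esub> x \<in> lin_span R M {x}"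
  by (auto simp: lin_span_singleton)

text \<open>The difference of the coefficients times \<open>r\<close> lies in \<open>X\<close>;
  scalars other than zero are invertible and \<open>r\<close> is outside \<open>X\<close>, so the
  difference is zero.\<close>

lemma coeff_unique:
  assumes X: "submodule X R M" and r: "r \<in> carrier M" "r \<notin> X" and uv: "u \<in> X" "v \<in> X"
    and c: "c \<in> carrier R" "c' \<in> carrier R"
    and eq: "u \<oplus>\<^bsub>M\<^esub> c \<odot>\<^bsub>M\<^esub> r = v \<oplus>\<^bsub>M\<^esub> c' \<odot>\<^bsub>M\<^esub> r"
  shows "c = c'" "u = v"
proof -
  have M: "u \<in> carrier M" "v \<in> carrier M" "c \<odot>\<^bsub>M\<^esub> r \<in> carrier M" "c' \<odot>\<^bsub>M\<^esub> r \<in> carrier M"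
    using subspace_memD[OF X] uv c r smult_closed by auto
  have d: "c \<ominus> c' \<in> carrier R" and cd: "(c \<ominus> c') \<oplus> c' = c"
    using c by (simp_all add: R.minus_eq R.a_assoc R.l_neg)
  have dr: "(c \<ominus> c') \<odot>\<^bsub>M\<^esub> r \<in> carrier M" using d r smult_closed by simp
  have "(c \<ominus> c') \<odot>\<^bsub>M\<^esub> r \<oplus>\<^bsub>M\<^esub> c' \<odot>\<^bsub>M\<^esub> r = c \<odot>\<^bsub>M\<^esub> r"
    using smult_l_distr[OF d c(2) r(1)] cd by simp
  then have "(u \<oplus>\<^bsub>M\<^esub> (c \<ominus> c') \<odot>\<^bsub>M\<^esub> r) \<oplus>\<^bsub>M\<^esub> c' \<odot>\<^bsub>M\<^esub> r = v \<oplus>\<^bsub>M\<^esub> c' \<odot>\<^bsub>M\<^esub> r"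
    using eq M dr by (simp add: M.a_assoc)
  then have "u \<oplus>\<^bsub>M\<^esub> (c \<ominus> c') \<odot>\<^bsub>M\<^esub> r = v" using M dr by (simp add: M.add.right_cancel)
  then have "(c \<ominus> c') \<odot>\<^bsub>M\<^esub> r \<in> X"
    using subspace_add_cancel_left[OF X uv(1) dr] uv(2) by simp
  then have "c \<ominus> c' = \<zero>" using subspace_smult_cancel[OF X d _ r(1)] r(2) by blast
  then show "c = c'" using c cd by simp
  then show "u = v" using eq M by (simp add: M.add.right_cancel)
qed

lemma coeff_unique2:
  assumes p: "p \<in> carrier M" "p \<noteq> \<zero>\<^bsub>M\<^esub>" and q: "q \<in> carrier M" "q \<notin> lin_span R M {p}"
    and "a \<in> carrier R" "a' \<in> carrier R" "b \<in> carrier R" "b' \<in> carrier R"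
    and eq: "a \<odot>\<^bsub>M\<^esub> p \<oplus>\<^bsub>M\<^esub> b \<odot>\<^bsub>M\<^esub> q = a' \<odot>\<^bsub>M\<^esub> p \<oplus>\<^bsub>M\<^esub> b' \<odot>\<^bsub>M\<^esub> q"
  shows "a = a'" "b = b'"
proof -
  have sp: "submodule (lin_span R M {p}) R M" using p by (intro lin_span_subspace) auto
  note cu = coeff_unique[OF sp q smult_mem_lin_span_singleton[OF p(1) assms(5)] smult_mem_lin_span_singleton[OF p(1) assms(6)] assms(7,8) eq]
  show "b = b'" by (rule cu(1))
  \<comment> \<open>The zero summands give the equation the form of \<open>coeff_unique\<close> for
    the zero subspace.\<close>
  have "\<zero>\<^bsub>M\<^esub> \<oplus>\<^bsub>M\<^esub> a \<odot>\<^bsub>M\<^esub> p = \<zero>\<^bsub>M\<^esub> \<oplus>\<^bsub>M\<^esub> a' \<odot>\<^bsub>M\<^esub> p"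
    using cu(2) smult_closed p assms by simp
  then show "a = a'"
    using coeff_unique(1)[OF subspace_zero_set p(1) _ _ _ assms(5,6)] p by auto
qed

lemma coeff_unique3:
  assumes p: "p \<in> carrier M" "p \<noteq> \<zero>\<^bsub>M\<^esub>" and q: "q \<in> carrier M" "q \<notin> lin_span R M {p}"
    and r: "r \<in> carrier M" "r \<notin> lin_span R M {p, q}"
    and ab: "a \<in> carrier R" "a' \<in> carrier R" "b \<in> carrier R" "b' \<in> carrier R" "c \<in> carrier R" "c' \<in> carrier R"
    and eq: "(a \<odot>\<^bsub>M\<^esub> p \<oplus>\<^bsub>M\<^esub> b \<odot>\<^bsub>M\<^esub> q) \<oplus>\<^bsub>M\<^esub> c \<odot>\<^bsub>M\<^esub> r = (a' \<odot>\<^bsub>M\<^esub> p \<oplus>\<^bsub>M\<^esub> b' \<odot>\<^bsub>M\<^esub> q) \<oplus>\<^bsub>M\<^esub> c' \<odot>\<^bsub>M\<^esub> r"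
  shows "a = a'" "b = b'" "c = c'"
proof -
  have sp: "submodule (lin_span R M {p, q}) R M" using p q by (intro lin_span_subspace) auto
  have m: "a \<odot>\<^bsub>M\<^esub> p \<oplus>\<^bsub>M\<^esub> b \<odot>\<^bsub>M\<^esub> q \<in> lin_span R M {p, q}" "a' \<odot>\<^bsub>M\<^esub> p \<oplus>\<^bsub>M\<^esub> b' \<odot>\<^bsub>M\<^esub> q \<in> lin_span R M {p, q}"
    using lin_span_pair_iff[OF p(1) q(1)] ab by blast+
  note cu = coeff_unique[OF sp r m ab(5,6) eq]
  show "c = c'" by (rule cu(1))
  show "a = a'" "b = b'" using coeff_unique2[OF p q ab(1-4) cu(2)] by simp_all
qed

end

text \<open>\<open>g\<close> picks an arbitrary vector on the image of each point, with no
  compatibility between multiples of one vector. Independence of up to three points is enough, since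
  every comparison of coefficients takes place in the span of at most three image vectors.\<close>

locale projective_map = V: fin_vector_space R M n + W: left_vector_space S N
  for R :: "('a, 'r) ring_scheme" and M :: "('a, 'v, 'm) module_scheme" and n
    and S :: "('b, 's) ring_scheme" and N :: "('b, 'w, 'k) module_scheme" +
  fixes g :: "'v \<Rightarrow> 'w"
  assumes n_ge_3: "3 \<le> n"
    and g_closed: "\<lbrakk>x \<in> carrier M; x \<noteq> \<zero>\<^bsub>M\<^esub>\<rbrakk> \<Longrightarrow> g x \<in> carrier N"
    and g_nonzero: "\<lbrakk>x \<in> carrier M; x \<noteq> \<zero>\<^bsub>M\<^esub>\<rbrakk> \<Longrightarrow> g x \<noteq> \<zero>\<^bsub>N\<^esub>"
    and g_line: "\<lbrakk>x \<in> carrier M; x \<noteq> \<zero>\<^bsub>M\<^esub>; y \<in> carrier M; y \<noteq> \<zero>\<^bsub>M\<^esub>; z \<in> lin_span R M {x, y}; z \<noteq> \<zero>\<^bsub>M\<^esub>\<rbrakk>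
      \<Longrightarrow> g z \<in> lin_span S N {g x, g y}"
    and g_indep2: "\<lbrakk>x \<in> carrier M; x \<noteq> \<zero>\<^bsub>M\<^esub>; y \<in> carrier M; y \<notin> lin_span R M {x}\<rbrakk>
      \<Longrightarrow> g y \<notin> lin_span S N {g x}"
    and g_indep3: "\<lbrakk>x \<in> carrier M; x \<noteq> \<zero>\<^bsub>M\<^esub>; y \<in> carrier M; y \<notin> lin_span R M {x};
        z \<in> carrier M; z \<notin> lin_span R M {x, y}\<rbrakk> \<Longrightarrow> g z \<notin> lin_span S N {g x, g y}"
begin

lemma zero_in_span: "A \<subseteq> carrier M \<Longrightarrow> \<zero>\<^bsub>M\<^esub> \<in> lin_span R M A"
  using V.subspace_zero V.lin_span_subspace by blast

lemma g_point:
  assumes "x \<in> carrier M" "x \<noteq> \<zero>\<^bsub>M\<^esub>" "z \<in> lin_span R M {x}" "z \<noteq> \<zero>\<^bsub>M\<^esub>"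
  shows "g z \<in> lin_span S N {g x}"
  using g_line[OF assms(1,2) assms(1,2)] assms by simp

section \<open>Rescaling on the affine chart of points x + e with x in a hyperplane\<close>

context
  fixes e H
  assumes e: "e \<in> carrier M" "e \<noteq> \<zero>\<^bsub>M\<^esub>"
    and H: "submodule H R M" "e \<notin> H" "Suc (vdim R M H) = n"
begin

lemma H_carrier: "x \<in> H \<Longrightarrow> x \<in> carrier M"
  using V.subspace_memD[OF H(1)] .

lemma add_e: "x \<in> H \<Longrightarrow> x \<oplus>\<^bsub>M\<^esub> e \<in> carrier M" "x \<in> H \<Longrightarrow> x \<oplus>\<^bsub>M\<^esub> e \<notin> H"
  "x \<in> H \<Longrightarrow> x \<oplus>\<^bsub>M\<^esub> e \<noteq> \<zero>\<^bsub>M\<^esub>"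
proof -
  assume x: "x \<in> H"
  show "x \<oplus>\<^bsub>M\<^esub> e \<in> carrier M" using H_carrier[OF x] e by simp
  show *: "x \<oplus>\<^bsub>M\<^esub> e \<notin> H" using V.subspace_add_cancel_left[OF H(1) x e(1)] H(2) by blast
  then show "x \<oplus>\<^bsub>M\<^esub> e \<noteq> \<zero>\<^bsub>M\<^esub>" using V.subspace_zero[OF H(1)] by metis
qed

lemma span_H: "A \<subseteq> H \<Longrightarrow> lin_span R M A \<subseteq> H"
  by (rule V.lin_span_subset[OF H(1)])

lemma notin_span_add_e: "x \<in> H \<Longrightarrow> x \<noteq> \<zero>\<^bsub>M\<^esub> \<Longrightarrow> x \<oplus>\<^bsub>M\<^esub> e \<notin> lin_span R M {x}"
  using add_e(2) span_H[of "{x}"] by auto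

lemma e_notin_span_add_e:
  assumes "x \<in> H" "x \<noteq> \<zero>\<^bsub>M\<^esub>"
  shows "e \<notin> lin_span R M {x \<oplus>\<^bsub>M\<^esub> e}"
proof
  assume "e \<in> lin_span R M {x \<oplus>\<^bsub>M\<^esub> e}"
  then have "lin_span R M {e} = lin_span R M {x \<oplus>\<^bsub>M\<^esub> e}"
    using V.lin_span_singleton_eq[OF add_e(1)] assms e by blast
  then have "x \<oplus>\<^bsub>M\<^esub> e \<in> lin_span R M {e}" using V.lin_span_mem[of "{x \<oplus>\<^bsub>M\<^esub> e}"] add_e assms by simp
  then have "x \<in> lin_span R M {e}"
    using V.subspace_add_cancel_right[OF V.lin_span_subspace, of "{e}" e x] V.lin_span_mem[of "{e}" e]
      e H_carrier[OF assms(1)] by simp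
  then have "lin_span R M {x} = lin_span R M {e}" using V.lin_span_singleton_eq assms e by blast
  then have "e \<in> lin_span R M {x}" using V.lin_span_mem[of "{e}" e] e by simp
  then show False using span_H[of "{x}"] assms H(2) by auto
qed

text \<open>Scales \<open>g x\<close> so that adding \<open>g e\<close> gives a multiple of \<open>g (x + e)\<close>; meaningful only on the
  hyperplane \<open>H\<close>, which avoids \<open>e\<close>.\<close>

definition lift :: "'v \<Rightarrow> 'w" where
  "lift x = (if x = \<zero>\<^bsub>M\<^esub> then \<zero>\<^bsub>N\<^esub> else
    (SOME w. w \<in> lin_span S N {g x} \<and> w \<oplus>\<^bsub>N\<^esub> g e \<in> lin_span S N {g (x \<oplus>\<^bsub>M\<^esub> e)}))"

lemma ge: "g e \<in> carrier N" "g e \<noteq> \<zero>\<^bsub>N\<^esub>"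
  using g_closed g_nonzero e by auto

text \<open>Both candidates satisfy an equation w + g(e) = c g(x + e). Eliminating g(e) leaves a
  relation between the lines of g(x) and g(x + e), which are distinct.\<close>

lemma lift_unique:
  assumes x: "x \<in> H" "x \<noteq> \<zero>\<^bsub>M\<^esub>"
    and w: "w \<in> lin_span S N {g x}" "w \<oplus>\<^bsub>N\<^esub> g e \<in> lin_span S N {g (x \<oplus>\<^bsub>M\<^esub> e)}"
    and w': "w' \<in> lin_span S N {g x}" "w' \<oplus>\<^bsub>N\<^esub> g e \<in> lin_span S N {g (x \<oplus>\<^bsub>M\<^esub> e)}"
  shows "w = w'"
proof -
  let ?p = "g x" and ?q = "g (x \<oplus>\<^bsub>M\<^esub> e)"
  have p: "?p \<in> carrier N" "?p \<noteq> \<zero>\<^bsub>N\<^esub>" and q: "?q \<in> carrier N"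
    using g_closed g_nonzero x H_carrier add_e by auto
  have qp: "?q \<notin> lin_span S N {?p}"
    using g_indep2 notin_span_add_e[OF x] x H_carrier add_e by auto
  obtain c where c: "c \<in> carrier S" "w \<oplus>\<^bsub>N\<^esub> g e = c \<odot>\<^bsub>N\<^esub> ?q" using w W.lin_span_singleton[OF q] by auto
  obtain c' where c': "c' \<in> carrier S" "w' \<oplus>\<^bsub>N\<^esub> g e = c' \<odot>\<^bsub>N\<^esub> ?q" using w' W.lin_span_singleton[OF q] by auto
  have sp: "submodule (lin_span S N {?p}) S N" using p by (intro W.lin_span_subspace) auto
  have wN: "w \<in> carrier N" "w' \<in> carrier N" using W.subspace_memD[OF sp] w w' by auto
  have cq: "c \<odot>\<^bsub>N\<^esub> ?q \<in> carrier N" "c' \<odot>\<^bsub>N\<^esub> ?q \<in> carrier N" using c c' q W.smult_closed by auto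
  have "(w' \<oplus>\<^bsub>N\<^esub> c \<odot>\<^bsub>N\<^esub> ?q) = w \<oplus>\<^bsub>N\<^esub> c' \<odot>\<^bsub>N\<^esub> ?q"
    unfolding c(2)[symmetric] c'(2)[symmetric] using wN ge by (simp add: W.M.a_ac)
  from W.coeff_unique[OF sp q qp w'(1) w(1) c(1) c'(1) this] show ?thesis by simp
qed

text \<open>As x + e lies on the line through \<open>x\<close> and \<open>e\<close>, its image is a
  g(x) + b g(e). Here b \<noteq> 0, for otherwise g(x + e) would lie in the span of g(x); dividing
  by \<open>b\<close> gives the scaled vector.\<close>

lemma lift_props:
  assumes x: "x \<in> H" "x \<noteq> \<zero>\<^bsub>M\<^esub>"
  shows "lift x \<in> lin_span S N {g x}" "lift x \<oplus>\<^bsub>N\<^esub> g e \<in> lin_span S N {g (x \<oplus>\<^bsub>M\<^esub> e)}"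
proof -
  let ?p = "g x" and ?q = "g (x \<oplus>\<^bsub>M\<^esub> e)"
  have xM: "x \<in> carrier M" using H_carrier x by auto
  have p: "?p \<in> carrier N" "?p \<noteq> \<zero>\<^bsub>N\<^esub>" and q: "?q \<in> carrier N"
    using g_closed g_nonzero x H_carrier add_e by auto
  have qp: "?q \<notin> lin_span S N {?p}"
    using g_indep2 notin_span_add_e[OF x] x H_carrier add_e by auto
  have "x \<oplus>\<^bsub>M\<^esub> e \<in> lin_span R M {x, e}"
    using V.lin_span_mem[of "{x, e}"] xM e V.subspace_add[OF V.lin_span_subspace, of "{x, e}" x e] by auto
  then have "?q \<in> lin_span S N {?p, g e}"
    using g_line[OF xM x(2) e] add_e(3)[OF x(1)] by simp
  then obtain a b where ab: "a \<in> carrier S" "b \<in> carrier S" "?q = a \<odot>\<^bsub>N\<^esub> ?p \<oplus>\<^bsub>N\<^esub> b \<odot>\<^bsub>N\<^esub> g e"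
    using W.lin_span_pair_iff[OF p(1) ge(1)] by blast
  have b0: "b \<noteq> \<zero>\<^bsub>S\<^esub>"
  proof
    assume "b = \<zero>\<^bsub>S\<^esub>"
    then have "?q = a \<odot>\<^bsub>N\<^esub> ?p" using ab ge p W.smult_l_null W.smult_closed by simp
    then show False using qp W.smult_mem_lin_span_singleton[OF p(1) ab(1)] by simp
  qed
  let ?i = "inv\<^bsub>S\<^esub> b" and ?w = "(inv\<^bsub>S\<^esub> b \<otimes>\<^bsub>S\<^esub> a) \<odot>\<^bsub>N\<^esub> ?p"
  note i = W.inv_nonzero[OF ab(2) b0]
  have "?i \<odot>\<^bsub>N\<^esub> ?q = ?w \<oplus>\<^bsub>N\<^esub> g e"
    using ab i ge p W.smult_inv_cancel(1)[OF ab(2) b0 ge(1)]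
    by (simp add: W.smult_r_distr W.smult_closed W.smult_assoc)
  then have "?w \<oplus>\<^bsub>N\<^esub> g e \<in> lin_span S N {?q}" using W.smult_mem_lin_span_singleton[OF q i(1)] by simp
  moreover have "?w \<in> lin_span S N {?p}" using W.smult_mem_lin_span_singleton[OF p(1)] i ab by simp
  ultimately have "\<exists>w. w \<in> lin_span S N {g x} \<and> w \<oplus>\<^bsub>N\<^esub> g e \<in> lin_span S N {g (x \<oplus>\<^bsub>M\<^esub> e)}" by blast
  from someI_ex[OF this] x(2)
  show "lift x \<in> lin_span S N {g x}" "lift x \<oplus>\<^bsub>N\<^esub> g e \<in> lin_span S N {g (x \<oplus>\<^bsub>M\<^esub> e)}"
    by (simp_all add: lift_def)
qed

lemma lift_zero: "lift \<zero>\<^bsub>M\<^esub> = \<zero>\<^bsub>N\<^esub>"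
  by (simp add: lift_def)

lemma lift_closed: "x \<in> H \<Longrightarrow> lift x \<in> carrier N"
  using lift_props(1)[of x] W.lin_span_memD[of "{g x}"] g_closed H_carrier lift_zero by (cases "x = \<zero>\<^bsub>M\<^esub>") auto

lemma lift_nonzero:
  assumes x: "x \<in> H" "x \<noteq> \<zero>\<^bsub>M\<^esub>"
  shows "lift x \<noteq> \<zero>\<^bsub>N\<^esub>"
proof
  assume "lift x = \<zero>\<^bsub>N\<^esub>"
  then have "g e \<in> lin_span S N {g (x \<oplus>\<^bsub>M\<^esub> e)}" using lift_props(2)[OF x] ge by simp
  then show False using g_indep2[OF add_e(1,3)] e_notin_span_add_e x e by blast
qed

lemma lift_add_e_nonzero:
  assumes x: "x \<in> H" "x \<noteq> \<zero>\<^bsub>M\<^esub>"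
  shows "lift x \<oplus>\<^bsub>N\<^esub> g e \<noteq> \<zero>\<^bsub>N\<^esub>"
proof
  assume 0: "lift x \<oplus>\<^bsub>N\<^esub> g e = \<zero>\<^bsub>N\<^esub>"
  have gx: "{g x} \<subseteq> carrier N" using g_closed x H_carrier by auto
  have s: "submodule (lin_span S N {g x}) S N" using gx by (rule W.lin_span_subspace)
  have "g e \<in> lin_span S N {g x}"
    using W.subspace_add_cancel_left[OF s lift_props(1)[OF x] ge(1)] 0 W.subspace_zero[OF s] by simp
  moreover have "e \<notin> lin_span R M {x}" using span_H[of "{x}"] x H(2) by auto
  ultimately show False using g_indep2 x H_carrier e by blast
qed

lemma span_lift:
  assumes x: "x \<in> H" "x \<noteq> \<zero>\<^bsub>M\<^esub>"
  shows "lin_span S N {lift x} = lin_span S N {g x}"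
    "lin_span S N {lift x \<oplus>\<^bsub>N\<^esub> g e} = lin_span S N {g (x \<oplus>\<^bsub>M\<^esub> e)}"
  using W.lin_span_singleton_eq[OF g_closed[OF H_carrier[OF x(1)] x(2)] lift_props(1)[OF x] lift_nonzero[OF x]]
    W.lin_span_singleton_eq[OF g_closed[OF add_e(1,3)[OF x(1)]] lift_props(2)[OF x] lift_add_e_nonzero[OF x]]
  by simp_all

lemma lift_indep2:
  assumes "x \<in> H" "x \<noteq> \<zero>\<^bsub>M\<^esub>" "y \<in> H" "y \<notin> lin_span R M {x}"
  shows "lift y \<notin> lin_span S N {lift x}"
proof
  have y: "y \<noteq> \<zero>\<^bsub>M\<^esub>" using assms zero_in_span[of "{x}"] H_carrier by auto
  assume "lift y \<in> lin_span S N {lift x}"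
  then have "lin_span S N {g y} = lin_span S N {g x}"
    using W.lin_span_singleton_eq[OF lift_closed[OF assms(1)]] lift_nonzero[OF assms(3) y]
      span_lift(1)[OF assms(1,2)] span_lift(1)[OF assms(3) y] by simp
  then have "g y \<in> lin_span S N {g x}"
    using W.lin_span_mem[of "{g y}" "g y"] g_closed H_carrier assms y by auto
  then show False using g_indep2 assms H_carrier by blast
qed

lemma ge_notin_span_lift:
  assumes "x \<in> H" "x \<noteq> \<zero>\<^bsub>M\<^esub>" "y \<in> H" "y \<notin> lin_span R M {x}"
  shows "g e \<notin> lin_span S N {lift x, lift y}"
proof -
  have y: "y \<noteq> \<zero>\<^bsub>M\<^esub>" using assms zero_in_span[of "{x}"] H_carrier by auto
  have "lin_span S N {lift x, lift y} = lin_span S N {lift y, g x}"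
    using W.lin_span_insert_cong[OF _ _ _ span_lift(1)[OF assms(1,2)], of "{lift y}"]
      g_closed H_carrier lift_closed assms by (simp add: insert_commute)
  also have "\<dots> = lin_span S N {g x, g y}"
    using W.lin_span_insert_cong[OF _ _ _ span_lift(1)[OF assms(3) y], of "{g x}"]
      g_closed H_carrier lift_closed assms y by (simp add: insert_commute)
  moreover have "e \<notin> lin_span R M {x, y}" using span_H[of "{x, y}"] assms H(2) by auto
  ultimately show ?thesis using g_indep3 assms H_carrier e by blast
qed

text \<open>The point x + y + e is common to the line through x + e and \<open>y\<close> and the
  line through y + e and \<open>x\<close>; this forces its image to be a multiple of lift(x) +
  lift(y) + g(e). The point x + y is common to the line through x + y + e and \<open>e\<close> and
  the line through \<open>x\<close> and \<open>y\<close>; this forces its image to be a multiple of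
  lift(x) + lift(y). These two facts characterize the lift of x + y.\<close>

lemma lift_add_indep:
  assumes x: "x \<in> H" "x \<noteq> \<zero>\<^bsub>M\<^esub>" and y: "y \<in> H" "y \<notin> lin_span R M {x}"
  shows "lift (x \<oplus>\<^bsub>M\<^esub> y) = lift x \<oplus>\<^bsub>N\<^esub> lift y"
proof -
  have y0: "y \<noteq> \<zero>\<^bsub>M\<^esub>" using assms zero_in_span[of "{x}"] H_carrier by auto
  have xM: "x \<in> carrier M" "y \<in> carrier M" using H_carrier x y by auto
  have xyH: "x \<oplus>\<^bsub>M\<^esub> y \<in> H" using V.subspace_add[OF H(1)] x y by simp
  have xy0: "x \<oplus>\<^bsub>M\<^esub> y \<noteq> \<zero>\<^bsub>M\<^esub>"
  proof
    assume "x \<oplus>\<^bsub>M\<^esub> y = \<zero>\<^bsub>M\<^esub>"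
    then have "y \<in> lin_span R M {x}"
      using V.subspace_add_cancel_left[OF V.lin_span_subspace, of "{x}" x y] V.lin_span_mem[of "{x}" x]
        zero_in_span[of "{x}"] xM by simp
    then show False using y by simp
  qed
  let ?p = "lift x" and ?q = "lift y" and ?r = "g e"
  have pN: "?p \<in> carrier N" "?q \<in> carrier N" using lift_closed x y by auto
  note p0 = lift_nonzero[OF x] and q0 = lift_indep2[OF x y] and r0 = ge_notin_span_lift[OF x y]
  note cu = W.coeff_unique3[OF pN(1) p0 pN(2) q0 ge(1) r0]
  let ?G = "g ((x \<oplus>\<^bsub>M\<^esub> y) \<oplus>\<^bsub>M\<^esub> e)" and ?D = "g (x \<oplus>\<^bsub>M\<^esub> y)"
  have GN: "?G \<in> carrier N" "?G \<noteq> \<zero>\<^bsub>N\<^esub>" and DN: "?D \<in> carrier N" "?D \<noteq> \<zero>\<^bsub>N\<^esub>"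
    using g_closed g_nonzero add_e[OF xyH] H_carrier[OF xyH] xy0 by auto
  have sum_in: "u \<oplus>\<^bsub>M\<^esub> v \<in> lin_span R M {u, v}" if "u \<in> carrier M" "v \<in> carrier M" for u v
    using V.subspace_add[OF V.lin_span_subspace, of "{u, v}" u v] V.lin_span_mem[of "{u, v}"] that by auto
  have G1: "?G \<in> lin_span S N {?p \<oplus>\<^bsub>N\<^esub> ?r, ?q}"
  proof -
    have "(x \<oplus>\<^bsub>M\<^esub> y) \<oplus>\<^bsub>M\<^esub> e = (x \<oplus>\<^bsub>M\<^esub> e) \<oplus>\<^bsub>M\<^esub> y" using xM e by (simp add: V.M.a_ac)
    then have "(x \<oplus>\<^bsub>M\<^esub> y) \<oplus>\<^bsub>M\<^esub> e \<in> lin_span R M {x \<oplus>\<^bsub>M\<^esub> e, y}"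
      using sum_in[of "x \<oplus>\<^bsub>M\<^esub> e" y] xM e by simp
    then have "?G \<in> lin_span S N {g (x \<oplus>\<^bsub>M\<^esub> e), g y}"
      using g_line add_e[OF x(1)] add_e[OF xyH] xM y0 by blast
    also have "lin_span S N {g (x \<oplus>\<^bsub>M\<^esub> e), g y} = lin_span S N {?p \<oplus>\<^bsub>N\<^esub> ?r, g y}"
      using W.lin_span_insert_cong[OF _ _ _ span_lift(2)[OF x], of "{g y}"] g_closed xM y0 add_e[OF x(1)] pN ge
      by simp
    also have "\<dots> = lin_span S N {?p \<oplus>\<^bsub>N\<^esub> ?r, ?q}"
      using W.lin_span_insert_cong[OF _ _ _ span_lift(1)[OF y(1) y0], of "{?p \<oplus>\<^bsub>N\<^esub> ?r}"] g_closed xM y0 pN ge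
      by (simp add: insert_commute)
    finally show ?thesis .
  qed
  have G2: "?G \<in> lin_span S N {?q \<oplus>\<^bsub>N\<^esub> ?r, ?p}"
  proof -
    have "(x \<oplus>\<^bsub>M\<^esub> y) \<oplus>\<^bsub>M\<^esub> e = (y \<oplus>\<^bsub>M\<^esub> e) \<oplus>\<^bsub>M\<^esub> x" using xM e by (simp add: V.M.a_ac)
    then have "(x \<oplus>\<^bsub>M\<^esub> y) \<oplus>\<^bsub>M\<^esub> e \<in> lin_span R M {y \<oplus>\<^bsub>M\<^esub> e, x}"
      using sum_in[of "y \<oplus>\<^bsub>M\<^esub> e" x] xM e by simp
    then have "?G \<in> lin_span S N {g (y \<oplus>\<^bsub>M\<^esub> e), g x}"
      using g_line add_e[OF y(1)] add_e[OF xyH] xM x(2) by blast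
    also have "lin_span S N {g (y \<oplus>\<^bsub>M\<^esub> e), g x} = lin_span S N {?q \<oplus>\<^bsub>N\<^esub> ?r, g x}"
      using W.lin_span_insert_cong[OF _ _ _ span_lift(2)[OF y(1) y0], of "{g x}"] g_closed xM x(2) add_e[OF y(1)] pN ge
      by simp
    also have "\<dots> = lin_span S N {?q \<oplus>\<^bsub>N\<^esub> ?r, ?p}"
      using W.lin_span_insert_cong[OF _ _ _ span_lift(1)[OF x], of "{?q \<oplus>\<^bsub>N\<^esub> ?r}"] g_closed xM x(2) pN ge
      by (simp add: insert_commute)
    finally show ?thesis .
  qed
  obtain a b where ab: "a \<in> carrier S" "b \<in> carrier S" "?G = a \<odot>\<^bsub>N\<^esub> (?p \<oplus>\<^bsub>N\<^esub> ?r) \<oplus>\<^bsub>N\<^esub> b \<odot>\<^bsub>N\<^esub> ?q"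
    using G1 W.lin_span_pair_iff[of "?p \<oplus>\<^bsub>N\<^esub> ?r" ?q] pN ge by auto
  obtain c d where cd: "c \<in> carrier S" "d \<in> carrier S" "?G = c \<odot>\<^bsub>N\<^esub> (?q \<oplus>\<^bsub>N\<^esub> ?r) \<oplus>\<^bsub>N\<^esub> d \<odot>\<^bsub>N\<^esub> ?p"
    using G2 W.lin_span_pair_iff[of "?q \<oplus>\<^bsub>N\<^esub> ?r" ?p] pN ge by auto
  note sm = W.smult_closed[OF _ pN(1)] W.smult_closed[OF _ pN(2)] W.smult_closed[OF _ ge(1)]
  have "(a \<odot>\<^bsub>N\<^esub> ?p \<oplus>\<^bsub>N\<^esub> b \<odot>\<^bsub>N\<^esub> ?q) \<oplus>\<^bsub>N\<^esub> a \<odot>\<^bsub>N\<^esub> ?r = ?G"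
    unfolding ab(3) using ab(1,2) pN ge sm by (simp add: W.smult_r_distr W.M.a_ac)
  moreover have "(d \<odot>\<^bsub>N\<^esub> ?p \<oplus>\<^bsub>N\<^esub> c \<odot>\<^bsub>N\<^esub> ?q) \<oplus>\<^bsub>N\<^esub> c \<odot>\<^bsub>N\<^esub> ?r = ?G"
    unfolding cd(3) using cd(1,2) pN ge sm by (simp add: W.smult_r_distr W.M.a_ac)
  ultimately have eq: "(a \<odot>\<^bsub>N\<^esub> ?p \<oplus>\<^bsub>N\<^esub> b \<odot>\<^bsub>N\<^esub> ?q) \<oplus>\<^bsub>N\<^esub> a \<odot>\<^bsub>N\<^esub> ?r
      = (d \<odot>\<^bsub>N\<^esub> ?p \<oplus>\<^bsub>N\<^esub> c \<odot>\<^bsub>N\<^esub> ?q) \<oplus>\<^bsub>N\<^esub> c \<odot>\<^bsub>N\<^esub> ?r" by simp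
  \<comment> \<open>The first representation of \<open>?G\<close> has equal coefficients at
    \<open>?p\<close> and \<open>?r\<close>, the second at \<open>?q\<close> and \<open>?r\<close>;
    by uniqueness all three are equal.\<close>
  have abeq: "b = a" using cu(2,3)[OF ab(1) cd(2) ab(2) cd(1) ab(1) cd(1) eq] by simp
  have G: "?G = a \<odot>\<^bsub>N\<^esub> ((?p \<oplus>\<^bsub>N\<^esub> ?q) \<oplus>\<^bsub>N\<^esub> ?r)"
    unfolding ab(3) abeq using ab(1) pN ge sm by (simp add: W.smult_r_distr W.M.a_ac)
  have a0: "a \<noteq> \<zero>\<^bsub>S\<^esub>" using G GN pN ge by (auto simp: W.smult_l_null)
  have sumN: "(?p \<oplus>\<^bsub>N\<^esub> ?q) \<oplus>\<^bsub>N\<^esub> ?r \<in> carrier N" using pN ge by simp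
  have w2: "(?p \<oplus>\<^bsub>N\<^esub> ?q) \<oplus>\<^bsub>N\<^esub> ?r \<in> lin_span S N {?G}"
    using W.smult_mem_lin_span_singleton[OF GN(1) W.inv_nonzero(1)[OF ab(1) a0]] W.smult_inv_cancel(1)[OF ab(1) a0 sumN] G by simp
  have D1: "?D \<in> lin_span S N {?p, ?q}"
  proof -
    have "?D \<in> lin_span S N {g x, g y}" using g_line[OF xM(1) x(2) xM(2) y0 sum_in[OF xM] xy0] .
    also have "\<dots> = lin_span S N {?p, g y}"
      using W.lin_span_insert_cong[OF _ _ _ span_lift(1)[OF x], of "{g y}"] g_closed xM x(2) y0 pN by simp
    also have "\<dots> = lin_span S N {?p, ?q}"
      using W.lin_span_insert_cong[OF _ _ _ span_lift(1)[OF y(1) y0], of "{?p}"] g_closed xM x(2) y0 pN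
      by (simp add: insert_commute)
    finally show ?thesis .
  qed
  obtain s t where st: "s \<in> carrier S" "t \<in> carrier S" "?D = s \<odot>\<^bsub>N\<^esub> ?p \<oplus>\<^bsub>N\<^esub> t \<odot>\<^bsub>N\<^esub> ?q"
    using D1 W.lin_span_pair_iff[OF pN] by blast
  have "x \<oplus>\<^bsub>M\<^esub> y \<in> lin_span R M {(x \<oplus>\<^bsub>M\<^esub> y) \<oplus>\<^bsub>M\<^esub> e, e}"
  proof -
    have sub: "{(x \<oplus>\<^bsub>M\<^esub> y) \<oplus>\<^bsub>M\<^esub> e, e} \<subseteq> carrier M" using xM e by auto
    show ?thesis
      using V.subspace_add_cancel_right[OF V.lin_span_subspace[OF sub] V.lin_span_mem[OF sub], of e "x \<oplus>\<^bsub>M\<^esub> y"]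
        V.lin_span_mem[OF sub] xM by auto
  qed
  then have "?D \<in> lin_span S N {?G, ?r}"
    using g_line[OF add_e(1,3)[OF xyH] e] xy0 by simp
  then obtain u v where uv: "u \<in> carrier S" "v \<in> carrier S" "?D = u \<odot>\<^bsub>N\<^esub> ?G \<oplus>\<^bsub>N\<^esub> v \<odot>\<^bsub>N\<^esub> ?r"
    using W.lin_span_pair_iff[OF GN(1) ge(1)] by blast
  define m where "m = u \<otimes>\<^bsub>S\<^esub> a"
  have m: "m \<in> carrier S" using uv ab by (simp add: m_def)
  have "u \<odot>\<^bsub>N\<^esub> ?G = m \<odot>\<^bsub>N\<^esub> ((?p \<oplus>\<^bsub>N\<^esub> ?q) \<oplus>\<^bsub>N\<^esub> ?r)"
    unfolding G m_def using uv(1) ab(1) sumN by (simp add: W.smult_assoc)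
  also have "\<dots> \<oplus>\<^bsub>N\<^esub> v \<odot>\<^bsub>N\<^esub> ?r = (m \<odot>\<^bsub>N\<^esub> ?p \<oplus>\<^bsub>N\<^esub> m \<odot>\<^bsub>N\<^esub> ?q) \<oplus>\<^bsub>N\<^esub> (m \<oplus>\<^bsub>S\<^esub> v) \<odot>\<^bsub>N\<^esub> ?r"
    using m uv(2) pN ge sm by (simp add: W.smult_r_distr W.smult_l_distr W.M.a_ac)
  finally have "?D = (m \<odot>\<^bsub>N\<^esub> ?p \<oplus>\<^bsub>N\<^esub> m \<odot>\<^bsub>N\<^esub> ?q) \<oplus>\<^bsub>N\<^esub> (m \<oplus>\<^bsub>S\<^esub> v) \<odot>\<^bsub>N\<^esub> ?r"
    using uv(3) by simp
  moreover have "?D = (s \<odot>\<^bsub>N\<^esub> ?p \<oplus>\<^bsub>N\<^esub> t \<odot>\<^bsub>N\<^esub> ?q) \<oplus>\<^bsub>N\<^esub> \<zero>\<^bsub>S\<^esub> \<odot>\<^bsub>N\<^esub> ?r"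
    using st ge pN sm by (simp add: W.smult_l_null)
  ultimately have eq2: "(s \<odot>\<^bsub>N\<^esub> ?p \<oplus>\<^bsub>N\<^esub> t \<odot>\<^bsub>N\<^esub> ?q) \<oplus>\<^bsub>N\<^esub> \<zero>\<^bsub>S\<^esub> \<odot>\<^bsub>N\<^esub> ?r
     = (m \<odot>\<^bsub>N\<^esub> ?p \<oplus>\<^bsub>N\<^esub> m \<odot>\<^bsub>N\<^esub> ?q) \<oplus>\<^bsub>N\<^esub> (m \<oplus>\<^bsub>S\<^esub> v) \<odot>\<^bsub>N\<^esub> ?r" by simp
  \<comment> \<open>Comparison of the first two coordinates shows that \<open>?D\<close> has the
    same coefficient at \<open>?p\<close> and at \<open>?q\<close>.\<close>
  have "s = m" "t = m" using cu(1,2)[OF st(1) m st(2) m _ _ eq2] m uv(2) by simp_all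
  then have D: "?D = m \<odot>\<^bsub>N\<^esub> (?p \<oplus>\<^bsub>N\<^esub> ?q)" using st(3) m pN by (simp add: W.smult_r_distr)
  have m0: "m \<noteq> \<zero>\<^bsub>S\<^esub>" using D DN pN by (auto simp: W.smult_l_null)
  have pq: "?p \<oplus>\<^bsub>N\<^esub> ?q \<in> carrier N" using pN by simp
  have w1: "?p \<oplus>\<^bsub>N\<^esub> ?q \<in> lin_span S N {?D}"
    using W.smult_mem_lin_span_singleton[OF DN(1) W.inv_nonzero(1)[OF m m0]] W.smult_inv_cancel(1)[OF m m0 pq] D by simp
  show ?thesis
    using lift_unique[OF xyH xy0 lift_props[OF xyH xy0] w1 w2] .
qed

text \<open>The assumption n \<ge> 3 enters here: the hyperplane has dimension at least two.\<close>

lemma ex_indep: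
  assumes "x \<in> H"
  obtains z where "z \<in> H" "z \<notin> lin_span R M {x}" "z \<noteq> \<zero>\<^bsub>M\<^esub>"
proof -
  have xM: "{x} \<subseteq> carrier M" using H_carrier assms by auto
  have "\<not> H \<subseteq> lin_span R M {x}"
  proof
    assume "H \<subseteq> lin_span R M {x}"
    then have "vdim R M H \<le> vdim R M (lin_span R M {x})"
      using V.vdim_mono[OF H(1) V.lin_span_subspace[OF xM]] by blast
    also have "\<dots> \<le> 1" using V.vdim_lin_span_le[of "{x}"] xM by simp
    finally show False using H(3) n_ge_3 by linarith
  qed
  then show thesis using that zero_in_span[OF xM] by blast
qed

lemma notin_span_sym:
  assumes "x \<in> carrier M" "x \<noteq> \<zero>\<^bsub>M\<^esub>" "y \<in> carrier M" "y \<notin> lin_span R M {x}"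
  shows "x \<notin> lin_span R M {y}"
  using V.lin_span_singleton_eq[of y x] V.lin_span_mem[of "{y}" y] assms by auto

text \<open>If \<open>y\<close> is on the line of \<open>x\<close>, an auxiliary \<open>z\<close> of
  the hyperplane off that line reduces the claim to independent pairs: the lift of x + y + z is
  computed in two ways and lift(z) is cancelled.\<close>

lemma lift_add:
  assumes x: "x \<in> H" and y: "y \<in> H"
  shows "lift (x \<oplus>\<^bsub>M\<^esub> y) = lift x \<oplus>\<^bsub>N\<^esub> lift y"
proof -
  have xM: "x \<in> carrier M" "y \<in> carrier M" using H_carrier x y by auto
  have xyH: "x \<oplus>\<^bsub>M\<^esub> y \<in> H" using V.subspace_add[OF H(1) x y] .
  consider "x = \<zero>\<^bsub>M\<^esub>" | "y = \<zero>\<^bsub>M\<^esub>" | "x \<noteq> \<zero>\<^bsub>M\<^esub>" "y \<noteq> \<zero>\<^bsub>M\<^esub>" "y \<notin> lin_span R M {x}"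
    | "x \<noteq> \<zero>\<^bsub>M\<^esub>" "y \<noteq> \<zero>\<^bsub>M\<^esub>" "y \<in> lin_span R M {x}" by blast
  then show ?thesis
  proof cases
    case 1
    then show ?thesis using lift_closed y xM lift_zero by simp
  next
    case 2
    then show ?thesis using lift_closed x xM lift_zero by simp
  next
    case 3
    then show ?thesis using lift_add_indep x y by blast
  next
    case 4
    obtain z where z: "z \<in> H" "z \<notin> lin_span R M {x}" "z \<noteq> \<zero>\<^bsub>M\<^esub>" using ex_indep[OF x] .
    have zM: "z \<in> carrier M" using H_carrier z by auto
    have sx: "submodule (lin_span R M {x}) R M" using xM by (intro V.lin_span_subspace) simp
    have xx: "x \<in> lin_span R M {x}" using V.lin_span_mem[of "{x}" x] xM by simp
    have zy: "z \<notin> lin_span R M {y}" using V.lin_span_singleton_eq[OF xM(1) 4(3,2)] z by simp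
    have yz: "lift (y \<oplus>\<^bsub>M\<^esub> z) = lift y \<oplus>\<^bsub>N\<^esub> lift z" using lift_add_indep[OF y 4(2) z(1) zy] .
    have yzH: "y \<oplus>\<^bsub>M\<^esub> z \<in> H" using V.subspace_add[OF H(1) y z(1)] .
    have "y \<oplus>\<^bsub>M\<^esub> z \<notin> lin_span R M {x}" using V.subspace_add_cancel_left[OF sx 4(3) zM] z by blast
    then have "lift (x \<oplus>\<^bsub>M\<^esub> (y \<oplus>\<^bsub>M\<^esub> z)) = lift x \<oplus>\<^bsub>N\<^esub> (lift y \<oplus>\<^bsub>N\<^esub> lift z)"
      using lift_add_indep[OF x 4(1) yzH] yz by simp
    moreover have "lift ((x \<oplus>\<^bsub>M\<^esub> y) \<oplus>\<^bsub>M\<^esub> z) = lift (x \<oplus>\<^bsub>M\<^esub> y) \<oplus>\<^bsub>N\<^esub> lift z"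
    proof (cases "x \<oplus>\<^bsub>M\<^esub> y = \<zero>\<^bsub>M\<^esub>")
      case True
      then show ?thesis using lift_zero lift_closed z zM by simp
    next
      case False
      have "x \<oplus>\<^bsub>M\<^esub> y \<in> lin_span R M {x}" using V.subspace_add[OF sx xx 4(3)] .
      then have "lin_span R M {x \<oplus>\<^bsub>M\<^esub> y} = lin_span R M {x}"
        using V.lin_span_singleton_eq[OF xM(1)] False by blast
      then show ?thesis using lift_add_indep[OF xyH False z(1)] z by simp
    qed
    ultimately have "lift (x \<oplus>\<^bsub>M\<^esub> y) \<oplus>\<^bsub>N\<^esub> lift z = (lift x \<oplus>\<^bsub>N\<^esub> lift y) \<oplus>\<^bsub>N\<^esub> lift z"
      using xM zM lift_closed x y z by (simp add: V.M.a_assoc W.M.a_assoc)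
    then show ?thesis using lift_closed x y z xyH by (simp add: W.M.add.right_cancel)
  qed
qed

section \<open>The ring homomorphism attached to the rescaled map\<close>

lemma lift_smult_ex:
  assumes x: "x \<in> H" "x \<noteq> \<zero>\<^bsub>M\<^esub>" and a: "a \<in> carrier R"
  obtains s where "s \<in> carrier S" "lift (a \<odot>\<^bsub>M\<^esub> x) = s \<odot>\<^bsub>N\<^esub> lift x"
proof -
  have xM: "x \<in> carrier M" using H_carrier x by auto
  have ax: "a \<odot>\<^bsub>M\<^esub> x \<in> H" "a \<odot>\<^bsub>M\<^esub> x \<in> lin_span R M {x}"
    using V.subspace_smult[OF H(1) a x(1)] V.smult_mem_lin_span_singleton[OF xM a] by auto
  show thesis
  proof (cases "a \<odot>\<^bsub>M\<^esub> x = \<zero>\<^bsub>M\<^esub>")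
    case True
    then show thesis using that[of "\<zero>\<^bsub>S\<^esub>"] lift_closed[OF x(1)] by (simp add: lift_zero W.smult_l_null)
  next
    case False
    have "g (a \<odot>\<^bsub>M\<^esub> x) \<in> lin_span S N {g x}" using g_point[OF xM x(2) ax(2) False] .
    then have "lin_span S N {g (a \<odot>\<^bsub>M\<^esub> x)} = lin_span S N {lift x}"
      using W.lin_span_singleton_eq[OF g_closed[OF xM x(2)]] g_nonzero[OF H_carrier[OF ax(1)] False]
        span_lift(1)[OF x] by simp
    then have "lift (a \<odot>\<^bsub>M\<^esub> x) \<in> lin_span S N {lift x}" using lift_props(1)[OF ax(1) False] by simp
    then show thesis using that W.lin_span_singleton[OF lift_closed[OF x(1)]] by auto
  qed
qed

text \<open>The scalars s, t, u that belong to \<open>x\<close>, \<open>y\<close> and x + y satisfy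
  s lift(x) + t lift(y) = u lift(x) + u lift(y), and independence gives s = u = t.\<close>

lemma lift_smult_transfer:
  assumes x: "x \<in> H" "x \<noteq> \<zero>\<^bsub>M\<^esub>" and y: "y \<in> H" "y \<notin> lin_span R M {x}" and a: "a \<in> carrier R"
    and s: "s \<in> carrier S" "lift (a \<odot>\<^bsub>M\<^esub> x) = s \<odot>\<^bsub>N\<^esub> lift x"
  shows "lift (a \<odot>\<^bsub>M\<^esub> y) = s \<odot>\<^bsub>N\<^esub> lift y"
proof -
  have xM: "x \<in> carrier M" "y \<in> carrier M" using H_carrier x y by auto
  have y0: "y \<noteq> \<zero>\<^bsub>M\<^esub>" using y zero_in_span[of "{x}"] xM by auto
  have xyH: "x \<oplus>\<^bsub>M\<^esub> y \<in> H" using V.subspace_add[OF H(1) x(1) y(1)] .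
  have sx: "submodule (lin_span R M {x}) R M" using xM by (intro V.lin_span_subspace) simp
  have xx: "x \<in> lin_span R M {x}" using V.lin_span_mem[of "{x}" x] xM by simp
  have xy0: "x \<oplus>\<^bsub>M\<^esub> y \<noteq> \<zero>\<^bsub>M\<^esub>"
    using V.subspace_add_cancel_left[OF sx xx xM(2)] V.subspace_zero[OF sx] y(2) by metis
  obtain t where t: "t \<in> carrier S" "lift (a \<odot>\<^bsub>M\<^esub> y) = t \<odot>\<^bsub>N\<^esub> lift y" using lift_smult_ex[OF y(1) y0 a] .
  obtain u where u: "u \<in> carrier S" "lift (a \<odot>\<^bsub>M\<^esub> (x \<oplus>\<^bsub>M\<^esub> y)) = u \<odot>\<^bsub>N\<^esub> lift (x \<oplus>\<^bsub>M\<^esub> y)"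
    using lift_smult_ex[OF xyH xy0 a] .
  have ax: "a \<odot>\<^bsub>M\<^esub> x \<in> H" "a \<odot>\<^bsub>M\<^esub> y \<in> H" using V.subspace_smult[OF H(1) a] x y by auto
  have "lift (a \<odot>\<^bsub>M\<^esub> (x \<oplus>\<^bsub>M\<^esub> y)) = s \<odot>\<^bsub>N\<^esub> lift x \<oplus>\<^bsub>N\<^esub> t \<odot>\<^bsub>N\<^esub> lift y"
    using lift_add[OF ax] s t a xM by (simp add: V.smult_r_distr)
  moreover have "lift (a \<odot>\<^bsub>M\<^esub> (x \<oplus>\<^bsub>M\<^esub> y)) = u \<odot>\<^bsub>N\<^esub> lift x \<oplus>\<^bsub>N\<^esub> u \<odot>\<^bsub>N\<^esub> lift y"
    using u lift_add[OF x(1) y(1)] lift_closed x y by (simp add: W.smult_r_distr)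
  ultimately have "s \<odot>\<^bsub>N\<^esub> lift x \<oplus>\<^bsub>N\<^esub> t \<odot>\<^bsub>N\<^esub> lift y = u \<odot>\<^bsub>N\<^esub> lift x \<oplus>\<^bsub>N\<^esub> u \<odot>\<^bsub>N\<^esub> lift y" by simp
  from W.coeff_unique2[OF lift_closed[OF x(1)] lift_nonzero[OF x] lift_closed[OF y(1)] lift_indep2[OF x y]
      s(1) u(1) t(1) u(1) this]
  show ?thesis using t by simp
qed

text \<open>The scalar is read off at one vector \<open>z\<close> and carried over to the vectors
  off its line; the vectors on that line are reached through an auxiliary \<open>y\<close>. The laws
  of a ring homomorphism are tested on lift(z), where scalars are determined uniquely.\<close>

lemma ex_ring_hom_lift:
  obtains \<sigma> where "\<sigma> \<in> ring_hom R S" "\<And>a x. a \<in> carrier R \<Longrightarrow> x \<in> H \<Longrightarrow> lift (a \<odot>\<^bsub>M\<^esub> x) = \<sigma> a \<odot>\<^bsub>N\<^esub> lift x"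
proof -
  obtain z where z: "z \<in> H" "z \<noteq> \<zero>\<^bsub>M\<^esub>"
    using ex_indep[OF V.subspace_zero[OF H(1)]] by blast
  define \<sigma> where "\<sigma> a = (SOME s. s \<in> carrier S \<and> lift (a \<odot>\<^bsub>M\<^esub> z) = s \<odot>\<^bsub>N\<^esub> lift z)" for a
  have zM: "z \<in> carrier M" using H_carrier z by auto
  have \<sigma>: "\<sigma> a \<in> carrier S \<and> lift (a \<odot>\<^bsub>M\<^esub> z) = \<sigma> a \<odot>\<^bsub>N\<^esub> lift z" if "a \<in> carrier R" for a
    unfolding \<sigma>_def by (rule someI_ex) (use lift_smult_ex[OF z that] in blast)
  have all: "lift (a \<odot>\<^bsub>M\<^esub> x) = \<sigma> a \<odot>\<^bsub>N\<^esub> lift x" if a: "a \<in> carrier R" and x: "x \<in> H" for a x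
  proof (cases "x = \<zero>\<^bsub>M\<^esub>")
    case True
    then show ?thesis using a \<sigma>[OF a] by (simp add: V.smult_r_null W.smult_r_null lift_zero)
  next
    case x0: False
    show ?thesis
    proof (cases "x \<in> lin_span R M {z}")
      case False
      then show ?thesis using lift_smult_transfer[OF z x False a] \<sigma>[OF a] by blast
    next
      case True
      obtain y where y: "y \<in> H" "y \<notin> lin_span R M {z}" "y \<noteq> \<zero>\<^bsub>M\<^esub>" using ex_indep[OF z(1)] .
      have yM: "y \<in> carrier M" using H_carrier y by auto
      have "lin_span R M {x} = lin_span R M {z}" using V.lin_span_singleton_eq[OF zM True x0] .
      then have "y \<notin> lin_span R M {x}" using y by simp
      then have xy: "x \<notin> lin_span R M {y}" using notin_span_sym[OF H_carrier[OF x] x0 yM] by blast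
      have "lift (a \<odot>\<^bsub>M\<^esub> y) = \<sigma> a \<odot>\<^bsub>N\<^esub> lift y" using lift_smult_transfer[OF z y(1,2) a] \<sigma>[OF a] by blast
      then show ?thesis using lift_smult_transfer[OF y(1,3) x xy a] \<sigma>[OF a] by blast
    qed
  qed
  have uniq: "s = t" if "s \<in> carrier S" "t \<in> carrier S" "s \<odot>\<^bsub>N\<^esub> lift z = t \<odot>\<^bsub>N\<^esub> lift z" for s t
    using W.coeff_unique(1)[OF W.subspace_zero_set lift_closed[OF z(1)] _ _ _ that(1,2)]
      lift_nonzero[OF z] that lift_closed[OF z(1)] W.smult_closed by simp
  have "\<sigma> \<in> ring_hom R S"
  proof (rule ring_hom_memI)
    show "\<sigma> a \<in> carrier S" if "a \<in> carrier R" for a using \<sigma> that by blast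
    show "\<sigma> (a \<otimes>\<^bsub>R\<^esub> b) = \<sigma> a \<otimes>\<^bsub>S\<^esub> \<sigma> b" if ab: "a \<in> carrier R" "b \<in> carrier R" for a b
    proof (rule uniq)
      have "lift ((a \<otimes>\<^bsub>R\<^esub> b) \<odot>\<^bsub>M\<^esub> z) = \<sigma> a \<odot>\<^bsub>N\<^esub> lift (b \<odot>\<^bsub>M\<^esub> z)"
        using all[OF ab(1) V.subspace_smult[OF H(1) ab(2) z(1)]] ab zM by (simp add: V.smult_assoc)
      then show "\<sigma> (a \<otimes>\<^bsub>R\<^esub> b) \<odot>\<^bsub>N\<^esub> lift z = (\<sigma> a \<otimes>\<^bsub>S\<^esub> \<sigma> b) \<odot>\<^bsub>N\<^esub> lift z"
        using \<sigma>[of "a \<otimes>\<^bsub>R\<^esub> b"] \<sigma>[OF ab(1)] \<sigma>[OF ab(2)] ab lift_closed[OF z(1)] by (simp add: W.smult_assoc)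
    qed (use \<sigma> ab in auto)
    show "\<sigma> (a \<oplus>\<^bsub>R\<^esub> b) = \<sigma> a \<oplus>\<^bsub>S\<^esub> \<sigma> b" if ab: "a \<in> carrier R" "b \<in> carrier R" for a b
    proof (rule uniq)
      have "lift ((a \<oplus>\<^bsub>R\<^esub> b) \<odot>\<^bsub>M\<^esub> z) = lift (a \<odot>\<^bsub>M\<^esub> z) \<oplus>\<^bsub>N\<^esub> lift (b \<odot>\<^bsub>M\<^esub> z)"
        using lift_add[OF V.subspace_smult[OF H(1) ab(1) z(1)] V.subspace_smult[OF H(1) ab(2) z(1)]] ab zM
        by (simp add: V.smult_l_distr)
      then show "\<sigma> (a \<oplus>\<^bsub>R\<^esub> b) \<odot>\<^bsub>N\<^esub> lift z = (\<sigma> a \<oplus>\<^bsub>S\<^esub> \<sigma> b) \<odot>\<^bsub>N\<^esub> lift z"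
        using \<sigma>[of "a \<oplus>\<^bsub>R\<^esub> b"] \<sigma>[OF ab(1)] \<sigma>[OF ab(2)] ab lift_closed[OF z(1)] by (simp add: W.smult_l_distr)
    qed (use \<sigma> ab in auto)
    show "\<sigma> \<one>\<^bsub>R\<^esub> = \<one>\<^bsub>S\<^esub>"
      by (rule uniq) (use \<sigma>[of "\<one>\<^bsub>R\<^esub>"] zM lift_closed[OF z(1)] in \<open>simp_all add: V.smult_one W.smult_one\<close>)
  qed
  then show thesis using that all by blast
qed

section \<open>Extension from the hyperplane to the whole space\<close>

lemma decompose:
  assumes "v \<in> carrier M"
  obtains a h where "a \<in> carrier R" "h \<in> H" "v = h \<oplus>\<^bsub>M\<^esub> a \<odot>\<^bsub>M\<^esub> e"
proof -
  have HM: "H \<subseteq> carrier M" using V.subspace_subset[OF H(1)] .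
  have sub: "insert e H \<subseteq> carrier M" using e HM by auto
  have "lin_span R M (insert e H) = carrier M"
    using V.vdim_insert[OF H(1) e(1) H(2)] H(3) V.vdim_carrier V.lin_span_carrier[OF sub]
    by (intro V.vdim_eqD V.lin_span_subspace sub V.subspace_carrier) auto
  then obtain a z where az: "a \<in> carrier R" "z \<in> lin_span R M H" "v = a \<odot>\<^bsub>M\<^esub> e \<oplus>\<^bsub>M\<^esub> z"
    using V.lin_span_insert[OF e(1) HM] assms by blast
  then have zH: "z \<in> H" using V.lin_span_subspace_eq[OF H(1)] by simp
  have "v = z \<oplus>\<^bsub>M\<^esub> a \<odot>\<^bsub>M\<^esub> e" using az zH H_carrier e V.smult_closed V.M.a_comm by simp
  then show thesis using that az zH by blast
qed

lemma decompose_unique: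
  assumes "a \<in> carrier R" "h \<in> H" "a' \<in> carrier R" "h' \<in> H" "h \<oplus>\<^bsub>M\<^esub> a \<odot>\<^bsub>M\<^esub> e = h' \<oplus>\<^bsub>M\<^esub> a' \<odot>\<^bsub>M\<^esub> e"
  shows "a = a'" "h = h'"
  using V.coeff_unique[OF H(1) e(1) H(2) assms(2,4,1,3,5)] by simp_all

text \<open>Every vector is uniquely h + a e with h in \<open>H\<close>, and \<open>l\<close> sends
  it to lift(h) + \<sigma>(a) g(e). For a = 1 and h nonzero, agreement with \<open>g\<close> on
  points is the defining property of \<open>lift\<close>; other nonzero a are reduced to this by
  writing the vector as a times (a^(-1) h + e). The cases a = 0 and h = 0 are separate.\<close>

lemma ex_semilinear_of_hyperplane:
  "\<exists>l. semilinear R M S N l \<and>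
    (\<forall>x\<in>carrier M. x \<noteq> \<zero>\<^bsub>M\<^esub> \<longrightarrow> l x \<noteq> \<zero>\<^bsub>N\<^esub> \<and> lin_span S N {l x} = lin_span S N {g x})"
proof -
  obtain \<sigma> where \<sigma>: "\<sigma> \<in> ring_hom R S"
    and lift_smult: "\<And>a x. a \<in> carrier R \<Longrightarrow> x \<in> H \<Longrightarrow> lift (a \<odot>\<^bsub>M\<^esub> x) = \<sigma> a \<odot>\<^bsub>N\<^esub> lift x"
    using ex_ring_hom_lift by blast
  note \<sigma>c = ring_hom_closed[OF \<sigma>] and \<sigma>a = ring_hom_add[OF \<sigma>] and \<sigma>m = ring_hom_mult[OF \<sigma>]
    and \<sigma>1 = ring_hom_one[OF \<sigma>]
  define l where "l v = (SOME w. \<exists>a h. a \<in> carrier R \<and> h \<in> H \<and> v = h \<oplus>\<^bsub>M\<^esub> a \<odot>\<^bsub>M\<^esub> e \<and>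
    w = lift h \<oplus>\<^bsub>N\<^esub> \<sigma> a \<odot>\<^bsub>N\<^esub> g e)" for v
  have l: "l (h \<oplus>\<^bsub>M\<^esub> a \<odot>\<^bsub>M\<^esub> e) = lift h \<oplus>\<^bsub>N\<^esub> \<sigma> a \<odot>\<^bsub>N\<^esub> g e" if "a \<in> carrier R" "h \<in> H" for a h
    unfolding l_def by (rule some_equality) (use decompose_unique that in blast)+
  have lN: "lift h \<oplus>\<^bsub>N\<^esub> \<sigma> a \<odot>\<^bsub>N\<^esub> g e \<in> carrier N" if "a \<in> carrier R" "h \<in> H" for a h
    using lift_closed[OF that(2)] W.smult_closed[OF \<sigma>c[OF that(1)] ge(1)] by simp
  have \<sigma>0: "\<sigma> \<zero>\<^bsub>R\<^esub> = \<zero>\<^bsub>S\<^esub>" using ring_hom_zero[OF \<sigma> V.R.ring_axioms W.R.ring_axioms] .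
  have "semilinear R M S N l"
    unfolding semilinear_def
  proof (intro conjI ballI bexI[OF _ \<sigma>] funcsetI)
    fix v assume "v \<in> carrier M"
    then obtain a h where ah: "a \<in> carrier R" "h \<in> H" "v = h \<oplus>\<^bsub>M\<^esub> a \<odot>\<^bsub>M\<^esub> e" using decompose by blast
    then show "l v \<in> carrier N" using l lN by simp
  next
    fix v w assume "v \<in> carrier M" "w \<in> carrier M"
    then obtain a h b h' where ah: "a \<in> carrier R" "h \<in> H" "v = h \<oplus>\<^bsub>M\<^esub> a \<odot>\<^bsub>M\<^esub> e"
      and bh: "b \<in> carrier R" "h' \<in> H" "w = h' \<oplus>\<^bsub>M\<^esub> b \<odot>\<^bsub>M\<^esub> e" using decompose by metis
    have hM: "h \<in> carrier M" "h' \<in> carrier M" using ah bh H_carrier by auto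
    have hh: "h \<oplus>\<^bsub>M\<^esub> h' \<in> H" using V.subspace_add[OF H(1)] ah bh by simp
    have "v \<oplus>\<^bsub>M\<^esub> w = (h \<oplus>\<^bsub>M\<^esub> h') \<oplus>\<^bsub>M\<^esub> (a \<oplus>\<^bsub>R\<^esub> b) \<odot>\<^bsub>M\<^esub> e"
      using ah(1,3) bh(1,3) hM e V.smult_closed by (simp add: V.smult_l_distr V.M.a_ac)
    then have "l (v \<oplus>\<^bsub>M\<^esub> w) = lift (h \<oplus>\<^bsub>M\<^esub> h') \<oplus>\<^bsub>N\<^esub> \<sigma> (a \<oplus>\<^bsub>R\<^esub> b) \<odot>\<^bsub>N\<^esub> g e"
      using l[of "a \<oplus>\<^bsub>R\<^esub> b" "h \<oplus>\<^bsub>M\<^esub> h'"] ah bh hh by simp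
    also have "\<dots> = (lift h \<oplus>\<^bsub>N\<^esub> lift h') \<oplus>\<^bsub>N\<^esub> (\<sigma> a \<odot>\<^bsub>N\<^esub> g e \<oplus>\<^bsub>N\<^esub> \<sigma> b \<odot>\<^bsub>N\<^esub> g e)"
      using lift_add[OF ah(2) bh(2)] \<sigma>a[OF ah(1) bh(1)] \<sigma>c ah(1) bh(1) ge by (simp add: W.smult_l_distr)
    also have "\<dots> = (lift h \<oplus>\<^bsub>N\<^esub> \<sigma> a \<odot>\<^bsub>N\<^esub> g e) \<oplus>\<^bsub>N\<^esub> (lift h' \<oplus>\<^bsub>N\<^esub> \<sigma> b \<odot>\<^bsub>N\<^esub> g e)"
      using lift_closed ah bh \<sigma>c ge W.smult_closed by (simp add: W.M.a_ac)
    finally show "l (v \<oplus>\<^bsub>M\<^esub> w) = l v \<oplus>\<^bsub>N\<^esub> l w" using l ah bh by simp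
  next
    fix c v assume c: "c \<in> carrier R" and "v \<in> carrier M"
    then obtain a h where ah: "a \<in> carrier R" "h \<in> H" "v = h \<oplus>\<^bsub>M\<^esub> a \<odot>\<^bsub>M\<^esub> e" using decompose by blast
    have "c \<odot>\<^bsub>M\<^esub> v = c \<odot>\<^bsub>M\<^esub> h \<oplus>\<^bsub>M\<^esub> (c \<otimes>\<^bsub>R\<^esub> a) \<odot>\<^bsub>M\<^esub> e"
      using ah c H_carrier e V.smult_closed by (simp add: V.smult_r_distr V.smult_assoc)
    then have "l (c \<odot>\<^bsub>M\<^esub> v) = lift (c \<odot>\<^bsub>M\<^esub> h) \<oplus>\<^bsub>N\<^esub> \<sigma> (c \<otimes>\<^bsub>R\<^esub> a) \<odot>\<^bsub>N\<^esub> g e"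
      using l[of "c \<otimes>\<^bsub>R\<^esub> a" "c \<odot>\<^bsub>M\<^esub> h"] ah c V.subspace_smult[OF H(1)] by simp
    also have "\<dots> = \<sigma> c \<odot>\<^bsub>N\<^esub> (lift h \<oplus>\<^bsub>N\<^esub> \<sigma> a \<odot>\<^bsub>N\<^esub> g e)"
      using lift_smult[OF c ah(2)] \<sigma>m[OF c ah(1)] \<sigma>c c ah lift_closed ge W.smult_closed
      by (simp add: W.smult_r_distr W.smult_assoc)
    finally show "l (c \<odot>\<^bsub>M\<^esub> v) = \<sigma> c \<odot>\<^bsub>N\<^esub> l v" using l ah by simp
  qed
  moreover have "l v \<noteq> \<zero>\<^bsub>N\<^esub> \<and> lin_span S N {l v} = lin_span S N {g v}" if v: "v \<in> carrier M" "v \<noteq> \<zero>\<^bsub>M\<^esub>" for v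
  proof -
    obtain a h where ah: "a \<in> carrier R" "h \<in> H" "v = h \<oplus>\<^bsub>M\<^esub> a \<odot>\<^bsub>M\<^esub> e" using decompose[OF v(1)] by blast
    have lv: "l v = lift h \<oplus>\<^bsub>N\<^esub> \<sigma> a \<odot>\<^bsub>N\<^esub> g e" using l ah by simp
    \<comment> \<open>A ring homomorphism that preserves one cannot send an invertible element to
      zero.\<close>
    have \<sigma>n: "\<sigma> a \<noteq> \<zero>\<^bsub>S\<^esub>" if "a \<noteq> \<zero>\<^bsub>R\<^esub>"
    proof
      assume "\<sigma> a = \<zero>\<^bsub>S\<^esub>"
      then have "\<sigma> (a \<otimes>\<^bsub>R\<^esub> inv\<^bsub>R\<^esub> a) = \<zero>\<^bsub>S\<^esub>"
        using \<sigma>m[OF ah(1) V.inv_nonzero(1)[OF ah(1) that]] \<sigma>c V.inv_nonzero(1)[OF ah(1) that] by simp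
      then show False using V.inv_nonzero(3)[OF ah(1) that] \<sigma>1 W.one_not_zero by simp
    qed
    have hM: "h \<in> carrier M" using H_carrier ah by auto
    \<comment> \<open>Two nonzero vectors in the span of one \<open>q\<close> span the same line; so
      each case only has to exhibit a suitable \<open>q\<close>.\<close>
    have "\<exists>q\<in>carrier N. l v \<noteq> \<zero>\<^bsub>N\<^esub> \<and> l v \<in> lin_span S N {q} \<and> g v \<in> lin_span S N {q}"
    proof (cases "a = \<zero>\<^bsub>R\<^esub>")
      case True
      then have "v = h" "l v = lift h" using ah lv \<sigma>0 hM e lift_closed ge by (simp_all add: V.smult_l_null W.smult_l_null)
      then show ?thesis
        using lift_nonzero lift_props(1) ah(2) v g_closed W.lin_span_mem[of "{g v}" "g v"]
        by (intro bexI[of _ "g v"]) auto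
    next
      case a0: False
      show ?thesis
      proof (cases "h = \<zero>\<^bsub>M\<^esub>")
        case True
        then have ve: "v = a \<odot>\<^bsub>M\<^esub> e" and lve: "l v = \<sigma> a \<odot>\<^bsub>N\<^esub> g e"
          using ah lv e ge V.smult_closed W.smult_closed \<sigma>c by (simp_all add: lift_zero)
        have "g v \<in> lin_span S N {g e}"
          using g_point[OF e _ v(2)] V.smult_mem_lin_span_singleton[OF e(1) ah(1)] ve by simp
        moreover have "l v \<noteq> \<zero>\<^bsub>N\<^esub>" using W.smult_eq_zeroD[OF \<sigma>c[OF ah(1)] ge(1)] \<sigma>n[OF a0] ge lve by auto
        ultimately show ?thesis
          using W.smult_mem_lin_span_singleton[OF ge(1) \<sigma>c[OF ah(1)]] lve ge by (intro bexI[of _ "g e"]) auto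
      next
        case h0: False
        define h' where "h' = inv\<^bsub>R\<^esub> a \<odot>\<^bsub>M\<^esub> h"
        note i = V.inv_nonzero[OF ah(1) a0]
        have h'H: "h' \<in> H" using V.subspace_smult[OF H(1) i(1) ah(2)] by (simp add: h'_def)
        have ah': "a \<odot>\<^bsub>M\<^esub> h' = h" using V.smult_inv_cancel(2)[OF ah(1) a0 hM] by (simp add: h'_def)
        then have h'0: "h' \<noteq> \<zero>\<^bsub>M\<^esub>" using h0 V.smult_r_null[OF ah(1)] by auto
        have vv: "v = a \<odot>\<^bsub>M\<^esub> (h' \<oplus>\<^bsub>M\<^esub> e)"
          using ah(1,3) ah' H_carrier[OF h'H] e by (simp add: V.smult_r_distr)
        let ?q = "g (h' \<oplus>\<^bsub>M\<^esub> e)"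
        have qN: "?q \<in> carrier N" using g_closed add_e[OF h'H] by simp
        have gv: "g v \<in> lin_span S N {?q}"
          using g_point[OF add_e(1,3)[OF h'H] _ v(2)] V.smult_mem_lin_span_singleton[OF add_e(1)[OF h'H] ah(1)] vv by simp
        have lvv: "l v = \<sigma> a \<odot>\<^bsub>N\<^esub> (lift h' \<oplus>\<^bsub>N\<^esub> g e)"
          using lv lift_smult[OF ah(1) h'H] ah' lift_closed[OF h'H] ge \<sigma>c[OF ah(1)] by (simp add: W.smult_r_distr)
        have sq: "submodule (lin_span S N {?q}) S N" using qN by (intro W.lin_span_subspace) simp
        have "l v \<in> lin_span S N {?q}"
          using W.subspace_smult[OF sq \<sigma>c[OF ah(1)] lift_props(2)[OF h'H h'0]] lvv by simp
        moreover have "l v \<noteq> \<zero>\<^bsub>N\<^esub>"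
          using W.smult_eq_zeroD[OF \<sigma>c[OF ah(1)]] \<sigma>n[OF a0] lift_add_e_nonzero[OF h'H h'0] lvv
            lift_closed[OF h'H] ge by auto
        ultimately show ?thesis using gv qN by blast
      qed
    qed
    then show ?thesis
      using W.lin_span_singleton_eq g_nonzero[OF v] by metis
  qed
  ultimately show ?thesis by blast
qed

end

theorem ex_semilinear:
  "\<exists>l. semilinear R M S N l \<and>
    (\<forall>x\<in>carrier M. x \<noteq> \<zero>\<^bsub>M\<^esub> \<longrightarrow> l x \<noteq> \<zero>\<^bsub>N\<^esub> \<and> lin_span S N {l x} = lin_span S N {g x})"
proof -
  have "vdim R M {\<zero>\<^bsub>M\<^esub>} < n" using V.vdim_zero n_ge_3 by simp
  then obtain e where e: "e \<in> carrier M" "e \<noteq> \<zero>\<^bsub>M\<^esub>"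
    using V.ex_notin_subspace[OF V.subspace_zero_set] by blast
  have "{\<zero>\<^bsub>M\<^esub>} \<subseteq> carrier M" "e \<notin> {\<zero>\<^bsub>M\<^esub>}" using e by auto
  then obtain H where "submodule H R M" "e \<notin> H" "Suc (vdim R M H) = n"
    using V.ex_hyperplane_between[OF V.subspace_zero_set V.subspace_carrier _ e(1)] V.vdim_carrier by metis
  then show ?thesis using ex_semilinear_of_hyperplane[OF e] by blast
qed

end

section \<open>Coordinates for the induced map\<close>

text \<open>\<open>gen T\<close> stands for the preimage of the span of \<open>T\<close> in the first case of the theorem and for the
  annihilator of \<open>T\<close>, with the reversed order of subspaces, in the second.\<close>

locale coordinatized_star_map =
  grassmann_star_map R M n L le meet join rk k K f + W: left_vector_space S N
  for R :: "('a, 'r) ring_scheme" and M :: "('a, 'v, 'm) module_scheme"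
    and n :: nat and L :: "'l set" and le (infix \<open>\<preceq>\<close> 50) and meet (infixl \<open>\<inter>\<^sub>L\<close> 70)
    and join (infixl \<open>\<union>\<^sub>L\<close> 65) and rk and k K and f :: "'v set \<Rightarrow> 'l"
    and S :: "('b, 's) ring_scheme" and N :: "('b, 'w, 'k) module_scheme" +
  fixes gen :: "'w set \<Rightarrow> 'l"
  assumes gen_closed: "T \<subseteq> carrier N \<Longrightarrow> gen T \<in> L"
    and gen_le_iff: "\<lbrakk>T \<subseteq> carrier N; a \<in> L\<rbrakk> \<Longrightarrow> gen T \<preceq> a \<longleftrightarrow> gen {} \<preceq> a \<and> (\<forall>w\<in>T. gen {w} \<preceq> a)"
    and gen_span: "\<lbrakk>finite T; T \<subseteq> carrier N; w \<in> carrier N\<rbrakk> \<Longrightarrow> gen {w} \<preceq> gen T \<longleftrightarrow> w \<in> lin_span S N T"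
    and rk_gen_singleton: "w \<in> carrier N \<Longrightarrow> rk (gen {w}) \<le> rk (gen {}) + 1"
    and gen_empty: "gen {} = induced {\<zero>\<^bsub>M\<^esub>}"
    and gen_point: "\<lbrakk>x \<in> carrier M; x \<noteq> \<zero>\<^bsub>M\<^esub>\<rbrakk> \<Longrightarrow> \<exists>w\<in>carrier N. gen {w} = induced (lin_span R M {x})"
begin

lemma le_imp_eq: "\<lbrakk>a \<in> L; b \<in> L; a \<preceq> b; b \<preceq> a\<rbrakk> \<Longrightarrow> a = b"
  by (rule rk_eqD) (simp_all add: rk_mono antisym)

text \<open>An inclusion of images makes the image of A \<inter> B as large in rank as the image of
  \<open>A\<close>, hence A \<inter> B = A.\<close>

lemma induced_leD:
  assumes A: "submodule A R M" "vdim R M A \<le> k" and B: "submodule B R M" "vdim R M B \<le> k"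
    and le: "induced A \<preceq> induced B"
  shows "A \<subseteq> B"
proof -
  have I: "submodule (A \<inter> B) R M" by (rule subspace_Int[OF A(1) B(1)])
  have dI: "vdim R M (A \<inter> B) \<le> k" using vdim_mono[OF I A(1)] A(2) by auto
  note L = induced_in_L[OF A] induced_in_L[OF B]
  have "induced A \<preceq> induced A \<inter>\<^sub>L induced B" by (rule meet_greatest[OF L L(1) le_refl[OF L(1)] le])
  then have "rk (induced A) \<le> rk (induced (A \<inter> B))"
    using rk_mono[OF L(1) meet_closed[OF L]] induced_Int_eq[OF A B] by simp
  then have "vdim R M A \<le> vdim R M (A \<inter> B)" using rk_induced[OF A] rk_induced[OF I dI] by simp
  then have "A \<inter> B = A" using vdim_eqD[OF I A(1)] by auto
  then show ?thesis by auto
qed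

lemma gen_singleton_le:
  assumes "T \<subseteq> carrier N" "w \<in> T"
  shows "gen {w} \<preceq> gen T"
  using iffD1[OF gen_le_iff[OF assms(1) gen_closed[OF assms(1)]] le_refl[OF gen_closed[OF assms(1)]]] assms(2)
  by blast

lemma gen_empty_le:
  assumes "T \<subseteq> carrier N"
  shows "gen {} \<preceq> gen T"
  using iffD1[OF gen_le_iff[OF assms gen_closed[OF assms]] le_refl[OF gen_closed[OF assms]]] by blast

text \<open>The rank of \<open>gen {t}\<close> exceeds that of \<open>gen {}\<close> by at most one,
  and \<open>gen {}\<close> lies below the meet of \<open>gen {t}\<close> and \<open>gen T\<close>;
  so by modularity one more vector raises the rank by at most one.\<close>

lemma rk_gen_le:
  assumes "finite T" "T \<subseteq> carrier N"
  shows "rk (gen T) \<le> rk (gen {}) + int (card T)"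
  using assms
proof (induction T rule: finite_induct)
  case (insert t T)
  have L: "gen {t} \<in> L" "gen T \<in> L" "gen (insert t T) \<in> L" "gen {} \<in> L" using insert gen_closed by auto
  have jL: "gen {t} \<union>\<^sub>L gen T \<in> L" and mL: "gen {t} \<inter>\<^sub>L gen T \<in> L" using L join_closed meet_closed by auto
  have "gen T \<preceq> gen {t} \<union>\<^sub>L gen T" using join_ge2 L by simp
  moreover have "gen {t} \<preceq> gen {t} \<union>\<^sub>L gen T" using join_ge1 L by simp
  ultimately have "gen (insert t T) \<preceq> gen {t} \<union>\<^sub>L gen T"
    using gen_le_iff[OF _ jL, of T] gen_le_iff[OF _ jL, of "insert t T"] insert.prems by simp
  then have 1: "rk (gen (insert t T)) \<le> rk (gen {t} \<union>\<^sub>L gen T)" using rk_mono[OF L(3) jL] by simp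
  have "gen {} \<preceq> gen {t} \<inter>\<^sub>L gen T" using gen_empty_le insert.prems by (intro meet_greatest L) auto
  then have 2: "rk (gen {}) \<le> rk (gen {t} \<inter>\<^sub>L gen T)" using rk_mono[OF L(4) mL] by simp
  have "rk (gen {t}) \<le> rk (gen {}) + 1" using rk_gen_singleton insert.prems by simp
  then show ?case using 1 2 rk_modular[OF L(1,2)] insert by simp
qed simp

definition coordinate_map :: "('v \<Rightarrow> 'w) \<Rightarrow> bool" where
  "coordinate_map l \<longleftrightarrow> semilinear R M S N l \<and>
    (\<forall>x\<in>carrier M. x \<noteq> \<zero>\<^bsub>M\<^esub> \<longrightarrow> l x \<noteq> \<zero>\<^bsub>N\<^esub> \<and> gen {l x} = induced (lin_span R M {x}))"

text \<open>A vector g(x) that generates the image of the point of \<open>x\<close> is chosen, and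
  \<open>gen_span\<close> translates inclusions of images into membership in spans. Independence of
  three points is tested as non-inclusion of a point in a line, so only subspaces of dimension at
  most two occur, and k \<ge> 2 puts them within reach of \<open>induced\<close>.\<close>

lemma ex_coordinate_map: "\<exists>l. coordinate_map l"
proof -
  define g where "g x = (SOME w. w \<in> carrier N \<and> gen {w} = induced (lin_span R M {x}))" for x
  have g: "g x \<in> carrier N" "gen {g x} = induced (lin_span R M {x})" if "x \<in> carrier M" "x \<noteq> \<zero>\<^bsub>M\<^esub>" for x
  proof -
    have "\<exists>w. w \<in> carrier N \<and> gen {w} = induced (lin_span R M {x})" using gen_point[OF that] by blast
    from someI_ex[OF this] show "g x \<in> carrier N" "gen {g x} = induced (lin_span R M {x})"
      by (simp_all add: g_def)
  qed
  have d1: "vdim R M (lin_span R M {x}) \<le> k" if "x \<in> carrier M" for x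
    using vdim_lin_span_le[of "{x}"] that k_ge_2 by simp
  have d2: "vdim R M (lin_span R M {x, y}) \<le> k" if "x \<in> carrier M" "y \<in> carrier M" for x y
    using vdim_lin_span_le[of "{x, y}"] that k_ge_2 card_insert_le_m1[of 2 "{y}" x] by simp
  have s1: "submodule (lin_span R M {x}) R M" if "x \<in> carrier M" for x
    using that by (intro lin_span_subspace) simp
  have s2: "submodule (lin_span R M {x, y}) R M" if "x \<in> carrier M" "y \<in> carrier M" for x y
    using that by (intro lin_span_subspace) simp
  have mem1: "x \<in> lin_span R M {x}" if "x \<in> carrier M" for x
    using that by (intro lin_span_mem) auto
  have le2: "lin_span R M {x} \<subseteq> lin_span R M {x, y}" "lin_span R M {y} \<subseteq> lin_span R M {x, y}"
    if "x \<in> carrier M" "y \<in> carrier M" for x y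
    using that by (intro lin_span_mono; auto)+
  \<comment> \<open>The image of the span of two vectors is the join of the images of their points,
    and by \<open>gen_le_iff\<close> the left-hand side is the least element above the same
    two.\<close>
  have pair: "gen {g x, g y} = induced (lin_span R M {x, y})"
    if x: "x \<in> carrier M" "x \<noteq> \<zero>\<^bsub>M\<^esub>" and y: "y \<in> carrier M" "y \<noteq> \<zero>\<^bsub>M\<^esub>" for x y
  proof (rule le_imp_eq)
    have "lin_span R M {x, y} = lin_span R M (lin_span R M {x} \<union> lin_span R M {y})"
      using lin_span_Un_eq[of "lin_span R M {x}" "{y}"] lin_span_Un_eq[of "{y}" "{x}"] x y
        subspace_subset[OF s1[OF x(1)]] by (simp add: Un_commute insert_commute)
    then have j: "induced (lin_span R M {x, y}) = gen {g x} \<union>\<^sub>L gen {g y}"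
      using induced_Un_eq[OF s1[OF x(1)] s1[OF y(1)]] d2[OF x(1) y(1)] g x y by simp
    have sub: "{g x, g y} \<subseteq> carrier N" using g x y by simp
    show G: "gen {g x, g y} \<in> L" using gen_closed[OF sub] .
    show I: "induced (lin_span R M {x, y}) \<in> L" using induced_in_L s2 d2 x y by simp
    show "induced (lin_span R M {x, y}) \<preceq> gen {g x, g y}"
      unfolding j using gen_closed[of "{g x}"] gen_closed[of "{g y}"] g x y
      by (intro join_least G gen_singleton_le sub) auto
    have "induced {\<zero>\<^bsub>M\<^esub>} \<preceq> induced (lin_span R M {x, y})"
      using induced_le[OF subspace_zero_set s2[OF x(1) y(1)] _ d2[OF x(1) y(1)]] subspace_zero[OF s2[OF x(1) y(1)]] by simp
    then show "gen {g x, g y} \<preceq> induced (lin_span R M {x, y})"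
      using gen_le_iff[OF sub I] gen_empty g x y
        induced_le[OF s1[OF x(1)] s2[OF x(1) y(1)] le2(1)[OF x(1) y(1)] d2[OF x(1) y(1)]]
        induced_le[OF s1[OF y(1)] s2[OF x(1) y(1)] le2(2)[OF x(1) y(1)] d2[OF x(1) y(1)]] by simp
  qed
  have "projective_map R M n S N g"
  proof (intro projective_map.intro fin_vector_space_axioms W.left_vector_space_axioms projective_map_axioms.intro)
    show "3 \<le> n" using k_ge_2 k_le by linarith
    show "g x \<in> carrier N" if "x \<in> carrier M" "x \<noteq> \<zero>\<^bsub>M\<^esub>" for x using g that by blast
    show "g x \<noteq> \<zero>\<^bsub>N\<^esub>" if x: "x \<in> carrier M" "x \<noteq> \<zero>\<^bsub>M\<^esub>" for x
    proof
      assume "g x = \<zero>\<^bsub>N\<^esub>"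
      then have "gen {g x} \<preceq> gen {}" using gen_span[of "{}" "g x"] by (simp add: W.lin_span_empty)
      then have "induced (lin_span R M {x}) \<preceq> induced {\<zero>\<^bsub>M\<^esub>}" using g x gen_empty by simp
      then have "lin_span R M {x} \<subseteq> {\<zero>\<^bsub>M\<^esub>}"
        using induced_leD[OF s1 d1 subspace_zero_set] x vdim_zero by simp
      then show False using mem1 x by blast
    qed
    show "g z \<in> lin_span S N {g x, g y}"
      if x: "x \<in> carrier M" "x \<noteq> \<zero>\<^bsub>M\<^esub>" and y: "y \<in> carrier M" "y \<noteq> \<zero>\<^bsub>M\<^esub>"
        and z: "z \<in> lin_span R M {x, y}" "z \<noteq> \<zero>\<^bsub>M\<^esub>" for x y z
    proof -
      have zM: "z \<in> carrier M" using lin_span_memD[OF _ z(1)] x y by simp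
      have "lin_span R M {z} \<subseteq> lin_span R M {x, y}"
        using z s2[OF x(1) y(1)] by (intro lin_span_subset) simp_all
      then have "gen {g z} \<preceq> gen {g x, g y}"
        using induced_le[OF s1[OF zM] s2[OF x(1) y(1)] _ d2[OF x(1) y(1)]] pair[OF x y] g(2)[OF zM z(2)] by simp
      then show ?thesis using gen_span[of "{g x, g y}" "g z"] g(1) x y zM z by simp
    qed
    show "g y \<notin> lin_span S N {g x}"
      if x: "x \<in> carrier M" "x \<noteq> \<zero>\<^bsub>M\<^esub>" and y: "y \<in> carrier M" "y \<notin> lin_span R M {x}" for x y
    proof
      assume a: "g y \<in> lin_span S N {g x}"
      have y0: "y \<noteq> \<zero>\<^bsub>M\<^esub>" using y subspace_zero[OF s1[OF x(1)]] by auto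
      have "gen {g y} \<preceq> gen {g x}" using a gen_span[of "{g x}" "g y"] g(1) x y y0 by simp
      then have "lin_span R M {y} \<subseteq> lin_span R M {x}"
        using induced_leD[OF s1[OF y(1)] d1[OF y(1)] s1[OF x(1)] d1[OF x(1)]] g(2) x y y0 by simp
      then show False using mem1[OF y(1)] y by blast
    qed
    show "g z \<notin> lin_span S N {g x, g y}"
      if x: "x \<in> carrier M" "x \<noteq> \<zero>\<^bsub>M\<^esub>" and y: "y \<in> carrier M" "y \<notin> lin_span R M {x}"
        and z: "z \<in> carrier M" "z \<notin> lin_span R M {x, y}" for x y z
    proof
      assume a: "g z \<in> lin_span S N {g x, g y}"
      have y0: "y \<noteq> \<zero>\<^bsub>M\<^esub>" using y subspace_zero[OF s1[OF x(1)]] by auto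
      have z0: "z \<noteq> \<zero>\<^bsub>M\<^esub>" using z subspace_zero[OF s2[OF x(1) y(1)]] by auto
      have "gen {g z} \<preceq> gen {g x, g y}" using a gen_span[of "{g x, g y}" "g z"] g(1) x y y0 z z0 by simp
      then have "lin_span R M {z} \<subseteq> lin_span R M {x, y}"
        using induced_leD[OF s1[OF z(1)] d1[OF z(1)] s2[OF x(1) y(1)] d2[OF x(1) y(1)]]
          g(2)[OF z(1) z0] pair[OF x y(1) y0] by simp
      then show False using mem1[OF z(1)] z by blast
    qed
  qed
  then obtain l where l: "semilinear R M S N l"
    and lg: "\<And>x. x \<in> carrier M \<Longrightarrow> x \<noteq> \<zero>\<^bsub>M\<^esub> \<Longrightarrow> l x \<noteq> \<zero>\<^bsub>N\<^esub> \<and> lin_span S N {l x} = lin_span S N {g x}"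
    using projective_map.ex_semilinear by blast
  have "gen {l x} = induced (lin_span R M {x})" if x: "x \<in> carrier M" "x \<noteq> \<zero>\<^bsub>M\<^esub>" for x
  proof -
    have lN: "l x \<in> carrier N" using l x unfolding semilinear_def by blast
    have "l x \<in> lin_span S N {g x}" "g x \<in> lin_span S N {l x}"
      using lg[OF x] W.lin_span_mem[of "{l x}" "l x"] W.lin_span_mem[of "{g x}" "g x"] lN g(1)[OF x] by auto
    then have "gen {l x} \<preceq> gen {g x}" "gen {g x} \<preceq> gen {l x}"
      using gen_span[of "{g x}" "l x"] gen_span[of "{l x}" "g x"] lN g(1)[OF x] by auto
    then have "gen {l x} = gen {g x}" using gen_closed lN g(1)[OF x] by (intro le_imp_eq) auto
    then show ?thesis using g(2)[OF x] by simp
  qed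
  then show ?thesis using l lg unfolding coordinate_map_def by blast
qed

section \<open>Consequences for a coordinate map\<close>

context
  fixes l assumes cm: "coordinate_map l"
begin

lemma coordinate_closed: "x \<in> carrier M \<Longrightarrow> l x \<in> carrier N"
  using cm by (simp add: coordinate_map_def semilinear_def Pi_iff)

lemma coordinate_add: "x \<in> carrier M \<Longrightarrow> y \<in> carrier M \<Longrightarrow> l (x \<oplus>\<^bsub>M\<^esub> y) = l x \<oplus>\<^bsub>N\<^esub> l y"
  using cm by (simp add: coordinate_map_def semilinear_def)

lemma coordinate_zero: "l \<zero>\<^bsub>M\<^esub> = \<zero>\<^bsub>N\<^esub>"
  using coordinate_add[of "\<zero>\<^bsub>M\<^esub>" "\<zero>\<^bsub>M\<^esub>"] coordinate_closed[of "\<zero>\<^bsub>M\<^esub>"] by (simp add: W.M.add.r_cancel_one')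

lemma gen_coordinate:
  assumes "x \<in> carrier M"
  shows "gen {l x} = induced (lin_span R M {x})"
proof (cases "x = \<zero>\<^bsub>M\<^esub>")
  case True
  have "gen {\<zero>\<^bsub>N\<^esub>} = gen {}"
    using gen_span[of "{}" "\<zero>\<^bsub>N\<^esub>"] gen_empty_le[of "{\<zero>\<^bsub>N\<^esub>}"] gen_closed
    by (intro le_imp_eq) (auto simp: W.lin_span_empty)
  moreover have "lin_span R M {x} = {\<zero>\<^bsub>M\<^esub>}" using True lin_span_subspace_eq[OF subspace_zero_set] by simp
  ultimately show ?thesis using gen_empty True coordinate_zero by simp
next
  case False
  then show ?thesis using cm assms unfolding coordinate_map_def by blast
qed

lemma inj_on_coordinate: "inj_on l (carrier M)"
proof (rule inj_onI)
  fix x y assume xy: "x \<in> carrier M" "y \<in> carrier M" "l x = l y"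
  have xy': "(x \<ominus>\<^bsub>M\<^esub> y) \<oplus>\<^bsub>M\<^esub> y = x" using xy by (simp add: M.minus_eq M.a_assoc M.l_neg)
  then have "l x = l ((x \<ominus>\<^bsub>M\<^esub> y) \<oplus>\<^bsub>M\<^esub> y)" by simp
  also have "\<dots> = l (x \<ominus>\<^bsub>M\<^esub> y) \<oplus>\<^bsub>N\<^esub> l y" using xy by (intro coordinate_add) auto
  finally have "l (x \<ominus>\<^bsub>M\<^esub> y) \<oplus>\<^bsub>N\<^esub> l y = \<zero>\<^bsub>N\<^esub> \<oplus>\<^bsub>N\<^esub> l y" using xy coordinate_closed by simp
  then have "l (x \<ominus>\<^bsub>M\<^esub> y) = \<zero>\<^bsub>N\<^esub>" using xy coordinate_closed by (simp add: W.M.add.right_cancel)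
  then have "x \<ominus>\<^bsub>M\<^esub> y = \<zero>\<^bsub>M\<^esub>" using cm xy unfolding coordinate_map_def by blast
  then show "x = y" using xy xy' by simp
qed

text \<open>\<open>induced\<close> carries sums of dimension at most \<open>k\<close> to joins, so
  an upper bound can be checked on the points of a spanning set.\<close>

lemma induced_span_le:
  assumes "finite T" "T \<subseteq> carrier M" "vdim R M (lin_span R M T) \<le> k" "c \<in> L" "gen {} \<preceq> c"
    and "\<And>t. t \<in> T \<Longrightarrow> gen {l t} \<preceq> c"
  shows "induced (lin_span R M T) \<preceq> c"
  using assms(1-3,6)
proof (induction T rule: finite_induct)
  case empty
  then show ?case using assms(5) gen_empty by (simp add: lin_span_empty)
next
  case (insert t T)
  have tM: "t \<in> carrier M" and TM: "T \<subseteq> carrier M" using insert by auto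
  have st: "submodule (lin_span R M {t}) R M" and sT: "submodule (lin_span R M T) R M"
    and s: "submodule (lin_span R M (insert t T)) R M" using tM TM by (auto intro!: lin_span_subspace)
  have "lin_span R M T \<subseteq> lin_span R M (insert t T)" "lin_span R M {t} \<subseteq> lin_span R M (insert t T)"
    using lin_span_mono[OF _ insert.prems(1), of T] lin_span_mono[OF _ insert.prems(1), of "{t}"] by auto
  then have dT: "vdim R M (lin_span R M T) \<le> k" and dt: "vdim R M (lin_span R M {t}) \<le> k"
    using vdim_mono[OF sT s] vdim_mono[OF st s] insert.prems(2) by auto
  have eq: "lin_span R M (lin_span R M {t} \<union> lin_span R M T) = lin_span R M (insert t T)"
    using lin_span_Un_eq[of "lin_span R M {t}" T] lin_span_Un_eq[of T "{t}"] tM TM subspace_subset[OF st]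
    by (simp add: Un_commute)
  have "induced (lin_span R M T) \<preceq> c" using insert.IH[OF TM dT] insert.prems(3) by simp
  moreover have "induced (lin_span R M {t}) \<preceq> c" using insert.prems(3)[of t] gen_coordinate[OF tM] by simp
  ultimately have "induced (lin_span R M {t}) \<union>\<^sub>L induced (lin_span R M T) \<preceq> c"
    using induced_in_L[OF st dt] induced_in_L[OF sT dT] assms(4) by (intro join_least) auto
  then show ?case using induced_Un_eq[OF st sT] eq insert.prems(2) by simp
qed

lemma image_subset: "T \<subseteq> carrier M \<Longrightarrow> l ` T \<subseteq> carrier N"
  using coordinate_closed by auto

text \<open>One inequality is tested on a basis of \<open>X\<close> by
  \<open>induced_span_le\<close>, the other on every vector of \<open>X\<close> by
  \<open>gen_le_iff\<close>.\<close>

lemma f_eq_gen: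
  assumes X: "X \<in> kspaces"
  shows "f X = gen (l ` X)"
proof (rule le_imp_eq)
  note x = kspacesD[OF X]
  have XM: "X \<subseteq> carrier M" using subspace_subset[OF x(1)] .
  have fX: "f X = induced X" using induced_kspace_eq[OF X] by simp
  show "f X \<in> L" by (rule x(3))
  show G: "gen (l ` X) \<in> L" using gen_closed image_subset[OF XM] by simp
  obtain B where B: "lin_span R M B = X" "finite B" "B \<subseteq> X" using obtain_basis[OF x(1)] by metis
  have "gen {l t} \<preceq> gen (l ` X)" if "t \<in> B" for t
    using gen_singleton_le[OF image_subset[OF XM]] that B by blast
  then have "induced (lin_span R M B) \<preceq> gen (l ` X)"
    using B XM x gen_empty_le[OF image_subset[OF XM]] by (intro induced_span_le G) auto
  then show "f X \<preceq> gen (l ` X)" using fX B by simp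
  have "gen {} \<preceq> f X"
    unfolding fX gen_empty using subspace_zero[OF x(1)] x by (intro induced_le subspace_zero_set) auto
  moreover have "gen {l y} \<preceq> f X" if y: "y \<in> X" for y
  proof -
    have yM: "y \<in> carrier M" using y XM by auto
    have "lin_span R M {y} \<subseteq> X" using y by (intro lin_span_subset x(1)) simp
    then show ?thesis
      unfolding fX gen_coordinate[OF yM] using x yM by (intro induced_le lin_span_subspace) auto
  qed
  ultimately show "gen (l ` X) \<preceq> f X" using gen_le_iff[OF image_subset[OF XM] x(3)] by blast
qed

text \<open>The set is cut into two halves that span vertices with zero intersection; the join of
  their images has rank K + k and lies below \<open>c\<close>.\<close>

lemma rk_ge_of_indep:
  assumes A: "lin_indep R M A" "finite A" "card A = 2 * k" and c: "c \<in> L" "gen {} \<preceq> c"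
    and le: "\<And>a. a \<in> A \<Longrightarrow> gen {l a} \<preceq> c"
  shows "K + int k \<le> rk c"
proof -
  obtain A1 where A1: "A1 \<subseteq> A" "card A1 = k" using obtain_subset_with_card_n[of k A] A by auto
  define A2 where "A2 = A - A1"
  have A2: "A2 \<subseteq> A" "card A2 = k" "finite A2" "finite A1" "A = A1 \<union> A2"
    using A1 A finite_subset[OF A1(1)] by (auto simp: A2_def card_Diff_subset)
  have AM: "A1 \<subseteq> carrier M" "A2 \<subseteq> carrier M" using lin_indep_carrier[OF A(1)] A1 A2 by auto
  let ?X = "lin_span R M A1" and ?Y = "lin_span R M A2"
  have s: "submodule ?X R M" "submodule ?Y R M" using AM lin_span_subspace by auto
  have dX: "vdim R M ?X = k" using vdim_lin_span[OF lin_indep_subset[OF A(1) A1(1)]] A1 A2 by simp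
  have dY: "vdim R M ?Y = k" using vdim_lin_span[OF lin_indep_subset[OF A(1) A2(1)]] A2 by simp
  have "lin_span R M (?X \<union> ?Y) = lin_span R M A"
    using lin_span_Un_eq[of ?X A2] lin_span_Un_eq[of A2 A1] AM subspace_subset[OF s(1)] A2(5) by (simp add: Un_commute)
  then have dI: "vdim R M (?X \<inter> ?Y) = 0" using vdim_Un_Int[OF s] vdim_lin_span[OF A(1,2)] dX dY A(3) by simp
  have V: "?X \<in> kspaces" "?Y \<in> kspaces" using s dX dY by (auto simp: kspaces_def)
  have "induced ?X \<preceq> c"
    by (rule induced_span_le[OF A2(4) AM(1) eq_imp_le[OF dX] c]) (use le A1 in blast)
  moreover have "induced ?Y \<preceq> c"
    by (rule induced_span_le[OF A2(3) AM(2) eq_imp_le[OF dY] c]) (use le A2 in blast)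
  ultimately have "f ?X \<preceq> c" "f ?Y \<preceq> c" using induced_kspace_eq V by auto
  then have "f ?X \<union>\<^sub>L f ?Y \<preceq> c" using kspacesD(3) V c by (intro join_least) auto
  then have "rk (f ?X \<union>\<^sub>L f ?Y) \<le> rk c" using kspacesD(3) V c join_closed by (intro rk_mono) auto
  then show ?thesis using rk_f_join[OF s(1) dX s(2) dY] dI by simp
qed

text \<open>If \<open>b\<close> were redundant, the remaining vectors, at most 2k - 1 in number,
  would generate an element of rank at most (K - k) + (2k - 1), below the rank K + k guaranteed by
  \<open>rk_ge_of_indep\<close>.\<close>

lemma m_embedding: "semilinear_m_embedding (2 * k) R M S N l"
  unfolding semilinear_m_embedding_def
proof (intro conjI allI impI)
  show "semilinear R M S N l" using cm unfolding coordinate_map_def by blast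
  show "inj_on l (carrier M)" by (rule inj_on_coordinate)
  fix A assume A: "lin_indep R M A \<and> finite A \<and> card A = 2 * k"
  have AM: "A \<subseteq> carrier M" using lin_indep_carrier A by blast
  show "lin_indep S N (l ` A)"
    unfolding W.lin_indep_iff
  proof (intro conjI ballI notI)
    show "l ` A \<subseteq> carrier N" using image_subset[OF AM] .
    fix b assume b: "b \<in> l ` A" "b \<in> lin_span S N (l ` A - {b})"
    let ?T = "l ` A - {b}"
    have T: "finite ?T" "?T \<subseteq> carrier N" using A image_subset[OF AM] by auto
    have "gen {l a} \<preceq> gen ?T" if "a \<in> A" for a
    proof -
      have "l a \<in> lin_span S N ?T" using that b W.lin_span_mem[OF T(2)] by (cases "l a = b") auto
      then show ?thesis using gen_span[OF T] that AM coordinate_closed by blast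
    qed
    then have "K + int k \<le> rk (gen ?T)"
      using A T gen_closed gen_empty_le by (intro rk_ge_of_indep) auto
    also have "\<dots> \<le> rk (gen {}) + int (card ?T)" by (rule rk_gen_le[OF T])
    also have "rk (gen {}) = K - int k"
      using rk_induced[OF subspace_zero_set] vdim_zero gen_empty by simp
    also have "card ?T < card (l ` A)" using A b by (intro psubset_card_mono) auto
    moreover have "card (l ` A) \<le> 2 * k" using A card_image_le[of A l] by simp
    ultimately show False by linarith
  qed
qed

text \<open>The bound is generated by the image of a basis: its rank is at least K + k by
  \<open>rk_ge_of_indep\<close> and at most (K - k) + 2k. In the reversed order the same element is
  a subspace contained in all images.\<close>

lemma ex_upper_bound:
  assumes n: "n = 2 * k"
  shows "\<exists>u\<in>L. rk u = K + int k \<and> (\<forall>X\<in>kspaces. f X \<preceq> u)"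
proof -
  obtain B where B: "lin_indep R M B" "lin_span R M B = carrier M" "finite B" "card B = n"
    using has_dim unfolding has_dim_def by blast
  have BM: "B \<subseteq> carrier M" using lin_indep_carrier[OF B(1)] .
  let ?T = "l ` B"
  have T: "finite ?T" "?T \<subseteq> carrier N" using B image_subset[OF BM] by auto
  have u: "gen ?T \<in> L" using gen_closed[OF T(2)] .
  have sT: "submodule (lin_span S N ?T) S N" by (rule W.lin_span_subspace[OF T(2)])
  obtain \<sigma> where \<sigma>: "\<sigma> \<in> ring_hom R S" "\<And>a x. a \<in> carrier R \<Longrightarrow> x \<in> carrier M \<Longrightarrow> l (a \<odot>\<^bsub>M\<^esub> x) = \<sigma> a \<odot>\<^bsub>N\<^esub> l x"
    using cm unfolding coordinate_map_def semilinear_def by blast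
  \<comment> \<open>The vectors sent into the span of \<open>?T\<close> form a subspace of the
    source that contains a basis, so they are all vectors.\<close>
  have "submodule {x \<in> carrier M. l x \<in> lin_span S N ?T} R M"
    using coordinate_add \<sigma> coordinate_zero W.subspace_zero[OF sT] W.subspace_add[OF sT] W.subspace_smult[OF sT] smult_closed
      ring_hom_closed[OF \<sigma>(1)]
    by (intro subspaceI) auto
  moreover have "B \<subseteq> {x \<in> carrier M. l x \<in> lin_span S N ?T}" using BM W.lin_span_mem[OF T(2)] by auto
  ultimately have span: "l x \<in> lin_span S N ?T" if "x \<in> carrier M" for x
    using lin_span_subset B(2) that by blast
  have gl: "gen {l x} \<preceq> gen ?T" if "x \<in> carrier M" for x
    using gen_span[OF T] span coordinate_closed that by blast
  have "f X \<preceq> gen ?T" if X: "X \<in> kspaces" for X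
  proof -
    have XM: "X \<subseteq> carrier M" using subspace_subset[OF kspacesD(1)[OF X]] .
    show ?thesis unfolding f_eq_gen[OF X] gen_le_iff[OF image_subset[OF XM] u]
      using gen_empty_le[OF T(2)] gl XM by auto
  qed
  moreover have "K + int k \<le> rk (gen ?T)"
    using B n u gen_empty_le[OF T(2)] gl BM by (intro rk_ge_of_indep[of B]) auto
  moreover have "rk (gen ?T) \<le> K - int k + int (card ?T)"
    using rk_gen_le[OF T] rk_induced[OF subspace_zero_set] vdim_zero gen_empty by simp
  moreover have "card ?T \<le> 2 * k" using B n card_image_le[of B l] by simp
  ultimately show ?thesis using u by (intro bexI[of _ "gen ?T"]) auto
qed

end

end

section \<open>The rank lattice of subspaces\<close>

context fin_vector_space
begin

lemma subspace_rank_lattice: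
  "rank_lattice {X. submodule X R M} (\<subseteq>) (\<inter>) (\<lambda>X Y. lin_span R M (X \<union> Y)) (\<lambda>X. int (vdim R M X))"
proof (unfold_locales, goal_cases)
  case (3 a b)
  then show ?case using subspace_Int by simp
next
  case (4 a b)
  then show ?case using lin_span_subspace[of "a \<union> b"] subspace_subset by simp
next
  case (8 a b)
  then show ?case using lin_span_superset[of "a \<union> b"] subspace_subset by simp
next
  case (9 a b)
  then show ?case using lin_span_superset[of "a \<union> b"] subspace_subset by simp
next
  case (10 a b c)
  then show ?case using lin_span_subset by simp
next
  case (11 a b)
  then show ?case using vdim_mono by simp
next
  case (12 a b)
  then show ?case using vdim_eqD by simp
next
  case (13 a b)
  then show ?case using vdim_Un_Int[of a b] by simp
qed auto

end


section \<open>Dual spaces\<close>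

context left_vector_space
begin

lemma opposite_ring_simps:
  "carrier (opposite_ring R) = carrier R" "\<zero>\<^bsub>opposite_ring R\<^esub> = \<zero>" "\<one>\<^bsub>opposite_ring R\<^esub> = \<one>"
  "a \<oplus>\<^bsub>opposite_ring R\<^esub> b = a \<oplus>\<^bsub>R\<^esub> b" "a \<otimes>\<^bsub>opposite_ring R\<^esub> b = b \<otimes> a"
  by (simp_all add: opposite_ring_def)

text \<open>Being a unit is a two-sided condition, so reversing the product keeps the same
  units.\<close>

lemma opposite_skew_field: "skew_field (opposite_ring R)"
proof -
  have ag: "abelian_group (opposite_ring R)"
    by (rule abelian_groupI)
      (auto simp: opposite_ring_simps R.a_ac intro: R.l_neg bexI[of _ "\<ominus> _"])
  have mon: "monoid (opposite_ring R)"
    by (rule monoidI) (auto simp: opposite_ring_simps R.m_assoc)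
  have "ring (opposite_ring R)"
    by (rule ringI[OF ag mon]) (auto simp: opposite_ring_simps R.l_distr R.r_distr)
  moreover have "Units (opposite_ring R) = Units R"
    by (auto simp: Units_def opposite_ring_simps)
  ultimately show ?thesis
    using one_not_zero skew_field_Units
    by (simp add: skew_field_def skew_field_axioms_def opposite_ring_simps)
qed

lemma dual_carrierI:
  assumes "\<phi> \<in> extensional (carrier M)" "\<And>x. x \<in> carrier M \<Longrightarrow> \<phi> x \<in> carrier R"
    and "\<And>x y. x \<in> carrier M \<Longrightarrow> y \<in> carrier M \<Longrightarrow> \<phi> (x \<oplus>\<^bsub>M\<^esub> y) = \<phi> x \<oplus>\<^bsub>R\<^esub> \<phi> y"
    and "\<And>a x. a \<in> carrier R \<Longrightarrow> x \<in> carrier M \<Longrightarrow> \<phi> (a \<odot>\<^bsub>M\<^esub> x) = a \<otimes> \<phi> x"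
  shows "\<phi> \<in> carrier (dual_space R M)"
  using assms by (auto simp: dual_space_def PiE_def)

lemma dual_carrierD:
  assumes "\<phi> \<in> carrier (dual_space R M)"
  shows "\<phi> \<in> extensional (carrier M)" "\<And>x. x \<in> carrier M \<Longrightarrow> \<phi> x \<in> carrier R"
    and "\<And>x y. x \<in> carrier M \<Longrightarrow> y \<in> carrier M \<Longrightarrow> \<phi> (x \<oplus>\<^bsub>M\<^esub> y) = \<phi> x \<oplus>\<^bsub>R\<^esub> \<phi> y"
    and "\<And>a x. a \<in> carrier R \<Longrightarrow> x \<in> carrier M \<Longrightarrow> \<phi> (a \<odot>\<^bsub>M\<^esub> x) = a \<otimes> \<phi> x"
  using assms by (auto simp: dual_space_def PiE_def)

lemma dual_ops:
  "\<zero>\<^bsub>dual_space R M\<^esub> = (\<lambda>x\<in>carrier M. \<zero>)"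
  "\<phi> \<oplus>\<^bsub>dual_space R M\<^esub> \<psi> = (\<lambda>x\<in>carrier M. \<phi> x \<oplus>\<^bsub>R\<^esub> \<psi> x)"
  "a \<odot>\<^bsub>dual_space R M\<^esub> \<phi> = (\<lambda>x\<in>carrier M. \<phi> x \<otimes> a)"
  by (simp_all add: dual_space_def)

lemma dual_eqI:
  assumes "\<phi> \<in> carrier (dual_space R M)" "\<psi> \<in> carrier (dual_space R M)"
    and "\<And>x. x \<in> carrier M \<Longrightarrow> \<phi> x = \<psi> x"
  shows "\<phi> = \<psi>"
  using extensionalityI[OF dual_carrierD(1)[OF assms(1)] dual_carrierD(1)[OF assms(2)]] assms(3) by blast

lemma dual_closed:
  shows "\<zero>\<^bsub>dual_space R M\<^esub> \<in> carrier (dual_space R M)"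
    and "\<lbrakk>\<phi> \<in> carrier (dual_space R M); \<psi> \<in> carrier (dual_space R M)\<rbrakk> \<Longrightarrow>
      \<phi> \<oplus>\<^bsub>dual_space R M\<^esub> \<psi> \<in> carrier (dual_space R M)"
    and "\<lbrakk>a \<in> carrier R; \<phi> \<in> carrier (dual_space R M)\<rbrakk> \<Longrightarrow>
      a \<odot>\<^bsub>dual_space R M\<^esub> \<phi> \<in> carrier (dual_space R M)"
proof -
  show "\<zero>\<^bsub>dual_space R M\<^esub> \<in> carrier (dual_space R M)"
    by (rule dual_carrierI) (simp_all add: dual_ops smult_closed)
next
  assume "\<phi> \<in> carrier (dual_space R M)" "\<psi> \<in> carrier (dual_space R M)"
  note p = dual_carrierD[OF this(1)] and q = dual_carrierD[OF this(2)]
  show "\<phi> \<oplus>\<^bsub>dual_space R M\<^esub> \<psi> \<in> carrier (dual_space R M)"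
    by (rule dual_carrierI) (simp_all add: dual_ops smult_closed p(2-4) q(2-4) R.r_distr R.a_ac)
next
  assume a: "a \<in> carrier R" and "\<phi> \<in> carrier (dual_space R M)"
  note p = dual_carrierD[OF this(2)]
  show "a \<odot>\<^bsub>dual_space R M\<^esub> \<phi> \<in> carrier (dual_space R M)"
    by (rule dual_carrierI) (simp_all add: dual_ops smult_closed p(2-4) a R.l_distr R.m_assoc)
qed

lemma dual_left_vector_space: "left_vector_space (opposite_ring R) (dual_space R M)"
proof -
  note c = dual_closed and d = dual_carrierD
  have ag: "abelian_group (dual_space R M)"
  proof (rule abelian_groupI)
    fix \<phi> assume p: "\<phi> \<in> carrier (dual_space R M)"
    have m: "\<ominus> \<one> \<odot>\<^bsub>dual_space R M\<^esub> \<phi> \<in> carrier (dual_space R M)" using p by (intro c) auto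
    have "\<ominus> \<one> \<odot>\<^bsub>dual_space R M\<^esub> \<phi> \<oplus>\<^bsub>dual_space R M\<^esub> \<phi> = \<zero>\<^bsub>dual_space R M\<^esub>"
      by (rule dual_eqI[OF c(2)[OF m p] c(1)])
        (simp add: dual_ops d(2)[OF p] R.r_minus R.l_neg)
    then show "\<exists>\<psi>\<in>carrier (dual_space R M). \<psi> \<oplus>\<^bsub>dual_space R M\<^esub> \<phi> = \<zero>\<^bsub>dual_space R M\<^esub>" using m by blast
    show "\<zero>\<^bsub>dual_space R M\<^esub> \<oplus>\<^bsub>dual_space R M\<^esub> \<phi> = \<phi>"
      by (rule dual_eqI[OF c(2)[OF c(1) p] p]) (simp add: dual_ops d(2)[OF p])
  next
    fix \<phi> \<psi> \<chi> assume p: "\<phi> \<in> carrier (dual_space R M)" "\<psi> \<in> carrier (dual_space R M)" "\<chi> \<in> carrier (dual_space R M)"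
    show "\<phi> \<oplus>\<^bsub>dual_space R M\<^esub> \<psi> \<oplus>\<^bsub>dual_space R M\<^esub> \<chi> = \<phi> \<oplus>\<^bsub>dual_space R M\<^esub> (\<psi> \<oplus>\<^bsub>dual_space R M\<^esub> \<chi>)"
      by (rule dual_eqI[OF c(2)[OF c(2)[OF p(1,2)] p(3)] c(2)[OF p(1) c(2)[OF p(2,3)]]])
        (use p in \<open>simp add: dual_ops d(2) R.a_assoc\<close>)
  next
    fix \<phi> \<psi> assume p: "\<phi> \<in> carrier (dual_space R M)" "\<psi> \<in> carrier (dual_space R M)"
    show "\<phi> \<oplus>\<^bsub>dual_space R M\<^esub> \<psi> = \<psi> \<oplus>\<^bsub>dual_space R M\<^esub> \<phi>"
      by (rule dual_eqI[OF c(2)[OF p] c(2)[OF p(2,1)]]) (use p in \<open>simp add: dual_ops d(2) R.a_comm\<close>)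
  qed (auto intro: c)
  have "left_vector_space_axioms (opposite_ring R) (dual_space R M)"
  proof (unfold_locales, unfold opposite_ring_simps)
    fix a \<phi> assume a: "a \<in> carrier R" and p: "\<phi> \<in> carrier (dual_space R M)"
    show "a \<odot>\<^bsub>dual_space R M\<^esub> \<phi> \<in> carrier (dual_space R M)" using c a p by simp
  next
    fix a b \<phi> assume a: "a \<in> carrier R" "b \<in> carrier R" and p: "\<phi> \<in> carrier (dual_space R M)"
    show "(a \<oplus>\<^bsub>R\<^esub> b) \<odot>\<^bsub>dual_space R M\<^esub> \<phi> = a \<odot>\<^bsub>dual_space R M\<^esub> \<phi> \<oplus>\<^bsub>dual_space R M\<^esub> b \<odot>\<^bsub>dual_space R M\<^esub> \<phi>"
      by (rule dual_eqI[OF c(3)[OF _ p] c(2)[OF c(3)[OF a(1) p] c(3)[OF a(2) p]]])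
        (use a p in \<open>simp_all add: dual_ops d(2) R.r_distr\<close>)
    show "(b \<otimes> a) \<odot>\<^bsub>dual_space R M\<^esub> \<phi> = a \<odot>\<^bsub>dual_space R M\<^esub> (b \<odot>\<^bsub>dual_space R M\<^esub> \<phi>)"
      by (rule dual_eqI[OF c(3)[OF _ p] c(3)[OF a(1) c(3)[OF a(2) p]]])
        (use a p in \<open>simp_all add: dual_ops d(2) R.m_assoc\<close>)
  next
    fix a \<phi> \<psi> assume a: "a \<in> carrier R" and p: "\<phi> \<in> carrier (dual_space R M)" "\<psi> \<in> carrier (dual_space R M)"
    show "a \<odot>\<^bsub>dual_space R M\<^esub> (\<phi> \<oplus>\<^bsub>dual_space R M\<^esub> \<psi>) =
        a \<odot>\<^bsub>dual_space R M\<^esub> \<phi> \<oplus>\<^bsub>dual_space R M\<^esub> a \<odot>\<^bsub>dual_space R M\<^esub> \<psi>"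
      by (rule dual_eqI[OF c(3)[OF a c(2)[OF p]] c(2)[OF c(3)[OF a p(1)] c(3)[OF a p(2)]]])
        (use a p in \<open>simp add: dual_ops d(2) R.l_distr\<close>)
  next
    fix \<phi> assume p: "\<phi> \<in> carrier (dual_space R M)"
    show "\<one> \<odot>\<^bsub>dual_space R M\<^esub> \<phi> = \<phi>"
      by (rule dual_eqI[OF c(3)[OF R.one_closed p] p]) (use p in \<open>simp add: dual_ops d(2)\<close>)
  qed
  then show ?thesis
    using ag opposite_skew_field by (simp add: left_vector_space_def)
qed

lemma vanishing_subspace:
  assumes "X \<subseteq> carrier M"
  shows "submodule {\<phi> \<in> carrier (dual_space R M). \<forall>x\<in>X. \<phi> x = \<zero>} (opposite_ring R) (dual_space R M)"
proof -
  interpret D: left_vector_space "opposite_ring R" "dual_space R M" by (rule dual_left_vector_space)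
  show ?thesis
    by (rule D.subspaceI)
      (use assms dual_closed in \<open>auto simp: dual_ops opposite_ring_simps subset_eq\<close>)
qed

text \<open>The functionals that vanish on the annihilator of \<open>T\<close> form a subspace
  containing \<open>T\<close>, hence containing its span.\<close>

lemma annihilator_lin_span:
  assumes "T \<subseteq> carrier (dual_space R M)"
  shows "annihilator R M (lin_span (opposite_ring R) (dual_space R M) T) = annihilator R M T"
proof
  interpret D: left_vector_space "opposite_ring R" "dual_space R M" by (rule dual_left_vector_space)
  show "annihilator R M (lin_span (opposite_ring R) (dual_space R M) T) \<subseteq> annihilator R M T"
    using D.lin_span_superset[OF assms] by (auto simp: annihilator_def)
  have "lin_span (opposite_ring R) (dual_space R M) T
      \<subseteq> {\<phi> \<in> carrier (dual_space R M). \<forall>x\<in>annihilator R M T. \<phi> x = \<zero>}"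
    using assms by (intro D.lin_span_subset vanishing_subspace) (auto simp: annihilator_def)
  then show "annihilator R M T \<subseteq> annihilator R M (lin_span (opposite_ring R) (dual_space R M) T)"
    by (auto simp: annihilator_def)
qed

lemma annihilator_subspace:
  assumes "T \<subseteq> carrier (dual_space R M)"
  shows "submodule (annihilator R M T) R M"
proof (rule subspaceI)
  have d: "\<phi> \<in> carrier (dual_space R M)" if "\<phi> \<in> T" for \<phi> using assms that by auto
  show "\<zero>\<^bsub>M\<^esub> \<in> annihilator R M T"
  proof -
    have "\<phi> \<zero>\<^bsub>M\<^esub> = \<zero>" if "\<phi> \<in> T" for \<phi>
      using dual_carrierD(4)[OF d[OF that], of \<zero> "\<zero>\<^bsub>M\<^esub>"] dual_carrierD(2)[OF d[OF that], of "\<zero>\<^bsub>M\<^esub>"]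
      by (simp add: smult_r_null)
    then show ?thesis by (simp add: annihilator_def)
  qed
  show "annihilator R M T \<subseteq> carrier M" by (auto simp: annihilator_def)
  show "x \<oplus>\<^bsub>M\<^esub> y \<in> annihilator R M T" if "x \<in> annihilator R M T" "y \<in> annihilator R M T" for x y
  proof -
    have xy: "x \<in> carrier M \<and> y \<in> carrier M" "\<And>\<phi>. \<phi> \<in> T \<Longrightarrow> \<phi> x = \<zero>" "\<And>\<phi>. \<phi> \<in> T \<Longrightarrow> \<phi> y = \<zero>"
      using that unfolding annihilator_def by blast+
    have "\<phi> (x \<oplus>\<^bsub>M\<^esub> y) = \<zero>" if "\<phi> \<in> T" for \<phi>
      using dual_carrierD(3)[OF d[OF that], of x y] xy(1)
      by (simp add: xy(2)[OF that] xy(3)[OF that])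
    then show ?thesis using xy(1) by (simp add: annihilator_def)
  qed
  show "a \<odot>\<^bsub>M\<^esub> x \<in> annihilator R M T" if "a \<in> carrier R" "x \<in> annihilator R M T" for a x
  proof -
    have x: "x \<in> carrier M" "\<And>\<phi>. \<phi> \<in> T \<Longrightarrow> \<phi> x = \<zero>" using that unfolding annihilator_def by blast+
    have "\<phi> (a \<odot>\<^bsub>M\<^esub> x) = \<zero>" if "\<phi> \<in> T" for \<phi>
      using dual_carrierD(4)[OF d[OF that] \<open>a \<in> carrier R\<close> x(1)] \<open>a \<in> carrier R\<close> by (simp add: x(2)[OF that])
    then show ?thesis using x(1) that(1) by (simp add: annihilator_def smult_closed)
  qed
qed

text \<open>If some \<open>x\<^sub>0\<close> is annihilated by \<open>T\<close> but \<open>\<psi> x\<^sub>0 = 1\<close>, then \<open>\<phi> - \<psi> \<cdot> \<phi> x\<^sub>0\<close> vanishes on the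
  annihilator of \<open>T\<close> alone.\<close>

lemma annihilator_subset_imp_lin_span:
  assumes "finite T" "T \<subseteq> carrier (dual_space R M)" "\<phi> \<in> carrier (dual_space R M)"
    and "annihilator R M T \<subseteq> annihilator R M {\<phi>}"
  shows "\<phi> \<in> lin_span (opposite_ring R) (dual_space R M) T"
  using assms
proof (induction T arbitrary: \<phi> rule: finite_induct)
  case empty
  interpret D: left_vector_space "opposite_ring R" "dual_space R M" by (rule dual_left_vector_space)
  have "\<phi> = \<zero>\<^bsub>dual_space R M\<^esub>"
    by (rule dual_eqI) (use empty dual_closed in \<open>auto simp: annihilator_def dual_ops\<close>)
  then show ?case by (simp add: D.lin_span_empty)
next
  case (insert \<psi> T)
  interpret D: left_vector_space "opposite_ring R" "dual_space R M" by (rule dual_left_vector_space)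
  let ?S = "lin_span (opposite_ring R) (dual_space R M)"
  have T: "T \<subseteq> carrier (dual_space R M)" and \<psi>: "\<psi> \<in> carrier (dual_space R M)" using insert.prems by auto
  have \<phi>: "\<phi> \<in> carrier (dual_space R M)" using insert.prems by auto
  have ins: "insert \<psi> T \<subseteq> carrier (dual_space R M)" by (rule insert.prems(1))
  have mono: "?S T \<subseteq> ?S (insert \<psi> T)" using ins by (intro D.lin_span_mono) auto
  have ann_ins: "annihilator R M (insert \<psi> T) = annihilator R M T \<inter> annihilator R M {\<psi>}"
    by (auto simp: annihilator_def)
  show ?case
  proof (cases "annihilator R M T \<subseteq> annihilator R M {\<psi>}")
    case True
    then have "annihilator R M T \<subseteq> annihilator R M {\<phi>}" using insert.prems(3) ann_ins by auto
    then show ?thesis using insert.IH[OF T \<phi>] mono by auto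
  next
    case False
    then obtain y where y: "y \<in> annihilator R M T" "y \<notin> annihilator R M {\<psi>}" by auto
    have yM: "y \<in> carrier M" "\<psi> y \<noteq> \<zero>" using y by (auto simp: annihilator_def)
    note dp = dual_carrierD[OF \<phi>] and dq = dual_carrierD[OF \<psi>]
    have sT: "submodule (annihilator R M T) R M" by (rule annihilator_subspace[OF T])
    define x0 where "x0 = inv (\<psi> y) \<odot>\<^bsub>M\<^esub> y"
    note i = inv_nonzero[OF dq(2)[OF yM(1)] yM(2)]
    have x0: "x0 \<in> annihilator R M T" "x0 \<in> carrier M" "\<psi> x0 = \<one>"
      using subspace_smult[OF sT i(1) y(1)] smult_closed[OF i(1) yM(1)] dq(4)[OF i(1) yM(1)] i
      by (auto simp: x0_def)
    define c where "c = \<ominus> (\<phi> x0)"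
    have c: "c \<in> carrier R" using dp(2)[OF x0(2)] by (simp add: c_def)
    define \<chi> where "\<chi> = \<phi> \<oplus>\<^bsub>dual_space R M\<^esub> c \<odot>\<^bsub>dual_space R M\<^esub> \<psi>"
    have \<chi>: "\<chi> \<in> carrier (dual_space R M)" unfolding \<chi>_def by (intro dual_closed c \<phi> \<psi>)
    have "annihilator R M T \<subseteq> annihilator R M {\<chi>}"
    proof
      fix x assume x: "x \<in> annihilator R M T"
      then have xM: "x \<in> carrier M" by (simp add: annihilator_def)
      \<comment> \<open>\<open>z\<close> is \<open>x\<close> corrected along \<open>x0\<close> so
        that \<psi> vanishes on it; evaluating \<phi> at \<open>z\<close> gives the value of \<chi>
        at \<open>x\<close>.\<close>
      define z where "z = x \<oplus>\<^bsub>M\<^esub> (\<ominus> (\<psi> x)) \<odot>\<^bsub>M\<^esub> x0"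
      have mp: "\<ominus> (\<psi> x) \<in> carrier R" using dq(2)[OF xM] by simp
      have sm: "(\<ominus> (\<psi> x)) \<odot>\<^bsub>M\<^esub> x0 \<in> carrier M" using smult_closed[OF mp x0(2)] .
      have zT: "z \<in> annihilator R M T"
        unfolding z_def by (intro subspace_add[OF sT] x subspace_smult[OF sT] mp x0)
      have "\<psi> z = \<zero>"
        unfolding z_def using dq(3)[OF xM sm] dq(4)[OF mp x0(2)] x0(3) dq(2)[OF xM] by (simp add: R.r_neg)
      then have "z \<in> annihilator R M (insert \<psi> T)" using zT ann_ins by (auto simp: annihilator_def)
      then have "\<phi> z = \<zero>" using insert.prems(3) by (auto simp: annihilator_def)
      then have "\<phi> x \<oplus>\<^bsub>R\<^esub> (\<ominus> (\<psi> x)) \<otimes> \<phi> x0 = \<zero>"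
        unfolding z_def using dp(3)[OF xM sm] dp(4)[OF mp x0(2)] by simp
      then have "\<chi> x = \<zero>"
        unfolding \<chi>_def c_def using xM dp(2)[OF xM] dp(2)[OF x0(2)] dq(2)[OF xM]
        by (simp add: dual_ops R.l_minus R.r_minus)
      then show "x \<in> annihilator R M {\<chi>}" using xM by (simp add: annihilator_def)
    qed
    then have \<chi>S: "\<chi> \<in> ?S (insert \<psi> T)" using insert.IH[OF T \<chi>] mono by auto
    have sS: "submodule (?S (insert \<psi> T)) (opposite_ring R) (dual_space R M)" by (rule D.lin_span_subspace[OF ins])
    have "c \<odot>\<^bsub>dual_space R M\<^esub> \<psi> \<in> ?S (insert \<psi> T)"
      using D.subspace_smult[OF sS] D.lin_span_mem[OF ins] c by (simp add: opposite_ring_simps)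
    then show ?thesis
      using D.subspace_add_cancel_right[OF sS _ \<phi>] \<chi>S unfolding \<chi>_def by blast
  qed
qed

end

section \<open>Linear images of a subspace\<close>

text \<open>The instances are the identity of \<open>U\<close> and the quotient map from
  \<open>U\<close> to U/S. Dimensions are taken in the ambient space \<open>M\<close>, so none is
  attached to \<open>Q\<close>.\<close>

locale subspace_surjection = V: fin_vector_space R M n + Q: left_vector_space R Q
  for R :: "('a, 'r) ring_scheme" and M :: "('a, 'v, 'm) module_scheme" and n
    and Q :: "('a, 'q, 'k) module_scheme" +
  fixes U :: "'v set" and p :: "'v \<Rightarrow> 'q"
  assumes U: "submodule U R M"
    and p_image: "p ` U = carrier Q"
    and p_add: "\<lbrakk>x \<in> U; y \<in> U\<rbrakk> \<Longrightarrow> p (x \<oplus>\<^bsub>M\<^esub> y) = p x \<oplus>\<^bsub>Q\<^esub> p y"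
    and p_smult: "\<lbrakk>a \<in> carrier R; x \<in> U\<rbrakk> \<Longrightarrow> p (a \<odot>\<^bsub>M\<^esub> x) = a \<odot>\<^bsub>Q\<^esub> p x"
begin

definition preim :: "'q set \<Rightarrow> 'v set" where
  "preim Y = {x \<in> U. p x \<in> Y}"

lemma U_carrier: "x \<in> U \<Longrightarrow> x \<in> carrier M"
  using V.subspace_memD[OF U] .

lemma p_closed: "x \<in> U \<Longrightarrow> p x \<in> carrier Q"
  using p_image by auto

lemma p_zero: "p \<zero>\<^bsub>M\<^esub> = \<zero>\<^bsub>Q\<^esub>"
  using p_smult[of "\<zero>\<^bsub>R\<^esub>" "\<zero>\<^bsub>M\<^esub>"] V.subspace_zero[OF U] p_closed
  by (simp add: V.smult_r_null Q.smult_l_null)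

lemma p_diff:
  assumes "x \<in> U" "y \<in> U"
  shows "x \<oplus>\<^bsub>M\<^esub> (\<ominus>\<^bsub>R\<^esub> \<one>\<^bsub>R\<^esub>) \<odot>\<^bsub>M\<^esub> y \<in> U" "p (x \<oplus>\<^bsub>M\<^esub> (\<ominus>\<^bsub>R\<^esub> \<one>\<^bsub>R\<^esub>) \<odot>\<^bsub>M\<^esub> y) = p x \<oplus>\<^bsub>Q\<^esub> (\<ominus>\<^bsub>R\<^esub> \<one>\<^bsub>R\<^esub>) \<odot>\<^bsub>Q\<^esub> p y"
proof -
  have s: "(\<ominus>\<^bsub>R\<^esub> \<one>\<^bsub>R\<^esub>) \<odot>\<^bsub>M\<^esub> y \<in> U" using V.subspace_smult[OF U _ assms(2)] by simp
  then show "x \<oplus>\<^bsub>M\<^esub> (\<ominus>\<^bsub>R\<^esub> \<one>\<^bsub>R\<^esub>) \<odot>\<^bsub>M\<^esub> y \<in> U" using V.subspace_add[OF U assms(1)] by simp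
  show "p (x \<oplus>\<^bsub>M\<^esub> (\<ominus>\<^bsub>R\<^esub> \<one>\<^bsub>R\<^esub>) \<odot>\<^bsub>M\<^esub> y) = p x \<oplus>\<^bsub>Q\<^esub> (\<ominus>\<^bsub>R\<^esub> \<one>\<^bsub>R\<^esub>) \<odot>\<^bsub>Q\<^esub> p y"
    using p_add[OF assms(1) s] p_smult[OF _ assms(2)] by simp
qed

lemma preim_subspace:
  assumes "submodule Y R Q"
  shows "submodule (preim Y) R M"
  using V.subspace_zero[OF U] V.subspace_add[OF U] V.subspace_smult[OF U] U_carrier p_zero p_add p_smult
    Q.subspace_zero[OF assms] Q.subspace_add[OF assms] Q.subspace_smult[OF assms]
  by (intro V.subspaceI) (auto simp: preim_def)

lemma preim_zero_subset: "submodule Y R Q \<Longrightarrow> preim {\<zero>\<^bsub>Q\<^esub>} \<subseteq> preim Y"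
  using Q.subspace_zero by (auto simp: preim_def)

lemma kernel_subspace: "submodule (preim {\<zero>\<^bsub>Q\<^esub>}) R M"
  by (rule preim_subspace[OF Q.subspace_zero_set])

text \<open>\<open>x\<close> and \<open>y\<close> differ by an element of the kernel of
  \<open>p\<close>, which lies in \<open>a\<close>.\<close>

lemma mem_if_p_eq:
  assumes a: "submodule a R M" "preim {\<zero>\<^bsub>Q\<^esub>} \<subseteq> a" and xy: "x \<in> U" "y \<in> U" "y \<in> a" "p x = p y"
  shows "x \<in> a"
proof -
  let ?d = "x \<oplus>\<^bsub>M\<^esub> (\<ominus>\<^bsub>R\<^esub> \<one>\<^bsub>R\<^esub>) \<odot>\<^bsub>M\<^esub> y"
  have "p ?d = \<zero>\<^bsub>Q\<^esub>"
    using p_diff(2)[OF xy(1,2)] xy(4) p_closed[OF xy(2)]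
    by (simp add: Q.smult_l_minus Q.smult_one Q.M.r_neg)
  then have "?d \<in> a" using p_diff(1)[OF xy(1,2)] a(2) by (auto simp: preim_def)
  moreover have "(\<ominus>\<^bsub>R\<^esub> \<one>\<^bsub>R\<^esub>) \<odot>\<^bsub>M\<^esub> y \<in> a" using V.subspace_smult[OF a(1) _ xy(3)] by simp
  ultimately show ?thesis using V.subspace_add_cancel_right[OF a(1)] U_carrier[OF xy(1)] by blast
qed

lemma image_subspace:
  assumes "submodule a R M" "a \<subseteq> U"
  shows "submodule (p ` a) R Q"
proof (rule Q.subspaceI)
  show "p ` a \<subseteq> carrier Q" using p_closed assms(2) by auto
  show "\<zero>\<^bsub>Q\<^esub> \<in> p ` a" using p_zero V.subspace_zero[OF assms(1)] by (metis imageI)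
next
  fix x y assume "x \<in> p ` a" "y \<in> p ` a"
  then obtain x' y' where "x' \<in> a" "y' \<in> a" "x = p x'" "y = p y'" by auto
  then show "x \<oplus>\<^bsub>Q\<^esub> y \<in> p ` a"
    using p_add[of x' y'] V.subspace_add[OF assms(1), of x' y'] assms(2) by (metis imageI subsetD)
next
  fix c x assume c: "c \<in> carrier R" and "x \<in> p ` a"
  then obtain x' where "x' \<in> a" "x = p x'" by auto
  then show "c \<odot>\<^bsub>Q\<^esub> x \<in> p ` a"
    using p_smult[OF c, of x'] V.subspace_smult[OF assms(1) c, of x'] assms(2) by (metis imageI subsetD)
qed

text \<open>From right to left, the image of U \<inter> a is a subspace that contains
  \<open>T\<close> and hence its span; \<open>mem_if_p_eq\<close> leads back from the image to
  \<open>a\<close> because \<open>a\<close> contains the kernel.\<close>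

lemma preim_subset_iff:
  assumes T: "T \<subseteq> carrier Q" and a: "submodule a R M"
  shows "preim (lin_span R Q T) \<subseteq> a \<longleftrightarrow> preim {\<zero>\<^bsub>Q\<^esub>} \<subseteq> a \<and> (\<forall>w\<in>T. preim (lin_span R Q {w}) \<subseteq> a)"
proof (intro iffI conjI ballI)
  assume le: "preim (lin_span R Q T) \<subseteq> a"
  show "preim {\<zero>\<^bsub>Q\<^esub>} \<subseteq> a" using preim_zero_subset[OF Q.lin_span_subspace[OF T]] le by simp
  fix w assume "w \<in> T"
  then have "lin_span R Q {w} \<subseteq> lin_span R Q T" using T by (intro Q.lin_span_mono) auto
  then show "preim (lin_span R Q {w}) \<subseteq> a" using le by (auto simp: preim_def)
next
  assume *: "preim {\<zero>\<^bsub>Q\<^esub>} \<subseteq> a \<and> (\<forall>w\<in>T. preim (lin_span R Q {w}) \<subseteq> a)"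
  have s: "submodule (p ` (U \<inter> a)) R Q" by (rule image_subspace[OF V.subspace_Int[OF U a]]) auto
  have "T \<subseteq> p ` (U \<inter> a)"
  proof
    fix w assume w: "w \<in> T"
    then have wQ: "w \<in> carrier Q" using T by auto
    then obtain x where x: "x \<in> U" "p x = w" using p_image by (metis imageE)
    have "w \<in> lin_span R Q {w}" using wQ by (intro Q.lin_span_mem) auto
    then have "x \<in> a" using * w x by (auto simp: preim_def)
    then show "w \<in> p ` (U \<inter> a)" using x by auto
  qed
  then have sp: "lin_span R Q T \<subseteq> p ` (U \<inter> a)" by (rule Q.lin_span_subset[OF s])
  show "preim (lin_span R Q T) \<subseteq> a"
  proof
    fix x assume "x \<in> preim (lin_span R Q T)"
    then obtain y where "x \<in> U" "y \<in> U" "y \<in> a" "p x = p y" using sp by (auto simp: preim_def)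
    then show "x \<in> a" using mem_if_p_eq[OF a] * by blast
  qed
qed

lemma preim_singleton_subset_iff:
  assumes "T \<subseteq> carrier Q" "w \<in> carrier Q"
  shows "preim (lin_span R Q {w}) \<subseteq> preim (lin_span R Q T) \<longleftrightarrow> w \<in> lin_span R Q T"
proof
  assume le: "preim (lin_span R Q {w}) \<subseteq> preim (lin_span R Q T)"
  obtain x where x: "x \<in> U" "p x = w" using p_image assms(2) by (metis imageE)
  have "w \<in> lin_span R Q {w}" using assms(2) by (intro Q.lin_span_mem) auto
  then have "x \<in> preim (lin_span R Q {w})" using x by (simp add: preim_def)
  then show "w \<in> lin_span R Q T" using le x by (auto simp: preim_def)
next
  assume "w \<in> lin_span R Q T"
  then have "lin_span R Q {w} \<subseteq> lin_span R Q T"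
    using assms by (intro Q.lin_span_subset Q.lin_span_subspace) auto
  then show "preim (lin_span R Q {w}) \<subseteq> preim (lin_span R Q T)" by (auto simp: preim_def)
qed

lemma preim_singleton_subset_span:
  assumes x: "x \<in> U"
  shows "preim (lin_span R Q {p x}) \<subseteq> lin_span R M (insert x (preim {\<zero>\<^bsub>Q\<^esub>}))"
proof
  let ?S = "lin_span R M (insert x (preim {\<zero>\<^bsub>Q\<^esub>}))"
  have sub: "insert x (preim {\<zero>\<^bsub>Q\<^esub>}) \<subseteq> carrier M" using x U_carrier by (auto simp: preim_def)
  have s: "submodule ?S R M" by (rule V.lin_span_subspace[OF sub])
  note sup = V.lin_span_superset[OF sub]
  fix y assume "y \<in> preim (lin_span R Q {p x})"
  then obtain a where y: "y \<in> U" and a: "a \<in> carrier R" "p y = a \<odot>\<^bsub>Q\<^esub> p x"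
    using Q.lin_span_singleton[OF p_closed[OF x]] by (auto simp: preim_def)
  show "y \<in> ?S"
  proof (rule mem_if_p_eq[OF s _ y])
    show "preim {\<zero>\<^bsub>Q\<^esub>} \<subseteq> ?S" "a \<odot>\<^bsub>M\<^esub> x \<in> U" "a \<odot>\<^bsub>M\<^esub> x \<in> ?S" "p y = p (a \<odot>\<^bsub>M\<^esub> x)"
      using sup V.subspace_smult[OF U a(1) x] V.subspace_smult[OF s a(1)] p_smult[OF a(1) x] a(2) by auto
  qed
qed

lemma vdim_preim_singleton_le:
  assumes "w \<in> carrier Q"
  shows "vdim R M (preim (lin_span R Q {w})) \<le> Suc (vdim R M (preim {\<zero>\<^bsub>Q\<^esub>}))"
proof -
  obtain x where x: "x \<in> U" "p x = w" using p_image assms by (metis imageE)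
  have sub: "insert x (preim {\<zero>\<^bsub>Q\<^esub>}) \<subseteq> carrier M" using x U_carrier by (auto simp: preim_def)
  have "vdim R M (preim (lin_span R Q {w})) \<le> vdim R M (lin_span R M (insert x (preim {\<zero>\<^bsub>Q\<^esub>})))"
    using preim_singleton_subset_span[OF x(1)] x(2) assms
    by (intro V.vdim_mono preim_subspace Q.lin_span_subspace V.lin_span_subspace[OF sub]) auto
  also have "\<dots> \<le> Suc (vdim R M (preim {\<zero>\<^bsub>Q\<^esub>}))"
    by (rule V.vdim_insert_le[OF kernel_subspace U_carrier[OF x(1)]])
  finally show ?thesis .
qed

text \<open>Any vector of \<open>a\<close> outside the kernel gives a suitable \<open>w\<close>: the
  preimage of its line lies in \<open>a\<close> and is strictly larger than the kernel, so it has
  the dimension of \<open>a\<close>.\<close>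

lemma ex_preim_singleton:
  assumes a: "submodule a R M" "preim {\<zero>\<^bsub>Q\<^esub>} \<subseteq> a" "a \<subseteq> U" "vdim R M a = Suc (vdim R M (preim {\<zero>\<^bsub>Q\<^esub>}))"
  shows "\<exists>w\<in>carrier Q. preim (lin_span R Q {w}) = a"
proof -
  have "\<not> a \<subseteq> preim {\<zero>\<^bsub>Q\<^esub>}" using V.vdim_mono[OF a(1) kernel_subspace] a(4) by auto
  then obtain x where x: "x \<in> a" "x \<notin> preim {\<zero>\<^bsub>Q\<^esub>}" by auto
  have xU: "x \<in> U" and w: "p x \<in> carrier Q" using x a p_closed by auto
  have sw: "submodule (preim (lin_span R Q {p x})) R M" using w by (intro preim_subspace Q.lin_span_subspace) auto
  have "lin_span R M (insert x (preim {\<zero>\<^bsub>Q\<^esub>})) \<subseteq> a" using x a by (intro V.lin_span_subset) auto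
  then have le: "preim (lin_span R Q {p x}) \<subseteq> a" using preim_singleton_subset_span[OF xU] by auto
  have sub: "preim {\<zero>\<^bsub>Q\<^esub>} \<subseteq> preim (lin_span R Q {p x})"
    using w by (intro preim_zero_subset Q.lin_span_subspace) auto
  have "x \<in> preim (lin_span R Q {p x})" using xU w Q.lin_span_mem[of "{p x}" "p x"] by (simp add: preim_def)
  then have "\<not> vdim R M (preim (lin_span R Q {p x})) \<le> vdim R M (preim {\<zero>\<^bsub>Q\<^esub>})"
    using V.vdim_eqD[OF kernel_subspace sw sub] x(2) by auto
  then have "preim (lin_span R Q {p x}) = a" using V.vdim_eqD[OF sw a(1) le] a(4) by auto
  then show ?thesis using w by blast
qed

section \<open>Preimages of annihilators\<close>

lemma annihilator_empty: "preim (annihilator R Q {}) = U"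
  using p_closed by (auto simp: preim_def annihilator_def)

lemma preim_annihilator_subspace:
  "T \<subseteq> carrier (dual_space R Q) \<Longrightarrow> submodule (preim (annihilator R Q T)) R M"
  by (intro preim_subspace Q.annihilator_subspace)

lemma subset_preim_annihilator_iff:
  "a \<subseteq> preim (annihilator R Q T) \<longleftrightarrow> a \<subseteq> U \<and> (\<forall>\<phi>\<in>T. a \<subseteq> preim (annihilator R Q {\<phi>}))"
  using p_closed by (auto simp: preim_def annihilator_def)

text \<open>Surjectivity of \<open>p\<close> turns an inclusion of preimages into an inclusion of
  annihilators in \<open>Q\<close>, where duality for finitely many functionals applies.\<close>

lemma preim_annihilator_subset_iff:
  assumes "finite T" "T \<subseteq> carrier (dual_space R Q)" "\<phi> \<in> carrier (dual_space R Q)"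
  shows "preim (annihilator R Q T) \<subseteq> preim (annihilator R Q {\<phi>}) \<longleftrightarrow>
    \<phi> \<in> lin_span (opposite_ring R) (dual_space R Q) T"
proof
  assume le: "preim (annihilator R Q T) \<subseteq> preim (annihilator R Q {\<phi>})"
  have "annihilator R Q T \<subseteq> annihilator R Q {\<phi>}"
  proof
    fix q assume q: "q \<in> annihilator R Q T"
    then obtain x where "x \<in> U" "p x = q" using p_image unfolding annihilator_def by (metis (mono_tags) imageE mem_Collect_eq)
    then show "q \<in> annihilator R Q {\<phi>}" using le q by (auto simp: preim_def)
  qed
  then show "\<phi> \<in> lin_span (opposite_ring R) (dual_space R Q) T"
    by (rule Q.annihilator_subset_imp_lin_span[OF assms])
next
  assume "\<phi> \<in> lin_span (opposite_ring R) (dual_space R Q) T"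
  then have "annihilator R Q (lin_span (opposite_ring R) (dual_space R Q) T) \<subseteq> annihilator R Q {\<phi>}"
    by (auto simp: annihilator_def)
  then show "preim (annihilator R Q T) \<subseteq> preim (annihilator R Q {\<phi>})"
    using Q.annihilator_lin_span[OF assms(2)] by (auto simp: preim_def)
qed

text \<open>A functional has a kernel of codimension at most one: if \<phi> is nonzero at p(x),
  adding a suitable multiple of \<open>x\<close> moves any vector of \<open>U\<close> into the
  kernel.\<close>

lemma vdim_preim_annihilator_ge:
  assumes \<phi>: "\<phi> \<in> carrier (dual_space R Q)"
  shows "vdim R M U \<le> Suc (vdim R M (preim (annihilator R Q {\<phi>})))"
proof -
  let ?K = "preim (annihilator R Q {\<phi>})"
  note d = Q.dual_carrierD[OF \<phi>]
  have K: "submodule ?K R M" using \<phi> by (intro preim_annihilator_subspace) simp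
  show ?thesis
  proof (cases "U \<subseteq> ?K")
    case True
    then show ?thesis using V.vdim_mono[OF U K] by simp
  next
    case False
    then obtain x where x: "x \<in> U" "\<phi> (p x) \<noteq> \<zero>\<^bsub>R\<^esub>" using p_closed by (auto simp: preim_def annihilator_def)
    have sub: "insert x ?K \<subseteq> carrier M" using U_carrier x by (auto simp: preim_def)
    have s: "submodule (lin_span R M (insert x ?K)) R M" by (rule V.lin_span_subspace[OF sub])
    note i = V.inv_nonzero[OF d(2)[OF p_closed[OF x(1)]] x(2)]
    have "U \<subseteq> lin_span R M (insert x ?K)"
    proof
      fix u assume u: "u \<in> U"
      define c where "c = \<ominus>\<^bsub>R\<^esub> (\<phi> (p u) \<otimes>\<^bsub>R\<^esub> inv\<^bsub>R\<^esub> (\<phi> (p x)))"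
      have fu: "\<phi> (p u) \<in> carrier R" and fx: "\<phi> (p x) \<in> carrier R" using d(2) p_closed u x by auto
      have c: "c \<in> carrier R" using fu i by (simp add: c_def)
      have cx: "c \<odot>\<^bsub>M\<^esub> x \<in> U" using V.subspace_smult[OF U c x(1)] .
      have cfx: "c \<otimes>\<^bsub>R\<^esub> \<phi> (p x) = \<ominus>\<^bsub>R\<^esub> \<phi> (p u)"
        unfolding c_def using fu fx i by (simp add: V.R.l_minus V.R.m_assoc)
      have "\<phi> (p (u \<oplus>\<^bsub>M\<^esub> c \<odot>\<^bsub>M\<^esub> x)) = \<zero>\<^bsub>R\<^esub>"
        using p_add[OF u cx] p_smult[OF c x(1)] d(3)[OF p_closed[OF u]] d(4)[OF c p_closed[OF x(1)]]
          Q.smult_closed[OF c p_closed[OF x(1)]] cfx fu by (simp add: V.R.r_neg)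
      then have "u \<oplus>\<^bsub>M\<^esub> c \<odot>\<^bsub>M\<^esub> x \<in> ?K"
        using V.subspace_add[OF U u cx] p_closed by (simp add: preim_def annihilator_def)
      then have "u \<oplus>\<^bsub>M\<^esub> c \<odot>\<^bsub>M\<^esub> x \<in> lin_span R M (insert x ?K)" using V.lin_span_superset[OF sub] by auto
      moreover have "c \<odot>\<^bsub>M\<^esub> x \<in> lin_span R M (insert x ?K)"
        using V.subspace_smult[OF s c] V.lin_span_superset[OF sub] by auto
      ultimately show "u \<in> lin_span R M (insert x ?K)"
        using V.subspace_add_cancel_right[OF s] U_carrier[OF u] by blast
    qed
    then have "vdim R M U \<le> vdim R M (lin_span R M (insert x ?K))" by (rule V.vdim_mono[OF U s])
    also have "\<dots> \<le> Suc (vdim R M ?K)" by (rule V.vdim_insert_le[OF K U_carrier[OF x(1)]])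
    finally show ?thesis .
  qed
qed

text \<open>A hyperplane \<open>a\<close> of \<open>U\<close> is the kernel of the coordinate along
  a vector \<open>x\<close> off \<open>a\<close>. This coordinate is well defined on
  \<open>Q\<close> because the kernel of \<open>p\<close> lies in \<open>a\<close>.\<close>

lemma ex_preim_annihilator:
  assumes a: "submodule a R M" "preim {\<zero>\<^bsub>Q\<^esub>} \<subseteq> a" "a \<subseteq> U" "Suc (vdim R M a) = vdim R M U"
  shows "\<exists>\<phi>\<in>carrier (dual_space R Q). preim (annihilator R Q {\<phi>}) = a"
proof -
  have "\<not> U \<subseteq> a" using V.vdim_mono[OF U a(1)] a(4) by auto
  then obtain x where x: "x \<in> U" "x \<notin> a" by auto
  have xM: "x \<in> carrier M" using U_carrier[OF x(1)] .
  have aM: "a \<subseteq> carrier M" using V.subspace_subset[OF a(1)] .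
  have sub: "insert x a \<subseteq> carrier M" using xM aM by auto
  have "lin_span R M (insert x a) = U"
    using V.vdim_insert[OF a(1) xM x(2)] a x
    by (intro V.vdim_eqD V.lin_span_subspace[OF sub] U V.lin_span_subset) auto
  then have dec: "\<exists>c h. c \<in> carrier R \<and> h \<in> a \<and> u = h \<oplus>\<^bsub>M\<^esub> c \<odot>\<^bsub>M\<^esub> x" if "u \<in> U" for u
  proof -
    obtain c h where ch: "c \<in> carrier R" "h \<in> a" "u = c \<odot>\<^bsub>M\<^esub> x \<oplus>\<^bsub>M\<^esub> h"
      using V.lin_span_insert[OF xM aM, of u] V.lin_span_subspace_eq[OF a(1)]
        \<open>lin_span R M (insert x a) = U\<close> \<open>u \<in> U\<close> by auto
    then have "u = h \<oplus>\<^bsub>M\<^esub> c \<odot>\<^bsub>M\<^esub> x"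
      using V.M.a_comm[OF V.smult_closed[OF ch(1) xM]] aM by auto
    then show ?thesis using ch by blast
  qed
  \<comment> \<open>The coordinate is defined on \<open>Q\<close> directly, through any
    representation of \<open>q\<close> as the image of h + c x with h in \<open>a\<close>.\<close>
  define \<psi> where "\<psi> q = (SOME c. c \<in> carrier R \<and> (\<exists>h\<in>a. q = p (h \<oplus>\<^bsub>M\<^esub> c \<odot>\<^bsub>M\<^esub> x)))" for q
  have cU: "h \<oplus>\<^bsub>M\<^esub> c \<odot>\<^bsub>M\<^esub> x \<in> U" if "h \<in> a" "c \<in> carrier R" for h c
    using V.subspace_add[OF U _ V.subspace_smult[OF U that(2) x(1)]] that(1) a(3) by auto
  have \<psi>: "\<psi> (p (h \<oplus>\<^bsub>M\<^esub> c \<odot>\<^bsub>M\<^esub> x)) = c" if hc: "h \<in> a" "c \<in> carrier R" for h c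
    unfolding \<psi>_def
  proof (rule some_equality)
    fix c' assume "c' \<in> carrier R \<and> (\<exists>h'\<in>a. p (h \<oplus>\<^bsub>M\<^esub> c \<odot>\<^bsub>M\<^esub> x) = p (h' \<oplus>\<^bsub>M\<^esub> c' \<odot>\<^bsub>M\<^esub> x))"
    then obtain h' where h': "c' \<in> carrier R" "h' \<in> a" "p (h \<oplus>\<^bsub>M\<^esub> c \<odot>\<^bsub>M\<^esub> x) = p (h' \<oplus>\<^bsub>M\<^esub> c' \<odot>\<^bsub>M\<^esub> x)" by auto
    let ?u = "h \<oplus>\<^bsub>M\<^esub> c \<odot>\<^bsub>M\<^esub> x" and ?v = "h' \<oplus>\<^bsub>M\<^esub> c' \<odot>\<^bsub>M\<^esub> x"
    let ?d = "?u \<oplus>\<^bsub>M\<^esub> (\<ominus>\<^bsub>R\<^esub> \<one>\<^bsub>R\<^esub>) \<odot>\<^bsub>M\<^esub> ?v"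
    have UV: "?u \<in> U" "?v \<in> U" using cU hc h' by auto
    have uvM: "?u \<in> carrier M" "?v \<in> carrier M" using UV U_carrier by auto
    have "p ?d = \<zero>\<^bsub>Q\<^esub>"
      using p_diff(2)[OF UV] h'(3) p_closed[OF UV(2)] by (simp add: Q.smult_l_minus Q.smult_one Q.M.r_neg)
    then have d: "?d \<in> a" using p_diff(1)[OF UV] a(2) by (auto simp: preim_def)
    have hM: "h \<in> carrier M" "h' \<in> carrier M" "?d \<in> carrier M" using hc h' d aM by auto
    have cx: "c' \<odot>\<^bsub>M\<^esub> x \<in> carrier M" "c \<odot>\<^bsub>M\<^esub> x \<in> carrier M" using V.smult_closed xM h'(1) hc(2) by auto
    have du: "?d \<oplus>\<^bsub>M\<^esub> ?v = ?u"
      using uvM by (simp add: V.smult_l_minus V.smult_one V.M.a_assoc V.M.l_neg)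
    have dh: "?d \<oplus>\<^bsub>M\<^esub> h' \<in> a" using V.subspace_add[OF a(1) d h'(2)] .
    have "h \<oplus>\<^bsub>M\<^esub> c \<odot>\<^bsub>M\<^esub> x = (?d \<oplus>\<^bsub>M\<^esub> h') \<oplus>\<^bsub>M\<^esub> c' \<odot>\<^bsub>M\<^esub> x"
      using du V.M.a_assoc[OF hM(3,2) cx(1)] by simp
    from V.coeff_unique(1)[OF a(1) xM x(2) hc(1) dh hc(2) h'(1) this] show "c' = c" by simp
  qed (use hc in blast)
  define \<phi> where "\<phi> = (\<lambda>q\<in>carrier Q. \<psi> q)"
  have rep: "\<exists>c h. c \<in> carrier R \<and> h \<in> a \<and> q = p (h \<oplus>\<^bsub>M\<^esub> c \<odot>\<^bsub>M\<^esub> x) \<and> \<phi> q = c" if q: "q \<in> carrier Q" for q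
  proof -
    obtain u where "u \<in> U" "q = p u" using q p_image by (metis imageE)
    moreover obtain c h where "c \<in> carrier R" "h \<in> a" "u = h \<oplus>\<^bsub>M\<^esub> c \<odot>\<^bsub>M\<^esub> x"
      using dec[OF calculation(1)] by blast
    ultimately show ?thesis using \<psi>[of h c] q by (intro exI[of _ c] exI[of _ h]) (simp add: \<phi>_def)
  qed
  have \<phi>c: "\<phi> \<in> carrier (dual_space R Q)"
  proof (rule Q.dual_carrierI)
    show "\<phi> \<in> extensional (carrier Q)" by (simp add: \<phi>_def)
    show "\<phi> q \<in> carrier R" if "q \<in> carrier Q" for q using rep[OF that] by auto
  next
    fix q r assume qr: "q \<in> carrier Q" "r \<in> carrier Q"
    obtain c h where q: "c \<in> carrier R" "h \<in> a" "q = p (h \<oplus>\<^bsub>M\<^esub> c \<odot>\<^bsub>M\<^esub> x)" "\<phi> q = c" using rep[OF qr(1)] by blast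
    obtain d g where r: "d \<in> carrier R" "g \<in> a" "r = p (g \<oplus>\<^bsub>M\<^esub> d \<odot>\<^bsub>M\<^esub> x)" "\<phi> r = d" using rep[OF qr(2)] by blast
    have M: "h \<in> carrier M" "g \<in> carrier M" "c \<odot>\<^bsub>M\<^esub> x \<in> carrier M" "d \<odot>\<^bsub>M\<^esub> x \<in> carrier M"
      using q r aM xM V.smult_closed by auto
    have "q \<oplus>\<^bsub>Q\<^esub> r = p ((h \<oplus>\<^bsub>M\<^esub> c \<odot>\<^bsub>M\<^esub> x) \<oplus>\<^bsub>M\<^esub> (g \<oplus>\<^bsub>M\<^esub> d \<odot>\<^bsub>M\<^esub> x))"
      using p_add[OF cU[OF q(2,1)] cU[OF r(2,1)]] q(3) r(3) by simp
    also have "(h \<oplus>\<^bsub>M\<^esub> c \<odot>\<^bsub>M\<^esub> x) \<oplus>\<^bsub>M\<^esub> (g \<oplus>\<^bsub>M\<^esub> d \<odot>\<^bsub>M\<^esub> x) = (h \<oplus>\<^bsub>M\<^esub> g) \<oplus>\<^bsub>M\<^esub> (c \<oplus>\<^bsub>R\<^esub> d) \<odot>\<^bsub>M\<^esub> x"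
      using M q(1) r(1) xM by (simp add: V.smult_l_distr V.M.a_ac)
    finally have e: "q \<oplus>\<^bsub>Q\<^esub> r = p ((h \<oplus>\<^bsub>M\<^esub> g) \<oplus>\<^bsub>M\<^esub> (c \<oplus>\<^bsub>R\<^esub> d) \<odot>\<^bsub>M\<^esub> x)" .
    have "\<psi> (q \<oplus>\<^bsub>Q\<^esub> r) = c \<oplus>\<^bsub>R\<^esub> d"
      unfolding e by (rule \<psi>[OF V.subspace_add[OF a(1) q(2) r(2)] V.R.a_closed[OF q(1) r(1)]])
    then show "\<phi> (q \<oplus>\<^bsub>Q\<^esub> r) = \<phi> q \<oplus>\<^bsub>R\<^esub> \<phi> r" unfolding q(4) r(4) using qr by (simp add: \<phi>_def)
  next
    fix b q assume b: "b \<in> carrier R" and qQ: "q \<in> carrier Q"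
    obtain c h where q: "c \<in> carrier R" "h \<in> a" "q = p (h \<oplus>\<^bsub>M\<^esub> c \<odot>\<^bsub>M\<^esub> x)" "\<phi> q = c" using rep[OF qQ] by blast
    have M: "h \<in> carrier M" "c \<odot>\<^bsub>M\<^esub> x \<in> carrier M" using q aM xM V.smult_closed by auto
    have "b \<odot>\<^bsub>Q\<^esub> q = p (b \<odot>\<^bsub>M\<^esub> (h \<oplus>\<^bsub>M\<^esub> c \<odot>\<^bsub>M\<^esub> x))"
      using p_smult[OF b cU[OF q(2,1)]] q(3) by simp
    also have "b \<odot>\<^bsub>M\<^esub> (h \<oplus>\<^bsub>M\<^esub> c \<odot>\<^bsub>M\<^esub> x) = b \<odot>\<^bsub>M\<^esub> h \<oplus>\<^bsub>M\<^esub> (b \<otimes>\<^bsub>R\<^esub> c) \<odot>\<^bsub>M\<^esub> x"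
      using M q(1) b xM by (simp add: V.smult_r_distr V.smult_assoc)
    finally have e: "b \<odot>\<^bsub>Q\<^esub> q = p (b \<odot>\<^bsub>M\<^esub> h \<oplus>\<^bsub>M\<^esub> (b \<otimes>\<^bsub>R\<^esub> c) \<odot>\<^bsub>M\<^esub> x)" .
    have "\<psi> (b \<odot>\<^bsub>Q\<^esub> q) = b \<otimes>\<^bsub>R\<^esub> c"
      unfolding e by (rule \<psi>[OF V.subspace_smult[OF a(1) b q(2)] V.R.m_closed[OF b q(1)]])
    then show "\<phi> (b \<odot>\<^bsub>Q\<^esub> q) = b \<otimes>\<^bsub>R\<^esub> \<phi> q" unfolding q(4) using qQ b Q.smult_closed by (simp add: \<phi>_def)
  qed
  have "preim (annihilator R Q {\<phi>}) = a"
  proof (intro subset_antisym[rotated] subsetI)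
    fix u assume "u \<in> a"
    then have "u = u \<oplus>\<^bsub>M\<^esub> \<zero>\<^bsub>R\<^esub> \<odot>\<^bsub>M\<^esub> x" "u \<in> U" using aM xM a(3) by (auto simp: V.smult_l_null)
    then have "\<phi> (p u) = \<zero>\<^bsub>R\<^esub>" using \<psi>[OF \<open>u \<in> a\<close>, of "\<zero>\<^bsub>R\<^esub>"] p_closed by (simp add: \<phi>_def)
    then show "u \<in> preim (annihilator R Q {\<phi>})" using \<open>u \<in> U\<close> p_closed by (simp add: preim_def annihilator_def)
  next
    fix u assume u: "u \<in> preim (annihilator R Q {\<phi>})"
    then have uU: "u \<in> U" and 0: "\<phi> (p u) = \<zero>\<^bsub>R\<^esub>" by (auto simp: preim_def annihilator_def)
    obtain c h where ch: "c \<in> carrier R" "h \<in> a" "u = h \<oplus>\<^bsub>M\<^esub> c \<odot>\<^bsub>M\<^esub> x" using dec[OF uU] by blast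
    have "c = \<zero>\<^bsub>R\<^esub>" using \<psi>[OF ch(2,1)] ch(3) 0 p_closed[OF uU] by (simp add: \<phi>_def)
    then have "u = h" using ch xM aM by (auto simp: V.smult_l_null)
    then show "u \<in> a" using ch by simp
  qed
  then show ?thesis using \<phi>c by blast
qed

end

section \<open>Quotient spaces\<close>

context left_vector_space
begin

text \<open>A coset does not see the carrier, so the vectors of U/S are vectors of the quotient of
  the whole space.\<close>

lemma a_r_coset_of_subspace: "S +>\<^bsub>M\<lparr>carrier := U\<rparr>\<^esub> x = S +>\<^bsub>M\<^esub> x"
  by (simp add: a_r_coset_def r_coset_def)

context
  fixes S assumes S: "submodule S R M"
begin

lemma subspace_abelian_subgroup: "abelian_subgroup S M"
proof (rule abelian_subgroupI3)
  show "additive_subgroup S M" using S by (simp add: submodule_def additive_subgroup_def)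
  show "abelian_group M" by (rule M.abelian_group_axioms)
qed

lemma quot_carrier: "carrier (quot_space M S) = {S +>\<^bsub>M\<^esub> x | x. x \<in> carrier M}"
  by (auto simp: quot_space_def A_RCOSETS_def')

lemma coset_self: "x \<in> carrier M \<Longrightarrow> x \<in> S +>\<^bsub>M\<^esub> x"
  by (rule abelian_subgroup.a_rcos_self[OF subspace_abelian_subgroup])

lemma mem_coset_iff:
  "\<lbrakk>x \<in> carrier M; y \<in> carrier M\<rbrakk> \<Longrightarrow> y \<in> S +>\<^bsub>M\<^esub> x \<longleftrightarrow> y \<oplus>\<^bsub>M\<^esub> \<ominus>\<^bsub>M\<^esub> x \<in> S"
  by (rule abelian_subgroup.a_rcos_module[OF subspace_abelian_subgroup])

lemma coset_eqI:
  "\<lbrakk>x \<in> carrier M; y \<in> S +>\<^bsub>M\<^esub> x\<rbrakk> \<Longrightarrow> S +>\<^bsub>M\<^esub> y = S +>\<^bsub>M\<^esub> x"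
  using abelian_subgroup.a_repr_independence'[OF subspace_abelian_subgroup] by blast

lemma coset_carrier: "x \<in> carrier M \<Longrightarrow> y \<in> S +>\<^bsub>M\<^esub> x \<Longrightarrow> y \<in> carrier M"
  using M.a_r_coset_subset_G subspace_subset[OF S] by blast

lemma coset_zero_iff:
  assumes "x \<in> carrier M"
  shows "S +>\<^bsub>M\<^esub> x = S \<longleftrightarrow> x \<in> S"
  using coset_self[OF assms] abelian_subgroup.a_rcos_const[OF subspace_abelian_subgroup] by auto

lemma quot_zero: "\<zero>\<^bsub>quot_space M S\<^esub> = S"
  by (simp add: quot_space_def)

lemma quot_add:
  "\<lbrakk>x \<in> carrier M; y \<in> carrier M\<rbrakk> \<Longrightarrow>
    (S +>\<^bsub>M\<^esub> x) \<oplus>\<^bsub>quot_space M S\<^esub> (S +>\<^bsub>M\<^esub> y) = S +>\<^bsub>M\<^esub> (x \<oplus>\<^bsub>M\<^esub> y)"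
  using abelian_subgroup.a_rcos_sum[OF subspace_abelian_subgroup] by (simp add: quot_space_def)

text \<open>All cosets in the union that defines the product coincide: if y - x is in
  \<open>S\<close>, so is a y - a x.\<close>

lemma quot_smult:
  assumes a: "a \<in> carrier R" and x: "x \<in> carrier M"
  shows "a \<odot>\<^bsub>quot_space M S\<^esub> (S +>\<^bsub>M\<^esub> x) = S +>\<^bsub>M\<^esub> (a \<odot>\<^bsub>M\<^esub> x)"
proof -
  have "S +>\<^bsub>M\<^esub> (a \<odot>\<^bsub>M\<^esub> y) = S +>\<^bsub>M\<^esub> (a \<odot>\<^bsub>M\<^esub> x)" if y: "y \<in> S +>\<^bsub>M\<^esub> x" for y
  proof (rule coset_eqI)
    have yM: "y \<in> carrier M" by (rule coset_carrier[OF x y])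
    show ax: "a \<odot>\<^bsub>M\<^esub> x \<in> carrier M" by (rule smult_closed[OF a x])
    have "a \<odot>\<^bsub>M\<^esub> (y \<oplus>\<^bsub>M\<^esub> \<ominus>\<^bsub>M\<^esub> x) \<in> S"
      using y mem_coset_iff[OF x yM] subspace_smult[OF S a] by simp
    then have "a \<odot>\<^bsub>M\<^esub> y \<oplus>\<^bsub>M\<^esub> \<ominus>\<^bsub>M\<^esub> (a \<odot>\<^bsub>M\<^esub> x) \<in> S"
      using a x yM by (simp add: smult_r_distr smult_r_minus)
    then show "a \<odot>\<^bsub>M\<^esub> y \<in> S +>\<^bsub>M\<^esub> (a \<odot>\<^bsub>M\<^esub> x)" using mem_coset_iff[OF ax smult_closed[OF a yM]] by simp
  qed
  then have "(\<Union>y\<in>S +>\<^bsub>M\<^esub> x. S +>\<^bsub>M\<^esub> (a \<odot>\<^bsub>M\<^esub> y)) = S +>\<^bsub>M\<^esub> (a \<odot>\<^bsub>M\<^esub> x)"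
    using coset_self[OF x] by blast
  then show ?thesis by (simp add: quot_space_def)
qed

lemma quot_left_vector_space: "left_vector_space R (quot_space M S)"
proof -
  have closed: "S +>\<^bsub>M\<^esub> x \<in> carrier (quot_space M S)" if "x \<in> carrier M" for x
    using that quot_carrier by blast
  have zero: "\<zero>\<^bsub>quot_space M S\<^esub> = S +>\<^bsub>M\<^esub> \<zero>\<^bsub>M\<^esub>"
    using coset_zero_iff[of "\<zero>\<^bsub>M\<^esub>"] subspace_zero[OF S] quot_zero by simp
  have ag: "abelian_group (quot_space M S)"
  proof (rule abelian_groupI)
    fix X assume "X \<in> carrier (quot_space M S)"
    then obtain x where x: "x \<in> carrier M" "X = S +>\<^bsub>M\<^esub> x" unfolding quot_carrier by blast
    have "(S +>\<^bsub>M\<^esub> (\<ominus>\<^bsub>M\<^esub> x)) \<oplus>\<^bsub>quot_space M S\<^esub> X = \<zero>\<^bsub>quot_space M S\<^esub>"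
      using x by (simp add: quot_add zero M.l_neg)
    then show "\<exists>Y\<in>carrier (quot_space M S). Y \<oplus>\<^bsub>quot_space M S\<^esub> X = \<zero>\<^bsub>quot_space M S\<^esub>"
      using closed[of "\<ominus>\<^bsub>M\<^esub> x"] x by blast
    show "\<zero>\<^bsub>quot_space M S\<^esub> \<oplus>\<^bsub>quot_space M S\<^esub> X = X" using x by (simp add: quot_add zero)
  next
    fix X Y assume "X \<in> carrier (quot_space M S)" "Y \<in> carrier (quot_space M S)"
    then obtain x y where x: "x \<in> carrier M" "X = S +>\<^bsub>M\<^esub> x" and y: "y \<in> carrier M" "Y = S +>\<^bsub>M\<^esub> y"
      unfolding quot_carrier by blast
    show "X \<oplus>\<^bsub>quot_space M S\<^esub> Y \<in> carrier (quot_space M S)" using x y closed by (simp add: quot_add)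
    show "X \<oplus>\<^bsub>quot_space M S\<^esub> Y = Y \<oplus>\<^bsub>quot_space M S\<^esub> X" using x y by (simp add: quot_add M.a_comm)
    fix Z assume "Z \<in> carrier (quot_space M S)"
    then obtain z where z: "z \<in> carrier M" "Z = S +>\<^bsub>M\<^esub> z" unfolding quot_carrier by blast
    show "X \<oplus>\<^bsub>quot_space M S\<^esub> Y \<oplus>\<^bsub>quot_space M S\<^esub> Z = X \<oplus>\<^bsub>quot_space M S\<^esub> (Y \<oplus>\<^bsub>quot_space M S\<^esub> Z)"
      using x y z by (simp add: quot_add M.a_assoc)
  next
    show "\<zero>\<^bsub>quot_space M S\<^esub> \<in> carrier (quot_space M S)" unfolding zero by (rule closed) simp
  qed
  have "left_vector_space_axioms R (quot_space M S)"
  proof (unfold_locales)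
    fix a X assume a: "a \<in> carrier R" and "X \<in> carrier (quot_space M S)"
    then obtain x where x: "x \<in> carrier M" "X = S +>\<^bsub>M\<^esub> x" unfolding quot_carrier by blast
    show "a \<odot>\<^bsub>quot_space M S\<^esub> X \<in> carrier (quot_space M S)"
      using a x closed smult_closed by (simp add: quot_smult)
  next
    fix X assume "X \<in> carrier (quot_space M S)"
    then obtain x where x: "x \<in> carrier M" "X = S +>\<^bsub>M\<^esub> x" unfolding quot_carrier by blast
    show "\<one>\<^bsub>R\<^esub> \<odot>\<^bsub>quot_space M S\<^esub> X = X" using x by (simp add: quot_smult smult_one)
    fix a b assume ab: "a \<in> carrier R" "b \<in> carrier R"
    show "(a \<oplus>\<^bsub>R\<^esub> b) \<odot>\<^bsub>quot_space M S\<^esub> X =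
        a \<odot>\<^bsub>quot_space M S\<^esub> X \<oplus>\<^bsub>quot_space M S\<^esub> b \<odot>\<^bsub>quot_space M S\<^esub> X"
      using ab x by (simp add: quot_smult quot_add smult_closed smult_l_distr)
    show "(a \<otimes>\<^bsub>R\<^esub> b) \<odot>\<^bsub>quot_space M S\<^esub> X = a \<odot>\<^bsub>quot_space M S\<^esub> (b \<odot>\<^bsub>quot_space M S\<^esub> X)"
      using ab x by (simp add: quot_smult smult_closed smult_assoc)
  next
    fix a X Y assume a: "a \<in> carrier R" and "X \<in> carrier (quot_space M S)" "Y \<in> carrier (quot_space M S)"
    then obtain x y where x: "x \<in> carrier M" "X = S +>\<^bsub>M\<^esub> x" and y: "y \<in> carrier M" "Y = S +>\<^bsub>M\<^esub> y"
      unfolding quot_carrier by blast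
    show "a \<odot>\<^bsub>quot_space M S\<^esub> (X \<oplus>\<^bsub>quot_space M S\<^esub> Y) =
        a \<odot>\<^bsub>quot_space M S\<^esub> X \<oplus>\<^bsub>quot_space M S\<^esub> a \<odot>\<^bsub>quot_space M S\<^esub> Y"
      using a x y by (simp add: quot_smult quot_add smult_closed smult_r_distr)
  qed
  then show ?thesis using ag R.skew_field_axioms by (simp add: left_vector_space_def)
qed

end

end

context fin_vector_space
begin

lemma identity_surjection:
  assumes U: "submodule U R M"
  shows "subspace_surjection R M n (M\<lparr>carrier := U\<rparr>) U (\<lambda>x. x)"
  by (intro subspace_surjection.intro fin_vector_space_axioms subspace_left_vector_space[OF U]
      subspace_surjection_axioms.intro) (use U in auto)

lemma quotient_surjection:
  assumes U: "submodule U R M" and S: "submodule S R M" "S \<subseteq> U"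
  shows "subspace_surjection R M n (quot_space (M\<lparr>carrier := U\<rparr>) S) U (\<lambda>x. S +>\<^bsub>M\<^esub> x)"
    and "\<zero>\<^bsub>quot_space (M\<lparr>carrier := U\<rparr>) S\<^esub> = S"
    and "\<And>Y. Y \<subseteq> carrier (quot_space (M\<lparr>carrier := U\<rparr>) S) \<Longrightarrow>
      quot_preimage M S Y = {x \<in> U. S +>\<^bsub>M\<^esub> x \<in> Y}"
proof -
  interpret U: left_vector_space R "M\<lparr>carrier := U\<rparr>" by (rule subspace_left_vector_space[OF U])
  have S': "submodule S R (M\<lparr>carrier := U\<rparr>)" using S subspace_of_subspace_iff[OF U] by simp
  note car = U.quot_carrier[OF S', unfolded a_r_coset_of_subspace]
  show "subspace_surjection R M n (quot_space (M\<lparr>carrier := U\<rparr>) S) U (\<lambda>x. S +>\<^bsub>M\<^esub> x)"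
  proof (intro subspace_surjection.intro fin_vector_space_axioms U.quot_left_vector_space[OF S']
      subspace_surjection_axioms.intro U)
    show "(\<lambda>x. S +>\<^bsub>M\<^esub> x) ` U = carrier (quot_space (M\<lparr>carrier := U\<rparr>) S)" using car by auto
    show "S +>\<^bsub>M\<^esub> (x \<oplus>\<^bsub>M\<^esub> y) = (S +>\<^bsub>M\<^esub> x) \<oplus>\<^bsub>quot_space (M\<lparr>carrier := U\<rparr>) S\<^esub> (S +>\<^bsub>M\<^esub> y)"
      if "x \<in> U" "y \<in> U" for x y
      using U.quot_add[OF S', of x y, unfolded a_r_coset_of_subspace] that by simp
    show "S +>\<^bsub>M\<^esub> (a \<odot>\<^bsub>M\<^esub> x) = a \<odot>\<^bsub>quot_space (M\<lparr>carrier := U\<rparr>) S\<^esub> (S +>\<^bsub>M\<^esub> x)"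
      if "a \<in> carrier R" "x \<in> U" for a x
      using U.quot_smult[OF S', of a x, unfolded a_r_coset_of_subspace] that by simp
  qed
  show "\<zero>\<^bsub>quot_space (M\<lparr>carrier := U\<rparr>) S\<^esub> = S" by (rule U.quot_zero[OF S'])
  fix Y assume Y: "Y \<subseteq> carrier (quot_space (M\<lparr>carrier := U\<rparr>) S)"
  \<comment> \<open>\<open>Y\<close> consists of cosets of vectors of \<open>U\<close>, and these
    stay inside \<open>U\<close> because S \<subseteq> U; so the preimage in the whole space is the
    preimage in \<open>U\<close>.\<close>
  have "x \<in> U" if x: "x \<in> carrier M" "S +>\<^bsub>M\<^esub> x \<in> Y" for x
  proof -
    obtain u where u: "u \<in> U" "S +>\<^bsub>M\<^esub> x = S +>\<^bsub>M\<^esub> u" using Y x(2) car by auto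
    have "x \<in> S +>\<^bsub>M\<lparr>carrier := U\<rparr>\<^esub> u" using coset_self[OF S(1) x(1)] u(2) a_r_coset_of_subspace by simp
    then show ?thesis using U.coset_carrier[OF S', of u x] u(1) by simp
  qed
  then show "quot_preimage M S Y = {x \<in> U. S +>\<^bsub>M\<^esub> x \<in> Y}"
    using subspace_memD[OF U] by (auto simp: quot_preimage_def)
qed

end


section \<open>Distances in Grassmann graphs\<close>

context fin_vector_space
begin

lemma grassmann_graph_simps:
  "pverts (grassmann_graph R M p) = grassmannian R M p"
  "parcs (grassmann_graph R M p) = {(X, Y). X \<in> grassmannian R M p \<and> Y \<in> grassmannian R M p \<and>
     X \<inter> Y \<in> grassmannian R M (p - 1)}"
  by (simp_all add: grassmann_graph_def)

lemma grassmann_wf_digraph: "wf_digraph (with_proj (grassmann_graph R M p))"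
  by unfold_locales (auto simp: grassmann_graph_simps)

text \<open>Along an edge from \<open>X\<close> to \<open>Z\<close> the intersection with
  \<open>Y\<close> grows by at most one dimension: X \<inter> Z, of dimension p - 1, and Z \<inter>
  Y both lie in the p-dimensional \<open>Z\<close>.\<close>

lemma awalk_length_ge:
  assumes p: "1 \<le> p" and w: "pre_digraph.awalk (with_proj (grassmann_graph R M p)) X es Y"
  shows "p \<le> vdim R M (X \<inter> Y) + length es"
  using w
proof (induction es arbitrary: X)
  case Nil
  interpret G: wf_digraph "with_proj (grassmann_graph R M p)" by (rule grassmann_wf_digraph)
  have "X = Y" "X \<in> grassmannian R M p" using Nil by (auto simp: G.awalk_Nil_iff grassmann_graph_simps)
  then show ?case by (simp add: grassmannian_iff)
next
  case (Cons e es)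
  interpret G: wf_digraph "with_proj (grassmann_graph R M p)" by (rule grassmann_wf_digraph)
  obtain Z where e: "e = (X, Z)" "X \<in> grassmannian R M p" "Z \<in> grassmannian R M p" "X \<inter> Z \<in> grassmannian R M (p - 1)"
    and w: "G.awalk Z es Y"
    using Cons.prems by (cases e) (auto simp: G.awalk_Cons_iff grassmann_graph_simps)
  have "Y \<in> grassmannian R M p" using G.awalk_last_in_verts[OF w] by (simp add: grassmann_graph_simps)
  then have s: "submodule X R M" "submodule Y R M" "submodule Z R M" "vdim R M Z = p" "vdim R M (X \<inter> Z) = p - 1"
    using e by (auto simp: grassmannian_iff)
  have XZ: "submodule (X \<inter> Z) R M" and ZY: "submodule (Z \<inter> Y) R M" and XY: "submodule (X \<inter> Y) R M"
    using s subspace_Int by auto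
  have I: "submodule ((X \<inter> Z) \<inter> (Z \<inter> Y)) R M" by (rule subspace_Int[OF XZ ZY])
  have sub: "(X \<inter> Z) \<union> (Z \<inter> Y) \<subseteq> carrier M" using subspace_subset[OF s(3)] by auto
  have "vdim R M (lin_span R M ((X \<inter> Z) \<union> (Z \<inter> Y))) \<le> p"
    using vdim_mono[OF lin_span_subspace[OF sub] s(3) lin_span_subset[OF s(3)]] s(4) by auto
  moreover have "vdim R M ((X \<inter> Z) \<inter> (Z \<inter> Y)) \<le> vdim R M (X \<inter> Y)" by (rule vdim_mono[OF I XY]) auto
  ultimately have "vdim R M (Z \<inter> Y) \<le> Suc (vdim R M (X \<inter> Y))"
    using vdim_Un_Int[OF XZ ZY] s(5) p by linarith
  then show ?case using Cons.IH[OF w] by simp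
qed

text \<open>Each edge given by \<open>ex_step_towards\<close> enlarges the intersection with the end
  vertex, so the lower bound on the length is attained.\<close>

lemma ex_short_awalk:
  assumes "1 \<le> p" "X \<in> grassmannian R M p" "Y \<in> grassmannian R M p"
  shows "\<exists>es. pre_digraph.awalk (with_proj (grassmann_graph R M p)) X es Y \<and> length es \<le> p - vdim R M (X \<inter> Y)"
  using assms(2)
proof (induction "p - vdim R M (X \<inter> Y)" arbitrary: X rule: less_induct)
  case less
  interpret G: wf_digraph "with_proj (grassmann_graph R M p)" by (rule grassmann_wf_digraph)
  have s: "submodule X R M" "vdim R M X = p" "submodule Y R M" "vdim R M Y = p"
    using less(2) assms(3) by (auto simp: grassmannian_iff)
  show ?case
  proof (cases "X = Y")
    case True
    then have "G.awalk X [] Y" using less(2) by (simp add: G.awalk_Nil_iff grassmann_graph_simps)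
    then show ?thesis by (intro exI[of _ "[]"]) simp
  next
    case False
    obtain Z where Z: "submodule Z R M" "vdim R M Z = p" "Suc (vdim R M (X \<inter> Z)) = p"
      "vdim R M (X \<inter> Y) < vdim R M (Z \<inter> Y)"
      using ex_step_towards[OF s(1,3,2,4) False] .
    have ZG: "Z \<in> grassmannian R M p" "X \<inter> Z \<in> grassmannian R M (p - 1)"
      using Z subspace_Int[OF s(1) Z(1)] by (auto simp: grassmannian_iff)
    have le: "vdim R M (Z \<inter> Y) \<le> p" using vdim_mono[OF subspace_Int[OF Z(1) s(3)] Z(1)] Z(2) by auto
    then obtain es where es: "G.awalk Z es Y" "length es \<le> p - vdim R M (Z \<inter> Y)"
      using less(1)[OF _ ZG(1)] Z(4) by (meson diff_less_mono2 less_le_trans)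
    have "G.awalk X ((X, Z) # es) Y"
      using es(1) ZG less(2) by (simp add: G.awalk_Cons_iff grassmann_graph_simps)
    moreover have "length ((X, Z) # es) \<le> p - vdim R M (X \<inter> Y)" using es(2) Z(4) le by simp
    ultimately show ?thesis by blast
  qed
qed

theorem graph_dist_grassmann:
  assumes "1 \<le> p" "X \<in> grassmannian R M p" "Y \<in> grassmannian R M p"
  shows "graph_dist (grassmann_graph R M p) X Y = ereal (real p - real (vdim R M (X \<inter> Y)))"
proof -
  interpret G: wf_digraph "with_proj (grassmann_graph R M p)" by (rule grassmann_wf_digraph)
  have le: "vdim R M (X \<inter> Y) \<le> p"
    using vdim_mono[OF subspace_Int, of X Y X] assms by (auto simp: grassmannian_iff)
  have cost: "G.awalk_cost (\<lambda>_. 1) es = real (length es)" for es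
    by (simp add: G.awalk_cost_def sum_list_triv)
  show ?thesis
    unfolding graph_dist_def
  proof (rule antisym)
    obtain es where es: "G.awalk X es Y" "length es \<le> p - vdim R M (X \<inter> Y)" using ex_short_awalk[OF assms] by blast
    have "G.\<mu> (\<lambda>_. 1) X Y \<le> ereal (real (length es))" using G.min_cost_le_walk_cost[OF es(1), of "\<lambda>_. 1"] cost by simp
    also have "\<dots> \<le> ereal (real p - real (vdim R M (X \<inter> Y)))" using es(2) le by simp
    finally show "G.\<mu> (\<lambda>_. 1) X Y \<le> ereal (real p - real (vdim R M (X \<inter> Y)))" .
    show "ereal (real p - real (vdim R M (X \<inter> Y))) \<le> G.\<mu> (\<lambda>_. 1) X Y"
      unfolding G.\<mu>_def
    proof (rule INF_greatest)
      fix es assume "es \<in> {es. G.awalk X es Y}"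
      then have "p \<le> vdim R M (X \<inter> Y) + length es" using awalk_length_ge[OF assms(1)] by blast
      then show "ereal (real p - real (vdim R M (X \<inter> Y))) \<le> ereal (G.awalk_cost (\<lambda>_. 1) es)"
        using cost by simp
    qed
  qed
qed

end

section \<open>The two cases\<close>

text \<open>Every independent set extends to a basis, which has exactly \<open>n\<close>
  elements.\<close>

lemma (in fin_vector_space) semilinear_embedding_if_n_embedding:
  assumes "semilinear_m_embedding n R M R' W l" "left_vector_space R' W"
  shows "semilinear_embedding R M R' W l"
  unfolding semilinear_embedding_def
proof (intro conjI allI impI)
  interpret W: left_vector_space R' W by (rule assms(2))
  show "semilinear R M R' W l" "inj_on l (carrier M)" using assms(1) by (auto simp: semilinear_m_embedding_def)
  fix A assume A: "lin_indep R M A"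
  obtain C where C: "A \<subseteq> C" "lin_indep R M C" "lin_span R M C = carrier M" "finite C" "C \<subseteq> carrier M"
    using extend_to_basis[OF subspace_carrier A lin_indep_carrier[OF A]] .
  have "card C = n" using vdim_lin_span[OF C(2,4)] C(3) vdim_carrier by simp
  then have "lin_indep R' W (l ` C)" using assms(1) C by (auto simp: semilinear_m_embedding_def)
  then show "lin_indep R' W (l ` A)" by (rule W.lin_indep_subset) (use C(1) in auto)
qed

section \<open>Stars to stars: embeddings into quotients\<close>

locale star_map_to_subspaces = tgt: fin_vector_space R' V' n' +
  src: grassmann_star_map R V n "{X. submodule X R' V'}" "(\<subseteq>)" "(\<inter>)"
    "\<lambda>X Y. lin_span R' V' (X \<union> Y)" "\<lambda>X. int (vdim R' V' X)" k "int k'" f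
  for R :: "('a, 'r) ring_scheme" and V :: "('a, 'v, 'm) module_scheme"
    and R' :: "('b, 's) ring_scheme" and V' :: "('b, 'w, 'n) module_scheme"
    and n n' k k' :: nat and f :: "'v set \<Rightarrow> 'w set"
begin

lemma kspaces_eq: "src.kspaces = grassmannian R V k"
  by (auto simp: src.kspaces_def src.grassmannian_iff)

abbreviation "S \<equiv> src.induced {\<zero>\<^bsub>V\<^esub>}"

text \<open>The value at the zero subspace has rank K - k = k' - k. Being a dimension, this is not
  negative, which yields k \<le> k' and makes the subtraction of natural numbers exact.\<close>

lemma S: "submodule S R' V'" "int (vdim R' V' S) = int k' - int k" "k \<le> k'" "S \<in> grassmannian R' V' (k' - k)"
proof -
  show s: "submodule S R' V'" and d: "int (vdim R' V' S) = int k' - int k"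
    using src.induced_in_L[OF src.subspace_zero_set] src.rk_induced[OF src.subspace_zero_set] src.vdim_zero by auto
  show "k \<le> k'" using d by linarith
  show "S \<in> grassmannian R' V' (k' - k)" using s d by (auto simp: tgt.grassmannian_iff)
qed

lemma S_subset_f:
  assumes "X \<in> grassmannian R V k"
  shows "S \<subseteq> f X"
proof -
  have X: "X \<in> src.kspaces" using assms kspaces_eq by simp
  note x = src.kspacesD[OF X]
  show ?thesis
    using src.induced_le[OF src.subspace_zero_set x(1)] src.subspace_zero[OF x(1)] x(2) src.induced_kspace_eq[OF X] by simp
qed

text \<open>The surjection is left open so that one verification serves the quotient of the whole
  space and the quotient of a smaller \<open>U\<close>. Because \<open>U\<close> contains all images
  of vertices, it contains the images of points, which are therefore preimages of lines of
  \<open>Q\<close>.\<close>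

lemma coordinatized:
  assumes surj: "subspace_surjection R' V' n' Q U p"
    and kernel: "{x \<in> U. p x = \<zero>\<^bsub>Q\<^esub>} = S" and fU: "\<And>X. X \<in> grassmannian R V k \<Longrightarrow> f X \<subseteq> U"
  shows "coordinatized_star_map R V n {X. submodule X R' V'} (\<subseteq>) (\<inter>)
    (\<lambda>X Y. lin_span R' V' (X \<union> Y)) (\<lambda>X. int (vdim R' V' X)) k (int k') f R' Q
    (\<lambda>T. {x \<in> U. p x \<in> lin_span R' Q T})"
proof -
  interpret P: subspace_surjection R' V' n' Q U p by (rule surj)
  have preim: "{x \<in> U. p x \<in> Y} = P.preim Y" for Y by (simp add: P.preim_def)
  have ker: "P.preim {\<zero>\<^bsub>Q\<^esub>} = S" using kernel by (simp add: P.preim_def)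
  have "coordinatized_star_map_axioms R V {X. submodule X R' V'} (\<subseteq>) (\<inter>) (\<lambda>X. int (vdim R' V' X)) k f R' Q
      (\<lambda>T. P.preim (lin_span R' Q T))"
  proof
    show "P.preim (lin_span R' Q T) \<in> {X. submodule X R' V'}" if "T \<subseteq> carrier Q" for T
      using P.preim_subspace[OF P.Q.lin_span_subspace[OF that]] by simp
    show "P.preim (lin_span R' Q T) \<subseteq> a \<longleftrightarrow>
      P.preim (lin_span R' Q {}) \<subseteq> a \<and> (\<forall>w\<in>T. P.preim (lin_span R' Q {w}) \<subseteq> a)"
      if "T \<subseteq> carrier Q" "a \<in> {X. submodule X R' V'}" for T a
      using P.preim_subset_iff[OF that(1), of a] that(2) by (simp add: P.Q.lin_span_empty)
    show "P.preim (lin_span R' Q {w}) \<subseteq> P.preim (lin_span R' Q T) \<longleftrightarrow> w \<in> lin_span R' Q T"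
      if "T \<subseteq> carrier Q" "w \<in> carrier Q" for T w
      by (rule P.preim_singleton_subset_iff[OF that])
    show "int (vdim R' V' (P.preim (lin_span R' Q {w}))) \<le> int (vdim R' V' (P.preim (lin_span R' Q {}))) + 1"
      if "w \<in> carrier Q" for w
      using P.vdim_preim_singleton_le[OF that] by (simp add: P.Q.lin_span_empty)
    show "P.preim (lin_span R' Q {}) = S" using ker by (simp add: P.Q.lin_span_empty)
    fix x assume x: "x \<in> carrier V" "x \<noteq> \<zero>\<^bsub>V\<^esub>"
    let ?P = "lin_span R V {x}"
    have sP: "submodule ?P R V" using x by (intro src.lin_span_subspace) simp
    have dP: "vdim R V ?P = 1" by (rule src.vdim_singleton[OF x])
    then have dk: "vdim R V ?P \<le> k" using src.k_ge_2 by simp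
    obtain X Y where XY: "X \<in> src.kspaces" "Y \<in> src.kspaces" "X \<inter> Y = ?P" using src.ex_kspaces_Int[OF sP dk] .
    have "src.induced ?P = f X \<inter> f Y" using src.induced_Int[OF src.meets_le_0 XY(1,2)] XY(3) by simp
    then have "src.induced ?P \<subseteq> U" using fU XY(1) kspaces_eq by auto
    moreover have "S \<subseteq> src.induced ?P"
      using src.induced_le[OF src.subspace_zero_set sP _ dk] src.subspace_zero[OF sP] by simp
    moreover have "vdim R' V' (src.induced ?P) = Suc (vdim R' V' S)" using src.rk_induced[OF sP dk] S(2) dP by simp
    ultimately show "\<exists>w\<in>carrier Q. P.preim (lin_span R' Q {w}) = src.induced ?P"
      using P.ex_preim_singleton[of "src.induced ?P"] src.induced_in_L[OF sP dk] unfolding ker by simp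
  qed
  then show ?thesis
    unfolding preim
    by (intro coordinatized_star_map.intro src.grassmann_star_map_axioms P.Q.left_vector_space_axioms)
qed

text \<open>\<open>U\<close> will be the whole space in the general case and the common upper
  subspace of all images when n = 2k.\<close>

lemma ex_embedding_into_quotient:
  assumes U: "submodule U R' V'" "S \<subseteq> U" and fU: "\<And>X. X \<in> grassmannian R V k \<Longrightarrow> f X \<subseteq> U"
  shows "\<exists>l. semilinear_m_embedding (2 * k) R V R' (quot_space (V'\<lparr>carrier := U\<rparr>) S) l \<and>
    (\<forall>X\<in>grassmannian R V k. f X = quot_preimage V' S (lin_span R' (quot_space (V'\<lparr>carrier := U\<rparr>) S) (l ` X)))"
    and "left_vector_space R' (quot_space (V'\<lparr>carrier := U\<rparr>) S)"
proof -
  let ?Q = "quot_space (V'\<lparr>carrier := U\<rparr>) S"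
  note q = tgt.quotient_surjection[OF U(1) S(1) U(2)]
  interpret P: subspace_surjection R' V' n' ?Q U "\<lambda>x. S +>\<^bsub>V'\<^esub> x" by (rule q(1))
  show "left_vector_space R' ?Q" by (rule P.Q.left_vector_space_axioms)
  have ker: "{x \<in> U. S +>\<^bsub>V'\<^esub> x = \<zero>\<^bsub>?Q\<^esub>} = S"
    using tgt.coset_zero_iff[OF S(1)] U(2) P.U_carrier q(2) by auto
  interpret C: coordinatized_star_map R V n "{X. submodule X R' V'}" "(\<subseteq>)" "(\<inter>)"
    "\<lambda>X Y. lin_span R' V' (X \<union> Y)" "\<lambda>X. int (vdim R' V' X)" k "int k'" f R' ?Q
    "\<lambda>T. {x \<in> U. S +>\<^bsub>V'\<^esub> x \<in> lin_span R' ?Q T}"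
    by (rule coordinatized[OF q(1) ker fU])
  obtain l where l: "C.coordinate_map l" using C.ex_coordinate_map by blast
  have "f X = quot_preimage V' S (lin_span R' ?Q (l ` X))" if X: "X \<in> grassmannian R V k" for X
  proof -
    have X': "X \<in> src.kspaces" using X kspaces_eq by simp
    have "l ` X \<subseteq> carrier ?Q" using C.image_subset[OF l] src.subspace_subset[OF src.kspacesD(1)[OF X']] .
    then show ?thesis using C.f_eq_gen[OF l X'] q(3)[OF P.Q.lin_span_carrier] by simp
  qed
  then show "\<exists>l. semilinear_m_embedding (2 * k) R V R' ?Q l \<and>
    (\<forall>X\<in>grassmannian R V k. f X = quot_preimage V' S (lin_span R' ?Q (l ` X)))"
    using C.m_embedding[OF l] by blast
qed

lemma ex_upper_subspace:
  assumes "n = 2 * k"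
  shows "\<exists>U\<in>grassmannian R' V' (k' + k). \<forall>X\<in>grassmannian R V k. f X \<subseteq> U"
proof -
  let ?Q = "quot_space (V'\<lparr>carrier := carrier V'\<rparr>) S"
  have V': "submodule (carrier V') R' V'" "S \<subseteq> carrier V'"
    using tgt.subspace_carrier tgt.subspace_subset[OF S(1)] by auto
  have fV: "f X \<subseteq> carrier V'" if "X \<in> grassmannian R V k" for X
    using src.kspacesD(3)[of X] that kspaces_eq tgt.subspace_subset by auto
  note q = tgt.quotient_surjection[OF V'(1) S(1) V'(2)]
  have ker: "{x \<in> carrier V'. S +>\<^bsub>V'\<^esub> x = \<zero>\<^bsub>?Q\<^esub>} = S"
    using tgt.coset_zero_iff[OF S(1)] V'(2) q(2) by auto
  interpret C: coordinatized_star_map R V n "{X. submodule X R' V'}" "(\<subseteq>)" "(\<inter>)"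
    "\<lambda>X Y. lin_span R' V' (X \<union> Y)" "\<lambda>X. int (vdim R' V' X)" k "int k'" f R' ?Q
    "\<lambda>T. {x \<in> carrier V'. S +>\<^bsub>V'\<^esub> x \<in> lin_span R' ?Q T}"
    by (rule coordinatized[OF q(1) ker fV])
  obtain l where l: "C.coordinate_map l" using C.ex_coordinate_map by blast
  obtain u where "submodule u R' V'" "int (vdim R' V' u) = int k' + int k" "\<forall>X\<in>src.kspaces. f X \<subseteq> u"
    using C.ex_upper_bound[OF l assms] by blast
  then show ?thesis using kspaces_eq by (intro bexI[of _ u]) (auto simp: tgt.grassmannian_iff)
qed

end

section \<open>Stars to tops: embeddings into dual spaces\<close>

locale star_map_to_dual_subspaces = tgt: fin_vector_space R' V' n' +
  src: grassmann_star_map R V n "{X. submodule X R' V'}" "\<lambda>X Y. Y \<subseteq> X"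
    "\<lambda>X Y. lin_span R' V' (X \<union> Y)" "(\<inter>)" "\<lambda>X. - int (vdim R' V' X)" k "- int k'" f
  for R :: "('a, 'r) ring_scheme" and V :: "('a, 'v, 'm) module_scheme"
    and R' :: "('b, 's) ring_scheme" and V' :: "('b, 'w, 'n) module_scheme"
    and n n' k k' :: nat and f :: "'v set \<Rightarrow> 'w set"
begin

lemma kspaces_eq: "src.kspaces = grassmannian R V k"
  by (auto simp: src.kspaces_def src.grassmannian_iff)

abbreviation "U \<equiv> src.induced {\<zero>\<^bsub>V\<^esub>}"

text \<open>With K = -k' the value at the zero subspace has rank -k' - k, that is, dimension k' + k.
  Being the least value in the reversed order means containing all images.\<close>

lemma U: "submodule U R' V'" "vdim R' V' U = k' + k" "U \<in> grassmannian R' V' (k' + k)"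
proof -
  show s: "submodule U R' V'" and d: "vdim R' V' U = k' + k"
    using src.induced_in_L[OF src.subspace_zero_set] src.rk_induced[OF src.subspace_zero_set] src.vdim_zero by auto
  show "U \<in> grassmannian R' V' (k' + k)" using s d by (auto simp: tgt.grassmannian_iff)
qed

lemma f_subset_U:
  assumes "X \<in> grassmannian R V k"
  shows "f X \<subseteq> U"
proof -
  have X: "X \<in> src.kspaces" using assms kspaces_eq by simp
  note x = src.kspacesD[OF X]
  show ?thesis
    using src.induced_le[OF src.subspace_zero_set x(1)] src.subspace_zero[OF x(1)] x(2) src.induced_kspace_eq[OF X] by simp
qed

text \<open>The kernel of \<open>p\<close> is required to lie in every image of a vertex. It then
  lies in the image of every point, and this image, a hyperplane of \<open>U\<close>, is the
  preimage of the kernel of a functional on \<open>Q\<close>.\<close>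

lemma coordinatized:
  assumes surj: "subspace_surjection R' V' n' Q U p"
    and kernel: "\<And>X. X \<in> grassmannian R V k \<Longrightarrow> {x \<in> U. p x = \<zero>\<^bsub>Q\<^esub>} \<subseteq> f X"
  shows "coordinatized_star_map R V n {X. submodule X R' V'} (\<lambda>X Y. Y \<subseteq> X)
    (\<lambda>X Y. lin_span R' V' (X \<union> Y)) (\<inter>) (\<lambda>X. - int (vdim R' V' X)) k (- int k') f
    (opposite_ring R') (dual_space R' Q) (\<lambda>T. {x \<in> U. p x \<in> annihilator R' Q T})"
proof -
  interpret P: subspace_surjection R' V' n' Q U p by (rule surj)
  have preim: "{x \<in> U. p x \<in> Y} = P.preim Y" for Y by (simp add: P.preim_def)
  have ker: "P.preim {\<zero>\<^bsub>Q\<^esub>} \<subseteq> f X" if "X \<in> grassmannian R V k" for X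
    using kernel[OF that] by (simp add: P.preim_def)
  have "coordinatized_star_map_axioms R V {X. submodule X R' V'} (\<lambda>X Y. Y \<subseteq> X)
    (\<lambda>X Y. lin_span R' V' (X \<union> Y)) (\<lambda>X. - int (vdim R' V' X)) k f
    (opposite_ring R') (dual_space R' Q) (\<lambda>T. P.preim (annihilator R' Q T))"
  proof
    show "P.preim (annihilator R' Q T) \<in> {X. submodule X R' V'}" if "T \<subseteq> carrier (dual_space R' Q)" for T
      using P.preim_annihilator_subspace[OF that] by simp
    show "a \<subseteq> P.preim (annihilator R' Q T) \<longleftrightarrow>
      a \<subseteq> P.preim (annihilator R' Q {}) \<and> (\<forall>w\<in>T. a \<subseteq> P.preim (annihilator R' Q {w}))" for T a
      unfolding P.annihilator_empty by (rule P.subset_preim_annihilator_iff)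
    show "P.preim (annihilator R' Q T) \<subseteq> P.preim (annihilator R' Q {w}) \<longleftrightarrow>
      w \<in> lin_span (opposite_ring R') (dual_space R' Q) T"
      if "finite T" "T \<subseteq> carrier (dual_space R' Q)" "w \<in> carrier (dual_space R' Q)" for T w
      by (rule P.preim_annihilator_subset_iff[OF that])
    show "- int (vdim R' V' (P.preim (annihilator R' Q {w}))) \<le> - int (vdim R' V' (P.preim (annihilator R' Q {}))) + 1"
      if "w \<in> carrier (dual_space R' Q)" for w
      using P.vdim_preim_annihilator_ge[OF that] by (simp add: P.annihilator_empty)
    show "P.preim (annihilator R' Q {}) = U" by (rule P.annihilator_empty)
    fix x assume x: "x \<in> carrier V" "x \<noteq> \<zero>\<^bsub>V\<^esub>"
    let ?P = "lin_span R V {x}"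
    have sP: "submodule ?P R V" using x by (intro src.lin_span_subspace) simp
    have dP: "vdim R V ?P = 1" by (rule src.vdim_singleton[OF x])
    then have dk: "vdim R V ?P \<le> k" using src.k_ge_2 by simp
    obtain X Y where XY: "X \<in> src.kspaces" "Y \<in> src.kspaces" "X \<inter> Y = ?P" using src.ex_kspaces_Int[OF sP dk] .
    have "f X \<union> f Y \<subseteq> carrier V'" using src.kspacesD(3)[OF XY(1)] src.kspacesD(3)[OF XY(2)] tgt.subspace_subset by auto
    moreover have "src.induced ?P = lin_span R' V' (f X \<union> f Y)"
      using src.induced_Int[OF src.meets_le_0 XY(1,2)] XY(3) by simp
    ultimately have "f X \<subseteq> src.induced ?P" using tgt.lin_span_superset[of "f X \<union> f Y"] by auto
    then have "P.preim {\<zero>\<^bsub>Q\<^esub>} \<subseteq> src.induced ?P" using ker[of X] XY(1) kspaces_eq by auto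
    moreover have "src.induced ?P \<subseteq> U"
      using src.induced_le[OF src.subspace_zero_set sP _ dk] src.subspace_zero[OF sP] by simp
    moreover have "Suc (vdim R' V' (src.induced ?P)) = vdim R' V' U" using src.rk_induced[OF sP dk] U(2) dP by simp
    ultimately show "\<exists>w\<in>carrier (dual_space R' Q). P.preim (annihilator R' Q {w}) = src.induced ?P"
      using P.ex_preim_annihilator[of "src.induced ?P"] src.induced_in_L[OF sP dk] by simp
  qed
  then show ?thesis
    unfolding preim
    by (intro coordinatized_star_map.intro src.grassmann_star_map_axioms P.Q.dual_left_vector_space)
qed

text \<open>The identity of \<open>U\<close> gives case (B); the quotient map by the common lower
  subspace gives the dual alternative for n = 2k.\<close>

lemma ex_embedding_into_dual:
  assumes surj: "subspace_surjection R' V' n' Q U p"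
    and kernel: "\<And>X. X \<in> grassmannian R V k \<Longrightarrow> {x \<in> U. p x = \<zero>\<^bsub>Q\<^esub>} \<subseteq> f X"
  shows "\<exists>v. semilinear_m_embedding (2 * k) R V (opposite_ring R') (dual_space R' Q) v \<and>
    (\<forall>X\<in>grassmannian R V k. f X =
      {x \<in> U. p x \<in> annihilator R' Q (lin_span (opposite_ring R') (dual_space R' Q) (v ` X))})"
proof -
  interpret P: subspace_surjection R' V' n' Q U p by (rule surj)
  interpret C: coordinatized_star_map R V n "{X. submodule X R' V'}" "\<lambda>X Y. Y \<subseteq> X"
    "\<lambda>X Y. lin_span R' V' (X \<union> Y)" "(\<inter>)" "\<lambda>X. - int (vdim R' V' X)" k "- int k'" f
    "opposite_ring R'" "dual_space R' Q" "\<lambda>T. {x \<in> U. p x \<in> annihilator R' Q T}"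
    by (rule coordinatized[OF surj kernel])
  obtain v where v: "C.coordinate_map v" using C.ex_coordinate_map by blast
  have "f X = {x \<in> U. p x \<in> annihilator R' Q (lin_span (opposite_ring R') (dual_space R' Q) (v ` X))}"
    if X: "X \<in> grassmannian R V k" for X
  proof -
    have X': "X \<in> src.kspaces" using X kspaces_eq by simp
    have "v ` X \<subseteq> carrier (dual_space R' Q)"
      using C.image_subset[OF v] src.subspace_subset[OF src.kspacesD(1)[OF X']] .
    then show ?thesis using C.f_eq_gen[OF v X'] P.Q.annihilator_lin_span by simp
  qed
  then show ?thesis using C.m_embedding[OF v] by blast
qed

lemma ex_embedding_into_dual_of_U:
  "\<exists>v. semilinear_m_embedding (2 * k) R V (opposite_ring R') (dual_space R' (V'\<lparr>carrier := U\<rparr>)) v \<and>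
    (\<forall>X\<in>grassmannian R V k. f X = annihilator R' (V'\<lparr>carrier := U\<rparr>)
      (lin_span (opposite_ring R') (dual_space R' (V'\<lparr>carrier := U\<rparr>)) (v ` X)))"
proof -
  have ker: "{x \<in> U. x = \<zero>\<^bsub>V'\<lparr>carrier := U\<rparr>\<^esub>} \<subseteq> f X" if "X \<in> grassmannian R V k" for X
    using src.kspacesD(3)[of X] that kspaces_eq tgt.subspace_zero by auto
  have eq: "{x \<in> U. x \<in> annihilator R' (V'\<lparr>carrier := U\<rparr>) T} = annihilator R' (V'\<lparr>carrier := U\<rparr>) T" for T
    by (auto simp: annihilator_def)
  show ?thesis using ex_embedding_into_dual[OF tgt.identity_surjection[OF U(1)] ker] unfolding eq .
qed

text \<open>An upper bound in the reversed order is a subspace contained in all images. Its rank -k'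
  + k means dimension k' - k, which also shows k \<le> k'.\<close>

lemma ex_lower_subspace:
  assumes "n = 2 * k"
  shows "k \<le> k' \<and> (\<exists>S\<in>grassmannian R' V' (k' - k). \<forall>X\<in>grassmannian R V k. S \<subseteq> f X)"
proof -
  have ker: "{x \<in> U. x = \<zero>\<^bsub>V'\<lparr>carrier := U\<rparr>\<^esub>} \<subseteq> f X" if "X \<in> grassmannian R V k" for X
    using src.kspacesD(3)[of X] that kspaces_eq tgt.subspace_zero by auto
  interpret C: coordinatized_star_map R V n "{X. submodule X R' V'}" "\<lambda>X Y. Y \<subseteq> X"
    "\<lambda>X Y. lin_span R' V' (X \<union> Y)" "(\<inter>)" "\<lambda>X. - int (vdim R' V' X)" k "- int k'" f
    "opposite_ring R'" "dual_space R' (V'\<lparr>carrier := U\<rparr>)"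
    "\<lambda>T. {x \<in> U. x \<in> annihilator R' (V'\<lparr>carrier := U\<rparr>) T}"
    by (rule coordinatized[OF tgt.identity_surjection[OF U(1)] ker])
  obtain v where v: "C.coordinate_map v" using C.ex_coordinate_map by blast
  obtain s where s: "submodule s R' V'" "- int (vdim R' V' s) = - int k' + int k" "\<forall>X\<in>src.kspaces. s \<subseteq> f X"
    using C.ex_upper_bound[OF v assms] by blast
  then have "k \<le> k'" "vdim R' V' s = k' - k" by linarith+
  moreover have "s \<in> grassmannian R' V' (k' - k)" using s(1) calculation by (simp add: tgt.grassmannian_iff)
  ultimately show ?thesis using s(3) kspaces_eq by auto
qed

end

text \<open>Wherever \<open>k' - k\<close> occurs as a dimension, \<open>k \<le> k'\<close> is
  asserted with it, so that the truncated subtraction is a true one. For n = 2k a (2k)-embedding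
  sends bases to independent sets, which makes it a semilinear embedding.\<close>

theorem theorem4p1:
  fixes R :: "('a, 'r) ring_scheme" and V :: "('a, 'v, 'm) module_scheme"
    and R' :: "('b, 's) ring_scheme" and V' :: "('b, 'w, 'n) module_scheme"
    and n n' k k' :: nat and f :: "'v set \<Rightarrow> 'w set"
  assumes "left_vector_space R V" and "has_dim R V n"
    and "left_vector_space R' V'" and "has_dim R' V' n'"
    and "2 \<le> k" and "k + 2 \<le> n" and "2 \<le> k'" and "k' + 2 \<le> n'"
    and "isometric_embedding (grassmann_graph R V k) (grassmann_graph R' V' k') f"
    and "k \<le> n - k"
  shows
    "((k \<le> k' \<and>
       (\<exists>S\<in>grassmannian R' V' (k' - k). \<exists>l.
          semilinear_m_embedding (2 * k) R V R' (quot_space V' S) l \<and>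
          (\<forall>X\<in>grassmannian R V k.
             f X = quot_preimage V' S (lin_span R' (quot_space V' S) (l ` X)))))
      \<or>
      (\<exists>U\<in>grassmannian R' V' (k' + k). \<exists>v.
          semilinear_m_embedding (2 * k) R V
            (opposite_ring R') (dual_space R' (V'\<lparr>carrier := U\<rparr>)) v \<and>
          (\<forall>X\<in>grassmannian R V k.
             f X = annihilator R' (V'\<lparr>carrier := U\<rparr>)
                     (lin_span (opposite_ring R') (dual_space R' (V'\<lparr>carrier := U\<rparr>)) (v ` X)))))
     \<and>
     (n = 2 * k \<longrightarrow>
       k \<le> k' \<and>
       (\<exists>S\<in>grassmannian R' V' (k' - k). \<exists>U\<in>grassmannian R' V' (k' + k). S \<subset> U \<and>
         ((\<exists>l. semilinear_embedding R V R' (quot_space (V'\<lparr>carrier := U\<rparr>) S) l \<and>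
             (\<forall>X\<in>grassmannian R V k.
                f X = quot_preimage V' S
                        (lin_span R' (quot_space (V'\<lparr>carrier := U\<rparr>) S) (l ` X))))
          \<or>
          (\<exists>w. semilinear_embedding R V
                 (opposite_ring R') (dual_space R' (quot_space (V'\<lparr>carrier := U\<rparr>) S)) w \<and>
             (\<forall>X\<in>grassmannian R V k.
                f X = quot_preimage V' S
                        (annihilator R' (quot_space (V'\<lparr>carrier := U\<rparr>) S)
                          (lin_span (opposite_ring R')
                            (dual_space R' (quot_space (V'\<lparr>carrier := U\<rparr>) S)) (w ` X))))))))"
    (is "?AB \<and> (n = 2 * k \<longrightarrow> ?C)")
proof -
  interpret src: fin_vector_space R V n
    using assms(1,2) by (simp add: fin_vector_space_def fin_vector_space_axioms_def)
  interpret tgt: fin_vector_space R' V' n'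
    using assms(3,4) by (simp add: fin_vector_space_def fin_vector_space_axioms_def)
  have emb: "graph_embedding (grassmann_graph R V k) (grassmann_graph R' V' k') f"
    and iso: "\<And>X Y. X \<in> grassmannian R V k \<Longrightarrow> Y \<in> grassmannian R V k \<Longrightarrow>
      graph_dist (grassmann_graph R' V' k') (f X) (f Y) = graph_dist (grassmann_graph R V k) X Y"
    using assms(9) by (auto simp: isometric_embedding_def src.grassmann_graph_simps)
  have fG: "f X \<in> grassmannian R' V' k'" if "X \<in> grassmannian R V k" for X
    using emb that by (auto simp: graph_embedding_def src.grassmann_graph_simps tgt.grassmann_graph_simps)
  have dist: "int (vdim R' V' (f X \<inter> f Y)) = int k' - int k + int (vdim R V (X \<inter> Y))"
    if "X \<in> grassmannian R V k" "Y \<in> grassmannian R V k" for X Y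
  proof -
    \<comment> \<open>Both distances are the defects of the intersection dimensions; the detour
      through the reals is due to the type of \<open>graph_dist\<close>.\<close>
    have "real k' - real (vdim R' V' (f X \<inter> f Y)) = real k - real (vdim R V (X \<inter> Y))"
      using iso[OF that] src.graph_dist_grassmann[OF _ that] tgt.graph_dist_grassmann[OF _ fG fG, OF _ that] assms(5,7)
      by simp
    then have "real_of_int (int (vdim R' V' (f X \<inter> f Y))) = real_of_int (int k' - int k + int (vdim R V (X \<inter> Y)))"
      by simp
    then show ?thesis by (simp only: of_int_eq_iff)
  qed
  interpret L: rank_lattice "{X. submodule X R' V'}" "(\<subseteq>)" "(\<inter>)" "\<lambda>X Y. lin_span R' V' (X \<union> Y)" "\<lambda>X. int (vdim R' V' X)"
    by (rule tgt.subspace_rank_lattice)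
  interpret F: grassmann_rank_map R V n "{X. submodule X R' V'}" "(\<subseteq>)" "(\<inter>)"
    "\<lambda>X Y. lin_span R' V' (X \<union> Y)" "\<lambda>X. int (vdim R' V' X)" k "int k'" f
  proof
    show "2 \<le> k" "2 * k \<le> n" using assms(5,10) assms(6) by auto
    show "f X \<in> {X. submodule X R' V'}" "int (vdim R' V' (f X)) = int k'" if "submodule X R V" "vdim R V X = k" for X
      using fG[of X] that by (auto simp: src.grassmannian_iff tgt.grassmannian_iff)
    show "int (vdim R' V' (f X \<inter> f Y)) = int k' - int k + int (vdim R V (X \<inter> Y))"
      if "submodule X R V" "vdim R V X = k" "submodule Y R V" "vdim R V Y = k" for X Y
      using dist[of X Y] that by (simp add: src.grassmannian_iff)
  qed
  \<comment> \<open>One vertex is enough to see that S \<subset> U: the inclusions pass through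
    \<open>f X0\<close>, and the dimensions k' - k and k' + k differ because k > 0.\<close>
  obtain X0 where X0: "X0 \<in> grassmannian R V k"
    using F.ex_kspaces_Int[OF src.subspace_zero_set] src.vdim_zero by (auto simp: F.kspaces_def src.grassmannian_iff)
  have strict: "S \<subset> U"
    if "S \<in> grassmannian R' V' (k' - k)" "U \<in> grassmannian R' V' (k' + k)" "S \<subseteq> f X0" "f X0 \<subseteq> U" for S U
    using that assms(5) by (auto simp: tgt.grassmannian_iff)
  from F.star_type_constant show ?thesis
  proof
    assume "\<forall>A. submodule A R V \<and> Suc (vdim R V A) = k \<longrightarrow> F.star_to_star A"
    then have "F.meets_le 0" using F.meets_le_zero by blast
    then interpret A: star_map_to_subspaces R V R' V' n n' k k' f
      by (intro star_map_to_subspaces.intro tgt.fin_vector_space_axioms grassmann_star_map.intro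
          F.grassmann_rank_map_axioms grassmann_star_map_axioms.intro)
    have fV: "f X \<subseteq> carrier V'" if "X \<in> grassmannian R V k" for X
      using fG[OF that] tgt.subspace_subset by (simp add: tgt.grassmannian_iff)
    have "?AB"
      using A.ex_embedding_into_quotient(1)[OF tgt.subspace_carrier tgt.subspace_subset[OF A.S(1)] fV] A.S(3,4)
      by auto
    moreover have "?C" if n: "n = 2 * k"
    proof -
      obtain U where U: "U \<in> grassmannian R' V' (k' + k)" "\<And>X. X \<in> grassmannian R V k \<Longrightarrow> f X \<subseteq> U"
        using A.ex_upper_subspace[OF n] by blast
      have sU: "submodule U R' V'" using U(1) by (simp add: tgt.grassmannian_iff)
      have SU: "A.S \<subset> U" using strict[OF A.S(4) U(1) A.S_subset_f[OF X0] U(2)[OF X0]] .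
      note E = A.ex_embedding_into_quotient[OF sU psubset_imp_subset[OF SU] U(2)]
      obtain l where l: "semilinear_m_embedding (2 * k) R V R' (quot_space (V'\<lparr>carrier := U\<rparr>) A.S) l"
        "\<forall>X\<in>grassmannian R V k. f X = quot_preimage V' A.S (lin_span R' (quot_space (V'\<lparr>carrier := U\<rparr>) A.S) (l ` X))"
        using E(1) by blast
      have "semilinear_embedding R V R' (quot_space (V'\<lparr>carrier := U\<rparr>) A.S) l"
        using src.semilinear_embedding_if_n_embedding[OF _ E(2)] l(1) n by simp
      then show ?C using A.S(3,4) U(1) SU l(2) by blast
    qed
    ultimately show ?thesis by blast
  next
    interpret D: grassmann_rank_map R V n "{X. submodule X R' V'}" "\<lambda>X Y. Y \<subseteq> X"
      "\<lambda>X Y. lin_span R' V' (X \<union> Y)" "(\<inter>)" "\<lambda>X. - int (vdim R' V' X)" k "- int k'" f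
      by (rule F.dual)
    assume "\<forall>A. submodule A R V \<and> Suc (vdim R V A) = k \<longrightarrow> F.star_to_top A"
    \<comment> \<open>In the reversed order, stars going to tops reads as stars going to stars, so
      the same induction applies.\<close>
    then have "D.meets_le 0" using D.meets_le_zero F.star_dual(1) by blast
    then interpret B: star_map_to_dual_subspaces R V R' V' n n' k k' f
      by (intro star_map_to_dual_subspaces.intro tgt.fin_vector_space_axioms grassmann_star_map.intro
          D.grassmann_rank_map_axioms grassmann_star_map_axioms.intro)
    have "?AB" using B.ex_embedding_into_dual_of_U B.U(3) by blast
    moreover have "?C" if n: "n = 2 * k"
    proof -
      obtain S where S: "k \<le> k'" "S \<in> grassmannian R' V' (k' - k)" "\<And>X. X \<in> grassmannian R V k \<Longrightarrow> S \<subseteq> f X"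
        using B.ex_lower_subspace[OF n] by blast
      have sS: "submodule S R' V'" using S(2) by (simp add: tgt.grassmannian_iff)
      have SU: "S \<subset> B.U" using strict[OF S(2) B.U(3) S(3)[OF X0] B.f_subset_U[OF X0]] .
      let ?Q = "quot_space (V'\<lparr>carrier := B.U\<rparr>) S"
      note q = tgt.quotient_surjection[OF B.U(1) sS psubset_imp_subset[OF SU]]
      interpret P: subspace_surjection R' V' n' ?Q B.U "\<lambda>x. S +>\<^bsub>V'\<^esub> x" by (rule q(1))
      have ker: "{x \<in> B.U. S +>\<^bsub>V'\<^esub> x = \<zero>\<^bsub>?Q\<^esub>} \<subseteq> f X" if "X \<in> grassmannian R V k" for X
        using tgt.coset_zero_iff[OF sS] P.U_carrier q(2) S(3)[OF that] by auto
      obtain w where w: "semilinear_m_embedding (2 * k) R V (opposite_ring R') (dual_space R' ?Q) w"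
        "\<forall>X\<in>grassmannian R V k. f X =
          {x \<in> B.U. S +>\<^bsub>V'\<^esub> x \<in> annihilator R' ?Q (lin_span (opposite_ring R') (dual_space R' ?Q) (w ` X))}"
        using B.ex_embedding_into_dual[OF q(1) ker] by blast
      have "semilinear_embedding R V (opposite_ring R') (dual_space R' ?Q) w"
        using src.semilinear_embedding_if_n_embedding[OF _ P.Q.dual_left_vector_space] w(1) n by simp
      \<comment> \<open>An annihilator in \<open>?Q\<close> consists of vectors of
        \<open>?Q\<close>, so its preimage in the whole space lies in \<open>B.U\<close>.\<close>
      moreover have "quot_preimage V' S (annihilator R' ?Q T) = {x \<in> B.U. S +>\<^bsub>V'\<^esub> x \<in> annihilator R' ?Q T}" for T
        by (rule q(3)) (auto simp: annihilator_def)
      then have "\<forall>X\<in>grassmannian R V k. f X = quot_preimage V' S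
          (annihilator R' ?Q (lin_span (opposite_ring R') (dual_space R' ?Q) (w ` X)))"
        using w(2) by (simp only:)
      ultimately have "\<exists>w. semilinear_embedding R V (opposite_ring R') (dual_space R' ?Q) w \<and>
          (\<forall>X\<in>grassmannian R V k. f X = quot_preimage V' S
            (annihilator R' ?Q (lin_span (opposite_ring R') (dual_space R' ?Q) (w ` X))))"
        by (intro exI[of _ w] conjI)
      then show ?C by (intro conjI[OF S(1)] bexI[OF _ S(2)] bexI[OF _ B.U(3)] conjI[OF SU] disjI2)
    qed
    ultimately show ?thesis by blast
  qed
qed

end
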